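(* Let $A\in L^2_{\rm loc}(\mathbb{R}^+)$ be the coefficient of a Krein system whose spectral measure $\sigma$ satisfies $\operatorname{supp}(d\sigma)\ne\mathbb{R}$. For a compact set $K\subset\mathbb{C}^+$ let $N_K(r)$ denote the number of zeroes of $P(r,\cdot)$ in $K$. Then for every compact $K\subset\mathbb{C}^+$ $$\sup_{r>0}N_K(r)<\infty .$$
   Context: $\mathbb{C}^+$ is the open upper half-plane; zeroes are counted with multiplicity. Krein system: for complex-valued $A\in L^2_{\rm loc}(\mathbb{R}^+)$ (i.e. $A\in L^2[0,R]$ for all $R>0$) and $\lambda\in\mathbb{C}$, $P(r,\lambda),P_*(r,\lambda)$ solve $P'=i\lambda P-\overline{A(r)}P_*$, $P_*'=-A(r)P$, $P(0,\lambda)=P_*(0,\lambda)=1$. Spectral measure: an accelerant is a function $H\in L^2_{\rm loc}(\mathbb{R})$ with $H(-x)=\overline{H(x)}$ such that for every $r>0$ the operator $(\mathcal{H}_rf)(x)=\int_0^rH(x-t)f(t)dt$ on $L^2[0,r]$ satisfies $I+\mathcal{H}_r>0$; its resolvent kernel $\Gamma_r$ satisfies $\Gamma_r(t,s)+\int_0^rH(t-u)\Gamma_r(u,s)du=H(t-s)$. Each $A\in L^2_{\rm loc}(\mathbb{R}^+)$ has a unique accelerant $H$ with $\overline{A(r)}=H(r)-\int_0^rH(r-u)\Gamma_r(u,0)du$ for a.e. $r$. The spectral measure $\sigma$ is the unique positive Borel measure on $\mathbb{R}$ with $\int\frac{d\sigma(\lambda)}{1+\lambda^2}<\infty$ such that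 for some $\beta\in\mathbb{R}$ and all $x\in\mathbb{R}$ $$\frac{|x|}{2}+\int_0^x(x-s)H(s)ds=i\beta x+\int_{-\infty}^\infty\left(1+\frac{i\lambda x}{1+\lambda^2}-e^{i\lambda x}\right)\frac{d\sigma(\lambda)}{\lambda^2}$$ (integrand extended by continuity to $\lambda=0$). Equivalently, $\sigma$ is the weak-$*$ limit of $\frac{d\lambda}{2\pi|P_*(r,\lambda)|^2}$ as $r\to\infty$. *)

theory Defs
  imports "HOL-Complex_Analysis.Complex_Analysis" "HOL-Library.Extended_Nat"
begin

definition L2_on :: "real set \<Rightarrow> (real \<Rightarrow> complex) \<Rightarrow> bool" where
  "L2_on S f \<longleftrightarrow> set_borel_measurable lebesgue S f \<and>
     set_integrable lebesgue S (\<lambda>x. (cmod (f x))\<^sup>2)"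

definition L2_loc_halfline :: "(real \<Rightarrow> complex) \<Rightarrow> bool" where
  "L2_loc_halfline A \<longleftrightarrow> (\<forall>R>0. L2_on {0..R} A)"

definition L2_loc_line :: "(real \<Rightarrow> complex) \<Rightarrow> bool" where
  "L2_loc_line H \<longleftrightarrow> (\<forall>R>0. L2_on {-R..R} H)"

text \<open>As \<open>A\<close> is only locally square integrable, a solution of the Krein system is a
  solution in the sense of Caratheodory (locally absolutely continuous, equations almost
  everywhere), that is, a continuous solution of the integrated system.\<close>

definition krein_system ::
  "(real \<Rightarrow> complex) \<Rightarrow> (real \<Rightarrow> complex \<Rightarrow> complex) \<Rightarrow> (real \<Rightarrow> complex \<Rightarrow> complex) \<Rightarrow> bool" where
  "krein_system A P Ps \<longleftrightarrow> (\<forall>z.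
     continuous_on {0..} (\<lambda>r. P r z) \<and> continuous_on {0..} (\<lambda>r. Ps r z) \<and>
     (\<forall>r\<ge>0. P r z = 1 + (LINT s:{0..r}|lebesgue. \<i> * z * P s z - cnj (A s) * Ps s z)) \<and>
     (\<forall>r\<ge>0. Ps r z = 1 + (LINT s:{0..r}|lebesgue. - A s * P s z)))"

definition conv_op :: "(real \<Rightarrow> complex) \<Rightarrow> real \<Rightarrow> (real \<Rightarrow> complex) \<Rightarrow> real \<Rightarrow> complex" where
  "conv_op H r f x = (LINT t:{0..r}|lebesgue. H (x - t) * f t)"

definition L2_inner :: "real \<Rightarrow> (real \<Rightarrow> complex) \<Rightarrow> (real \<Rightarrow> complex) \<Rightarrow> complex" where
  "L2_inner r f g = (LINT x:{0..r}|lebesgue. f x * cnj (g x))"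

definition positive_operator :: "real \<Rightarrow> ((real \<Rightarrow> complex) \<Rightarrow> real \<Rightarrow> complex) \<Rightarrow> bool" where
  "positive_operator r T \<longleftrightarrow>
     (\<forall>f. L2_on {0..r} f \<and> \<not> (AE x\<in>{0..r} in lebesgue. f x = 0) \<longrightarrow>
        L2_inner r (T f) f \<in> \<real> \<and> Re (L2_inner r (T f) f) > 0)"

definition accelerant :: "(real \<Rightarrow> complex) \<Rightarrow> bool" where
  "accelerant H \<longleftrightarrow> L2_loc_line H \<and> (AE x in lebesgue. H (- x) = cnj (H x)) \<and>
     (\<forall>r>0. positive_operator r (\<lambda>f x. f x + conv_op H r f x))"

text \<open>The equation is required for every \<open>s\<close> and almost every \<open>t\<close>: this determines each
  section \<open>G (\<cdot>, s)\<close>, in particular \<open>G (\<cdot>, 0)\<close>, as an element of \<open>L\<^sup>2[0, r]\<close>.\<close>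

definition resolvent_kernel ::
  "(real \<Rightarrow> complex) \<Rightarrow> real \<Rightarrow> (real \<Rightarrow> real \<Rightarrow> complex) \<Rightarrow> bool" where
  "resolvent_kernel H r G \<longleftrightarrow> (\<forall>s\<in>{0..r}. L2_on {0..r} (\<lambda>t. G t s) \<and>
     (AE t\<in>{0..r} in lebesgue.
        G t s + (LINT u:{0..r}|lebesgue. H (t - u) * G u s) = H (t - s)))"

definition accelerant_of :: "(real \<Rightarrow> complex) \<Rightarrow> (real \<Rightarrow> complex) \<Rightarrow> bool" where
  "accelerant_of A H \<longleftrightarrow> accelerant H \<and>
     (\<exists>G. (\<forall>r>0. resolvent_kernel H r (G r)) \<and>
        (AE r\<in>{0<..} in lebesgue.
           cnj (A r) = H r - (LINT u:{0..r}|lebesgue. H (r - u) * G r u 0)))"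

definition spectral_integrand :: "real \<Rightarrow> real \<Rightarrow> complex" where
  "spectral_integrand x l =
     (if l = 0 then of_real (x\<^sup>2 / 2)
      else (1 + \<i> * of_real (l * x) / of_real (1 + l\<^sup>2) - exp (\<i> * of_real (l * x)))
             / of_real (l\<^sup>2))"

text \<open>The integral of \<open>(x - s) H s\<close> is oriented, so that it is minus the integral over
  \<open>[x, 0]\<close> when \<open>x < 0\<close>.\<close>

definition spectral_measure :: "(real \<Rightarrow> complex) \<Rightarrow> real measure \<Rightarrow> bool" where
  "spectral_measure A \<sigma> \<longleftrightarrow> sets \<sigma> = sets borel \<and>
     (\<integral>\<^sup>+ l. ennreal (1 / (1 + l\<^sup>2)) \<partial>\<sigma>) < \<infinity> \<and>
     (\<exists>H. accelerant_of A H \<and>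
       (\<exists>\<beta>::real. \<forall>x::real.
          of_real (\<bar>x\<bar> / 2) +
            (LINT s=ereal 0..ereal x|lebesgue. (of_real (x - s) * H s)) =
          \<i> * of_real (\<beta> * x) + (LINT l|\<sigma>. spectral_integrand x l)))"

definition measure_support :: "'a::topological_space measure \<Rightarrow> 'a set" where
  "measure_support \<mu> = {x. \<forall>U. open U \<and> x \<in> U \<longrightarrow> emeasure \<mu> U > 0}"

text \<open>The multiplicity of a zero of a holomorphic function that is not locally constant is
  its \<open>zorder\<close>; the count is infinite if there are infinitely many zeroes in \<open>K\<close>.\<close>

definition zero_count :: "(complex \<Rightarrow> complex) \<Rightarrow> complex set \<Rightarrow> enat" where
  "zero_count f K =
     (if finite {z \<in> K. f z = 0} then enat (\<Sum>z\<in>{z \<in> K. f z = 0}. nat (zorder f z)) else \<infinity>)"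

end

theory Submission
  imports Defs
begin

text \<open>Write \<open>P(r, \<lambda>) = e\<^bsup>i\<lambda>r\<^esup> Q(\<lambda>)\<close> with \<open>Q(\<lambda>) = 1 - \<integral> \<Gamma>\<^sub>r(s, 0) e\<^bsup>-i\<lambda>s\<^esup> ds\<close> over \<open>[0, r]\<close>. The equation of the
  resolvent kernel says that \<open>Q\<close> is orthogonal in \<open>L\<^sup>2(\<sigma>)\<close> to every \<open>F\<close> for which \<open>\<lambda>\<^sup>2 F(\<lambda>)\<close> is the
  Fourier transform of a measure on \<open>[0, r]\<close> with an atom at \<open>0\<close> only. If \<open>Q\<close> has zeroes
  \<open>z\<^sub>1, \<dots>, z\<^sub>2\<^sub>N\<close> in \<open>K\<close>, then \<open>F = S Q / \<Prod>(\<lambda> - z\<^sub>j)\<close> is such a function for every polynomial \<open>S\<close> of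
  degree at most \<open>2N - 2\<close>, so the integral of \<open>|Q|\<^sup>2 S / \<Prod>(\<lambda> - z\<^sub>j)\<close> vanishes. Let \<open>\<zeta>\<close> lie in the
  upper half-plane close to a gap of the support. Split the zeroes into two groups of size \<open>N\<close>
  and let \<open>B\<^sub>1, B\<^sub>2\<close> be the products of the factors \<open>(\<lambda> - cnj z\<^sub>j) / (\<lambda> - z\<^sub>j)\<close>, which are unimodular on
  the real line. One may choose \<open>S\<close> such that the quotient equals
  \<open>(1 - B\<^sub>1(\<lambda>) / B\<^sub>1(\<zeta>)) (1 - B\<^sub>2(\<lambda>) / B\<^sub>2(\<zeta>)) / (\<lambda> - \<zeta>)\<^sup>2\<close>. For large \<open>N\<close> the numbers \<open>B\<^sub>i(\<zeta>)\<close> are large,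
  uniformly in the zeroes, and the real part of the quotient is positive off the gap, a
  contradiction.\<close>

subsection \<open>Square integrable functions and convolution\<close>

text \<open>\<open>P\<close> is given by a differential system in r, \<open>\<sigma>\<close> by the
  accelerant; the bridge is \<open>Q\<close>, and showing that \<open>P\<close> is its exponential
  multiple takes up a large share of the work. The obstacle is regularity: accelerant and
  coefficient are only locally square integrable, so the resolvent kernel has no pointwise
  derivative in r. Its increments over (a, b] are estimated instead, up to a small factor times an
  additive function of the interval, and such errors sum to something arbitrarily small. The measure
  is known only through a second antiderivative of its Fourier transform; this is why \<lambda>^2 F,
  and not F, has to be a transform. The square in the denominator decides the sign: with u the
  distance along the real line and t the height of \<zeta>, Re 1/(u - it) is odd in u, whereas Re
  1/(u - it)^2 is (u^2 - t^2)/(u^2 + t^2)^2, positive for |u| > t on both sides of the gap. Two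
  groups of zeroes are used because each factor 1 - B/B(\<zeta>) has a zero at \<zeta> and removes
  one of the two poles there.\<close>

lemma borel_measurable_cnj [measurable (raw)]:
  fixes f :: "'a \<Rightarrow> complex"
  assumes "f \<in> borel_measurable M"
  shows "(\<lambda>x. cnj (f x)) \<in> borel_measurable M"
  using assms by (rule measurable_compose) (intro borel_measurable_continuous_onI continuous_intros)

text \<open>Borel rather than Lebesgue measurability, so that composition and Fubini's theorem apply
  directly; representatives of this kind are supplied at the end.\<close>

definition sq_integrable :: "(real \<Rightarrow> complex) \<Rightarrow> bool" where
  "sq_integrable f \<longleftrightarrow> f \<in> borel_measurable borel \<and> integrable lborel (\<lambda>x. (cmod (f x))\<^sup>2)"

definition norm2 :: "(real \<Rightarrow> complex) \<Rightarrow> real" where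
  "norm2 f = sqrt (LINT x|lborel. (cmod (f x))\<^sup>2)"

lemma sq_integrable_measurable [measurable_dest]: "sq_integrable f \<Longrightarrow> f \<in> borel_measurable borel"
  by (simp add: sq_integrable_def)

lemma sq_integrableD: "sq_integrable f \<Longrightarrow> integrable lborel (\<lambda>x. (cmod (f x))\<^sup>2)"
  by (simp add: sq_integrable_def)

lemma norm2_nonneg [simp]: "norm2 f \<ge> 0"
  by (simp add: norm2_def)

lemma norm2_square: "(norm2 f)\<^sup>2 = (LINT x|lborel. (cmod (f x))\<^sup>2)"
  by (simp add: norm2_def)

lemma sq_integrable_bound:
  assumes "f \<in> borel_measurable borel" "sq_integrable g" "AE x in lborel. cmod (f x) \<le> cmod (g x)"
  shows "sq_integrable f" "norm2 f \<le> norm2 g"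
proof -
  have sq: "AE x in lborel. (cmod (f x))\<^sup>2 \<le> (cmod (g x))\<^sup>2"
    using assms(3) by eventually_elim (simp add: power_mono)
  have "integrable lborel (\<lambda>x. (cmod (f x))\<^sup>2)"
    by (rule Bochner_Integration.integrable_bound[OF sq_integrableD[OF assms(2)]])
       (use assms(1) sq in auto)
  then show f: "sq_integrable f" using assms(1) by (simp add: sq_integrable_def)
  show "norm2 f \<le> norm2 g"
    unfolding norm2_def real_sqrt_le_iff
    by (rule integral_mono_AE) (use sq_integrableD[OF f] sq_integrableD[OF assms(2)] sq in auto)
qed

lemma norm2_cong_AE:
  assumes "f \<in> borel_measurable borel" "g \<in> borel_measurable borel" "AE x in lborel. f x = g x"
  shows "norm2 f = norm2 g"
proof -
  have "(LINT x|lborel. (cmod (f x))\<^sup>2) = (LINT x|lborel. (cmod (g x))\<^sup>2)"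
    by (rule integral_cong_AE) (use assms in \<open>auto elim: eventually_mono\<close>)
  then show ?thesis by (simp add: norm2_def)
qed

lemma sq_integrable_cmult:
  assumes "sq_integrable f"
  shows "sq_integrable (\<lambda>x. c * f x)" "norm2 (\<lambda>x. c * f x) = cmod c * norm2 f"
proof -
  have [measurable]: "f \<in> borel_measurable borel" using assms by measurable
  show "sq_integrable (\<lambda>x. c * f x)"
    using sq_integrableD[OF assms] by (simp add: sq_integrable_def norm_mult power_mult_distrib)
  show "norm2 (\<lambda>x. c * f x) = cmod c * norm2 f"
    by (simp add: norm2_def norm_mult power_mult_distrib real_sqrt_mult)
qed

lemma sq_integrable_cnj:
  assumes "sq_integrable f"
  shows "sq_integrable (\<lambda>x. cnj (f x))" "norm2 (\<lambda>x. cnj (f x)) = norm2 f"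
  using assms by (auto simp: sq_integrable_def norm2_def)

lemma sq_integrable_add:
  assumes f: "sq_integrable f" and g: "sq_integrable g"
  shows "sq_integrable (\<lambda>x. f x + g x)"
proof -
  have [measurable]: "f \<in> borel_measurable borel" "g \<in> borel_measurable borel" using assms by measurable
  have "integrable lborel (\<lambda>x. (cmod (f x + g x))\<^sup>2)"
  proof (rule Bochner_Integration.integrable_bound)
    show "integrable lborel (\<lambda>x. 2 * (cmod (f x))\<^sup>2 + 2 * (cmod (g x))\<^sup>2)"
      using sq_integrableD[OF f] sq_integrableD[OF g] by simp
    have "(cmod (f x + g x))\<^sup>2 \<le> 2 * (cmod (f x))\<^sup>2 + 2 * (cmod (g x))\<^sup>2" for x
    proof -
      have "(cmod (f x + g x))\<^sup>2 \<le> (cmod (f x) + cmod (g x))\<^sup>2"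
        by (intro power_mono norm_triangle_ineq) auto
      also have "\<dots> \<le> 2 * (cmod (f x))\<^sup>2 + 2 * (cmod (g x))\<^sup>2"
        using sum_squares_bound[of "cmod (f x)" "cmod (g x)"] by (simp add: power2_sum)
      finally show ?thesis .
    qed
    then show "AE x in lborel. norm ((cmod (f x + g x))\<^sup>2) \<le> norm (2 * (cmod (f x))\<^sup>2 + 2 * (cmod (g x))\<^sup>2)"
      by (intro AE_I2) simp
  qed simp
  then show ?thesis by (simp add: sq_integrable_def)
qed

lemma sq_integrable_diff:
  assumes f: "sq_integrable f" and g: "sq_integrable g"
  shows "sq_integrable (\<lambda>x. f x - g x)"
  using sq_integrable_add[OF f sq_integrable_cmult(1)[OF g, of "-1"]] by simp

lemma Cauchy_Schwarz_integral:
  assumes f: "sq_integrable f" and g: "sq_integrable g"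
  shows "integrable lborel (\<lambda>x. cmod (f x) * cmod (g x))"
    and "(LINT x|lborel. cmod (f x) * cmod (g x)) \<le> norm2 f * norm2 g"
proof -
  have [measurable]: "f \<in> borel_measurable borel" "g \<in> borel_measurable borel" using assms by measurable
  show i: "integrable lborel (\<lambda>x. cmod (f x) * cmod (g x))"
  proof (rule Bochner_Integration.integrable_bound)
    show "integrable lborel (\<lambda>x. (cmod (f x))\<^sup>2 + (cmod (g x))\<^sup>2)"
      using sq_integrableD[OF f] sq_integrableD[OF g] by simp
    have "cmod (f x) * cmod (g x) \<le> (cmod (f x))\<^sup>2 + (cmod (g x))\<^sup>2" for x
      using sum_squares_bound[of "cmod (f x)" "cmod (g x)"]
        mult_nonneg_nonneg[OF norm_ge_zero norm_ge_zero, of "f x" "g x"] by (simp only: mult.assoc)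
    then show "AE x in lborel. norm (cmod (f x) * cmod (g x)) \<le> norm ((cmod (f x))\<^sup>2 + (cmod (g x))\<^sup>2)"
      by (intro AE_I2) auto
  qed simp
  have eq: "(\<integral>\<^sup>+x. ennreal (cmod (u x)) ^ 2 \<partial>lborel) = ennreal ((norm2 u)\<^sup>2)" if "sq_integrable u" for u
    using sq_integrableD[OF that] unfolding norm2_square
    by (subst nn_integral_eq_integral[symmetric]) (auto simp: ennreal_power)
  have "(\<integral>\<^sup>+x. ennreal (cmod (f x)) * ennreal (cmod (g x)) \<partial>lborel)\<^sup>2 \<le> ennreal ((norm2 f)\<^sup>2) * ennreal ((norm2 g)\<^sup>2)"
    using Cauchy_Schwarz_nn_integral[of "\<lambda>x. ennreal (cmod (f x))" lborel "\<lambda>x. ennreal (cmod (g x))"]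
    by (simp add: eq f g)
  moreover have "(\<integral>\<^sup>+x. ennreal (cmod (f x)) * ennreal (cmod (g x)) \<partial>lborel) = ennreal (LINT x|lborel. cmod (f x) * cmod (g x))"
    using i by (subst nn_integral_eq_integral[symmetric]) (auto simp: ennreal_mult)
  ultimately have "(LINT x|lborel. cmod (f x) * cmod (g x))\<^sup>2 \<le> (norm2 f * norm2 g)\<^sup>2"
    by (simp add: ennreal_power ennreal_mult[symmetric] power_mult_distrib)
  then show "(LINT x|lborel. cmod (f x) * cmod (g x)) \<le> norm2 f * norm2 g"
    by (rule power2_le_imp_le) simp
qed

lemma integral_mult_le_norm2:
  assumes f: "sq_integrable f" and g: "sq_integrable g"
  shows "integrable lborel (\<lambda>x. f x * g x)" "cmod (LINT x|lborel. f x * g x) \<le> norm2 f * norm2 g"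
proof -
  have [measurable]: "f \<in> borel_measurable borel" "g \<in> borel_measurable borel" using assms by measurable
  show "integrable lborel (\<lambda>x. f x * g x)"
    by (rule Bochner_Integration.integrable_bound[OF Cauchy_Schwarz_integral(1)[OF f g]]) (auto simp: norm_mult)
  have "cmod (LINT x|lborel. f x * g x) \<le> (LINT x|lborel. cmod (f x * g x))"
    by (rule integral_norm_bound)
  also have "\<dots> \<le> norm2 f * norm2 g"
    using Cauchy_Schwarz_integral(2)[OF f g] by (simp add: norm_mult)
  finally show "cmod (LINT x|lborel. f x * g x) \<le> norm2 f * norm2 g" .
qed

lemma norm2_triangle:
  assumes f: "sq_integrable f" and g: "sq_integrable g"
  shows "norm2 (\<lambda>x. f x + g x) \<le> norm2 f + norm2 g"
proof -
  note fg = sq_integrable_add[OF f g]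
  note I = sq_integrableD[OF f] sq_integrableD[OF g] Cauchy_Schwarz_integral(1)[OF f g]
  have "(norm2 (\<lambda>x. f x + g x))\<^sup>2 \<le> (LINT x|lborel. (cmod (f x))\<^sup>2 + (cmod (g x))\<^sup>2 + 2 * (cmod (f x) * cmod (g x)))"
    unfolding norm2_square
  proof (rule integral_mono)
    show "integrable lborel (\<lambda>x. (cmod (f x + g x))\<^sup>2)" using fg by (rule sq_integrableD)
    show "integrable lborel (\<lambda>x. (cmod (f x))\<^sup>2 + (cmod (g x))\<^sup>2 + 2 * (cmod (f x) * cmod (g x)))"
      using I by auto
    fix x
    have "(cmod (f x + g x))\<^sup>2 \<le> (cmod (f x) + cmod (g x))\<^sup>2"
      by (intro power_mono norm_triangle_ineq) auto
    then show "(cmod (f x + g x))\<^sup>2 \<le> (cmod (f x))\<^sup>2 + (cmod (g x))\<^sup>2 + 2 * (cmod (f x) * cmod (g x))"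
      by (simp add: power2_sum algebra_simps)
  qed
  also have "\<dots> = (norm2 f)\<^sup>2 + (norm2 g)\<^sup>2 + 2 * (LINT x|lborel. cmod (f x) * cmod (g x))"
    using I by (simp add: norm2_square)
  also have "\<dots> \<le> (norm2 f + norm2 g)\<^sup>2"
    using Cauchy_Schwarz_integral(2)[OF f g] by (simp add: power2_sum)
  finally show ?thesis by (rule power2_le_imp_le) simp
qed

lemma norm2_triangle_diff:
  assumes f: "sq_integrable f" and g: "sq_integrable g"
  shows "norm2 (\<lambda>x. f x - g x) \<le> norm2 f + norm2 g"
  using norm2_triangle[OF f sq_integrable_cmult(1)[OF g, of "-1"]] sq_integrable_cmult(2)[OF g, of "-1"]
  by simp

lemma sq_integrable_affine:
  assumes f: "sq_integrable f"
  shows "sq_integrable (\<lambda>x. f (t - x))" "norm2 (\<lambda>x. f (t - x)) = norm2 f"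
    "sq_integrable (\<lambda>x. f (x - t))" "norm2 (\<lambda>x. f (x - t)) = norm2 f"
proof -
  have [measurable]: "f \<in> borel_measurable borel" using assms by measurable
  have "integrable lborel (\<lambda>x. (cmod (f (t + (-1) * x)))\<^sup>2)"
    by (rule lborel_integrable_real_affine[OF sq_integrableD[OF f]]) simp
  then show "sq_integrable (\<lambda>x. f (t - x))" by (simp add: sq_integrable_def)
  have "integrable lborel (\<lambda>x. (cmod (f (- t + 1 * x)))\<^sup>2)"
    by (rule lborel_integrable_real_affine[OF sq_integrableD[OF f]]) simp
  then show "sq_integrable (\<lambda>x. f (x - t))" by (simp add: sq_integrable_def)
  have "(LINT x|lborel. (cmod (f x))\<^sup>2) = (LINT x|lborel. (cmod (f (t + (-1) * x)))\<^sup>2)"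
    by (subst lborel_integral_real_affine[of "-1" _ t]) auto
  then show "norm2 (\<lambda>x. f (t - x)) = norm2 f" by (simp add: norm2_def)
  have "(LINT x|lborel. (cmod (f x))\<^sup>2) = (LINT x|lborel. (cmod (f (- t + 1 * x)))\<^sup>2)"
    by (subst lborel_integral_real_affine[of 1 _ "-t"]) auto
  then show "norm2 (\<lambda>x. f (x - t)) = norm2 f" by (simp add: norm2_def)
qed

section \<open>Truncation, and functions on bounded intervals\<close>

definition cut :: "real set \<Rightarrow> (real \<Rightarrow> complex) \<Rightarrow> real \<Rightarrow> complex" where
  "cut S f = (\<lambda>x. if x \<in> S then f x else 0)"

lemma cut_measurable [measurable]:
  assumes [measurable]: "f \<in> borel_measurable borel" "S \<in> sets borel"
  shows "cut S f \<in> borel_measurable borel"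
  unfolding cut_def by measurable

lemma sq_integrable_cut:
  assumes f: "sq_integrable f" and [measurable]: "S \<in> sets borel"
  shows "sq_integrable (cut S f)" "norm2 (cut S f) \<le> norm2 f"
proof -
  have [measurable]: "f \<in> borel_measurable borel" using assms by measurable
  show "sq_integrable (cut S f)" "norm2 (cut S f) \<le> norm2 f"
    by (rule sq_integrable_bound[OF _ f]; simp add: cut_def)+
qed

lemma sq_integrable_interval:
  assumes [measurable]: "f \<in> borel_measurable borel" and "a \<le> b" "B \<ge> 0"
    and "\<And>x. x \<in> {a..b} \<Longrightarrow> cmod (f x) \<le> B" "\<And>x. x \<notin> {a..b} \<Longrightarrow> f x = 0"
  shows "sq_integrable f" "norm2 f \<le> B * sqrt (b - a)"
proof -
  define g :: "real \<Rightarrow> complex" where "g = (\<lambda>x. indicator {a..b} x *\<^sub>R of_real B)"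
  have eq: "(cmod (g x))\<^sup>2 = B\<^sup>2 * indicator {a..b} x" for x
    by (simp add: g_def indicator_def)
  have g: "sq_integrable g"
    unfolding sq_integrable_def eq by (auto simp: g_def emeasure_lborel_Icc_eq intro!: integrable_real_indicator)
  have n: "norm2 g = B * sqrt (b - a)"
    unfolding norm2_def eq using \<open>a \<le> b\<close> \<open>B \<ge> 0\<close> by (simp add: real_sqrt_mult)
  have "AE x in lborel. cmod (f x) \<le> cmod (g x)"
    using assms(3-5) by (intro AE_I2) (auto simp: g_def indicator_def)
  from sq_integrable_bound[OF assms(1) g this] show "sq_integrable f" "norm2 f \<le> B * sqrt (b - a)"
    by (simp_all add: n)
qed

lemma sq_integrable_imp_integrable:
  assumes f: "sq_integrable f" and "a \<le> b" "\<And>x. x \<notin> {a..b} \<Longrightarrow> f x = 0"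
  shows "integrable lborel f" "(LINT x|lborel. cmod (f x)) \<le> sqrt (b - a) * norm2 f"
proof -
  define g :: "real \<Rightarrow> complex" where "g = cut {a..b} (\<lambda>x. 1)"
  have g: "sq_integrable g" "norm2 g \<le> 1 * sqrt (b - a)"
    by (rule sq_integrable_interval[where a=a and b=b and B=1]; use \<open>a \<le> b\<close> in \<open>simp add: g_def cut_def\<close>)+
  have "(\<lambda>x. f x * g x) = f" using assms(3) by (fastforce simp: g_def cut_def)
  then show "integrable lborel f" using integral_mult_le_norm2(1)[OF f g(1)] by simp
  have "(\<lambda>x. cmod (f x) * cmod (g x)) = (\<lambda>x. cmod (f x))" using assms(3) by (fastforce simp: g_def cut_def)
  then have "(LINT x|lborel. cmod (f x)) \<le> norm2 f * norm2 g"
    using Cauchy_Schwarz_integral(2)[OF f g(1)] by simp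
  also have "\<dots> \<le> norm2 f * sqrt (b - a)" using g(2) by (intro mult_left_mono) auto
  finally show "(LINT x|lborel. cmod (f x)) \<le> sqrt (b - a) * norm2 f" by (simp add: mult.commute)
qed

section \<open>Pointwise bounds for convolutions\<close>

definition conv :: "(real \<Rightarrow> complex) \<Rightarrow> (real \<Rightarrow> complex) \<Rightarrow> real \<Rightarrow> complex" where
  "conv h f x = (LINT u|lborel. h (x - u) * f u)"

lemma conv_measurable [measurable]:
  assumes [measurable]: "h \<in> borel_measurable borel" "f \<in> borel_measurable borel"
  shows "conv h f \<in> borel_measurable borel"
  unfolding conv_def by measurable

lemma conv_integrable:
  assumes "sq_integrable h" "sq_integrable f"
  shows "integrable lborel (\<lambda>u. h (x - u) * f u)"
  using integral_mult_le_norm2(1)[OF sq_integrable_affine(1)[OF assms(1)] assms(2)] .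

lemma conv_bound:
  assumes "sq_integrable h" "sq_integrable f"
  shows "cmod (conv h f x) \<le> norm2 h * norm2 f"
  using integral_mult_le_norm2(2)[OF sq_integrable_affine(1)[OF assms(1), of x] assms(2)]
  by (simp add: conv_def sq_integrable_affine(2)[OF assms(1)])

lemma conv_diff_right:
  assumes "sq_integrable h" "sq_integrable f" "sq_integrable g"
  shows "conv h (\<lambda>x. f x - g x) t = conv h f t - conv h g t"
  unfolding conv_def using conv_integrable[OF assms(1,2), of t] conv_integrable[OF assms(1,3), of t]
  by (subst Bochner_Integration.integral_diff[symmetric]) (auto simp: algebra_simps)

lemma conv_add_right:
  assumes "sq_integrable h" "sq_integrable f" "sq_integrable g"
  shows "conv h (\<lambda>x. f x + g x) t = conv h f t + conv h g t"
  unfolding conv_def using conv_integrable[OF assms(1,2), of t] conv_integrable[OF assms(1,3), of t]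
  by (subst Bochner_Integration.integral_add[symmetric]) (auto simp: algebra_simps)

lemma conv_cmult_right: "conv h (\<lambda>x. c * f x) t = c * conv h f t"
  unfolding conv_def by (subst integral_mult_right_zero[symmetric]) (simp add: algebra_simps)

section \<open>Density of continuous functions and continuity of translations\<close>

lemma norm2_tendsto:
  fixes s :: "nat \<Rightarrow> real \<Rightarrow> complex"
  assumes [measurable]: "\<And>n. s n \<in> borel_measurable borel" "f \<in> borel_measurable borel"
    and d: "sq_integrable d"
    and lim: "AE x in lborel. (\<lambda>n. s n x) \<longlonglongrightarrow> f x"
    and bound: "\<And>n. AE x in lborel. cmod (s n x - f x) \<le> cmod (d x)"
  shows "(\<lambda>n. norm2 (\<lambda>x. s n x - f x)) \<longlonglongrightarrow> 0"
proof -
  have "(\<lambda>n. LINT x|lborel. (cmod (s n x - f x))\<^sup>2) \<longlonglongrightarrow> (LINT x|(lborel::real measure). (0::real))"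
  proof (rule integral_dominated_convergence)
    show "integrable lborel (\<lambda>x. (cmod (d x))\<^sup>2)" by (rule sq_integrableD[OF d])
    show "AE x in lborel. (\<lambda>n. (cmod (s n x - f x))\<^sup>2) \<longlonglongrightarrow> 0"
      using lim by eventually_elim (auto intro!: tendsto_eq_intros)
    show "AE x in lborel. norm ((cmod (s n x - f x))\<^sup>2) \<le> (cmod (d x))\<^sup>2" for n
      using bound[of n] by eventually_elim (simp add: power_mono)
  qed auto
  then have "(\<lambda>n. sqrt (LINT x|lborel. (cmod (s n x - f x))\<^sup>2)) \<longlonglongrightarrow> sqrt 0"
    by (intro tendsto_real_sqrt) simp
  then show ?thesis by (simp add: norm2_def)
qed

text \<open>For M > 0 the radial retraction of the plane onto the disc of radius M: it bounds
  approximants without destroying their continuity.\<close>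

definition clip :: "real \<Rightarrow> complex \<Rightarrow> complex" where
  "clip M z = z / of_real (max 1 (cmod z / M))"

lemma continuous_on_clip [continuous_intros]:
  assumes "continuous_on S f" "M > 0"
  shows "continuous_on S (\<lambda>x. clip M (f x))"
  unfolding clip_def using assms
  by (intro continuous_intros) (auto simp: max_def)

lemma clip_bound:
  assumes "M > 0"
  shows "cmod (clip M z) \<le> M" "cmod (clip M z) \<le> cmod z" "cmod (clip M z - z) \<le> cmod z"
    "cmod z \<le> M \<Longrightarrow> clip M z = z"
proof -
  define m where "m = max 1 (cmod z / M)"
  have m: "m \<ge> 1" "m \<ge> cmod z / M" by (simp_all add: m_def)
  have c: "cmod (clip M z) = cmod z / m" using m by (simp add: clip_def m_def[symmetric] norm_divide)
  show "cmod (clip M z) \<le> M" using m assms by (simp add: c field_simps)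
  show "cmod (clip M z) \<le> cmod z" using m mult_left_mono[OF m(1), of "cmod z"] by (simp add: c field_simps)
  have "clip M z - z = z * of_real (1 / m - 1)" using m by (simp add: clip_def m_def[symmetric] field_simps)
  then have "cmod (clip M z - z) = cmod z * \<bar>1 / m - 1\<bar>" by (simp add: norm_mult del: of_real_diff)
  also have "\<bar>1 / m - 1\<bar> \<le> 1" using m by (simp add: abs_le_iff field_simps)
  then have "cmod z * \<bar>1 / m - 1\<bar> \<le> cmod z" using mult_left_mono[of _ 1 "cmod z"] by simp
  finally show "cmod (clip M z - z) \<le> cmod z" .
  show "clip M z = z" if "cmod z \<le> M"
    using that assms by (simp add: clip_def max_def)
qed

text \<open>Almost everywhere convergence of continuous functions gives norm convergence only under
  a dominating function. Hence two stages: the values of f are clipped, with f as majorant; then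
  continuous functions converging to f are clipped at the same height and cut off in space, with a
  constant on a bounded interval as majorant.\<close>

lemma continuous_approx_norm2:
  assumes f: "sq_integrable f" and supp: "\<And>x. x \<notin> {-R..R} \<Longrightarrow> f x = 0" and "R > 0" "e > 0"
  obtains G where "continuous_on UNIV G" "\<And>x. x \<notin> {-R-1..R+1} \<Longrightarrow> G x = 0"
    "sq_integrable G" "norm2 (\<lambda>x. G x - f x) < e"
proof -
  have fm[measurable]: "f \<in> borel_measurable borel" using f by measurable
  have clipm[measurable]: "clip M \<in> borel_measurable borel" if "M > 0" for M
    using that by (intro borel_measurable_continuous_onI continuous_intros)
  have "(\<lambda>n. norm2 (\<lambda>x. clip (real (Suc n)) (f x) - f x)) \<longlonglongrightarrow> 0"
  proof (rule norm2_tendsto[OF _ fm f])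
    show "AE x in lborel. (\<lambda>n. clip (real (Suc n)) (f x)) \<longlonglongrightarrow> f x"
    proof (intro AE_I2 tendsto_eventually)
      fix x
      obtain n0 :: nat where "cmod (f x) \<le> real n0" using real_arch_simple by blast
      then show "\<forall>\<^sub>F n in sequentially. clip (real (Suc n)) (f x) = f x"
        by (intro eventually_sequentiallyI[of n0] clip_bound(4)) auto
    qed
    show "AE x in lborel. cmod (clip (real (Suc n)) (f x) - f x) \<le> cmod (f x)" for n
      by (intro AE_I2 clip_bound) auto
  qed (auto intro!: measurable_compose[OF fm clipm])
  then have "\<forall>\<^sub>F n in sequentially. norm2 (\<lambda>x. clip (real (Suc n)) (f x) - f x) < e / 2"
    by (rule order_tendstoD) (use \<open>e > 0\<close> in simp)
  then obtain n where n: "norm2 (\<lambda>x. clip (real (Suc n)) (f x) - f x) < e / 2"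
    by (meson eventually_sequentially le_refl)
  define M where "M = real (Suc n)"
  have M: "M > 0" by (simp add: M_def)
  define fM where "fM = (\<lambda>x. clip M (f x))"
  have fMm[measurable]: "fM \<in> borel_measurable borel"
    unfolding fM_def by (rule measurable_compose[OF fm clipm[OF M]])
  have fM: "sq_integrable fM"
    by (rule sq_integrable_bound[OF _ f]) (auto simp: fM_def clip_bound M)
  have "f \<in> borel_measurable lebesgue" using fm by (simp add: measurable_completion)
  then have "f measurable_on UNIV"
    using lebesgue_measurable_imp_measurable_on by (metis sets.top space_completion space_lborel sets_completionI_sets sets_lborel UNIV_I borel_open open_UNIV)
  then obtain N g where N: "negligible N" and g: "\<And>n. continuous_on UNIV (g n)"
    and lim: "\<And>x. x \<notin> N \<Longrightarrow> (\<lambda>n. g n x) \<longlonglongrightarrow> f x"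
    unfolding measurable_on_def by auto
  \<comment> \<open>A trapezoid: 1 on [-R, R], where f lives, and 0 outside [-R - 1, R + 1].\<close>
  define \<phi> :: "real \<Rightarrow> real" where "\<phi> = (\<lambda>x. max 0 (min 1 (R + 1 - \<bar>x\<bar>)))"
  define G where "G = (\<lambda>n x. of_real (\<phi> x) * clip M (g n x))"
  have Gc: "continuous_on UNIV (G n)" for n
    unfolding G_def \<phi>_def using g M by (intro continuous_intros)
  have [measurable]: "G n \<in> borel_measurable borel" for n
    by (rule borel_measurable_continuous_onI[OF Gc])
  have G0: "G n x = 0" if "x \<notin> {-R-1..R+1}" for n x
    using that by (auto simp: G_def \<phi>_def max_def min_def abs_if split: if_splits)
  have \<phi>: "\<bar>\<phi> x\<bar> \<le> 1" for x by (simp add: \<phi>_def)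
  have GM: "cmod (G n x) \<le> M" for n x
    using mult_mono[OF \<phi>[of x] clip_bound(1)[OF M, of "g n x"]] by (simp add: G_def norm_mult)
  have fM0: "fM x = 0" if "x \<notin> {-R-1..R+1}" for x
    using that supp[of x] by (auto simp: fM_def clip_def)
  define d where "d = cut {-R-1..R+1} (\<lambda>x. of_real (2*M))"
  have d: "sq_integrable d"
    by (rule sq_integrable_interval(1)[where a="-R-1" and b="R+1" and B="2*M"])
       (use M \<open>R > 0\<close> in \<open>auto simp: d_def cut_def\<close>)
  have "(\<lambda>n. norm2 (\<lambda>x. G n x - fM x)) \<longlonglongrightarrow> 0"
  proof (rule norm2_tendsto[OF _ fMm d])
    have "AE x in lborel. x \<notin> N"
      using N AE_completion_iff[of "\<lambda>x. x \<notin> N" lborel] AE_not_in[of N lebesgue]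
      by (simp add: negligible_iff_null_sets)
    then show "AE x in lborel. (\<lambda>n. G n x) \<longlonglongrightarrow> fM x"
    proof eventually_elim
      case (elim x)
      have "(\<lambda>n. clip M (g n x)) \<longlonglongrightarrow> clip M (f x)"
        by (rule continuous_on_tendsto_compose[of UNIV "clip M"])
           (use lim[OF elim] M in \<open>auto intro!: continuous_intros\<close>)
      then have "(\<lambda>n. G n x) \<longlonglongrightarrow> of_real (\<phi> x) * fM x"
        unfolding G_def fM_def by (intro tendsto_intros)
      moreover have "of_real (\<phi> x) * fM x = fM x"
        using supp[of x] by (cases "x \<in> {-R..R}") (auto simp: \<phi>_def fM_def clip_def)
      ultimately show ?case by simp
    qed
    show "AE x in lborel. cmod (G n x - fM x) \<le> cmod (d x)" for n
    proof (rule AE_I2)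
      fix x
      show "cmod (G n x - fM x) \<le> cmod (d x)"
      proof (cases "x \<in> {-R-1..R+1}")
        case True
        have "cmod (G n x - fM x) \<le> M + M"
          using norm_triangle_ineq4[of "G n x" "fM x"] GM[of n x] clip_bound(1)[OF M, of "f x"]
          unfolding fM_def by linarith
        then show ?thesis using True M by (simp add: d_def cut_def)
      qed (simp add: G0 fM0)
    qed
  qed measurable
  then have "\<forall>\<^sub>F n in sequentially. norm2 (\<lambda>x. G n x - fM x) < e / 2"
    by (rule order_tendstoD) (use \<open>e > 0\<close> in simp)
  then obtain k where k: "norm2 (\<lambda>x. G k x - fM x) < e / 2"
    by (meson eventually_sequentially le_refl)
  have Gk: "sq_integrable (G k)"
    by (rule sq_integrable_interval(1)[where a="-R-1" and b="R+1" and B="M"])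
       (use M \<open>R > 0\<close> GM G0 in auto)
  have "norm2 (\<lambda>x. (G k x - fM x) + (fM x - f x)) < e"
    using norm2_triangle[OF sq_integrable_diff[OF Gk fM] sq_integrable_diff[OF fM f]] k n
    by (simp add: fM_def M_def)
  then have "norm2 (\<lambda>x. G k x - f x) < e" by simp
  from that[OF Gc G0 Gk this] show thesis by simp
qed

text \<open>Uniform continuity settles the claim for a continuous approximant, and the distance from
  f to the approximant is invariant under translation and reflection.\<close>

lemma translation_continuity:
  assumes f: "sq_integrable f" and supp: "\<And>x. x \<notin> {-R..R} \<Longrightarrow> f x = 0" and "R > 0" "e > 0"
  obtains \<delta> where "\<delta> > 0" "\<And>a b. \<bar>a - b\<bar> < \<delta> \<Longrightarrow> norm2 (\<lambda>u. f (u - a) - f (u - b)) < e"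
    "\<And>a b. \<bar>a - b\<bar> < \<delta> \<Longrightarrow> norm2 (\<lambda>u. f (a - u) - f (b - u)) < e"
proof -
  obtain G where Gc: "continuous_on UNIV G" and G0: "\<And>x. x \<notin> {-R-1..R+1} \<Longrightarrow> G x = 0"
    and G: "sq_integrable G" and Ge: "norm2 (\<lambda>x. G x - f x) < e / 3"
    using continuous_approx_norm2[OF f supp \<open>R > 0\<close>, of "e/3"] \<open>e > 0\<close> by auto
  \<comment> \<open>The root of the length of [-R - 2, R + 2], outside which G and its translates by
    at most 1 vanish. With \<open>\<eta>\<close> chosen accordingly the three errors are e/4, e/3
    and e/3.\<close>
  define L where "L = sqrt (2 * R + 4)"
  have L: "L > 0" using \<open>R > 0\<close> by (simp add: L_def)
  define \<eta> where "\<eta> = e / (4 * L)"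
  have \<eta>: "\<eta> > 0" using L \<open>e > 0\<close> by (simp add: \<eta>_def)
  have "uniformly_continuous_on {-R-2..R+2} G"
    by (intro compact_uniformly_continuous continuous_on_subset[OF Gc]) auto
  then obtain d where d: "d > 0" and du: "\<And>x y. x \<in> {-R-2..R+2} \<Longrightarrow> y \<in> {-R-2..R+2} \<Longrightarrow> dist y x < d \<Longrightarrow> dist (G y) (G x) < \<eta>"
    unfolding uniformly_continuous_on_def using \<eta> by metis
  define \<delta> where "\<delta> = min d 1"
  have \<delta>: "\<delta> > 0" "\<delta> \<le> 1" "\<delta> \<le> d" using d by (auto simp: \<delta>_def)
  have key: "norm2 (\<lambda>u. f (u + t) - f u) < e" if t: "\<bar>t\<bar> < \<delta>" for t
  proof -
    have t': "\<bar>t\<bar> \<le> 1" "\<bar>t\<bar> < d" using t \<delta> by auto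
    have [measurable]: "G \<in> borel_measurable borel" using G by measurable
    have small: "cmod (G (x + t) - G x) \<le> \<eta>" if "x \<in> {-R-2..R+2}" for x
    proof (cases "x + t \<in> {-R-2..R+2}")
      case True
      then show ?thesis using du[of x "x+t"] t' that by (simp add: dist_norm)
    next
      case False
      then have "x \<notin> {-R-1..R+1}" "x + t \<notin> {-R-1..R+1}" using t'(1) by auto
      then show ?thesis using G0 \<eta> by simp
    qed
    have zero: "G (x + t) - G x = 0" if "x \<notin> {-R-2..R+2}" for x
    proof -
      have "x \<notin> {-R-1..R+1}" "x + t \<notin> {-R-1..R+1}" using t'(1) that by auto
      then show ?thesis using G0 by simp
    qed
    have n: "sq_integrable (\<lambda>u. G (u + t) - G u)" "norm2 (\<lambda>u. G (u + t) - G u) \<le> \<eta> * sqrt ((R + 2) - (- R - 2))"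
      using sq_integrable_interval[of "\<lambda>u. G (u + t) - G u" "-R-2" "R+2" \<eta>] small zero \<open>R > 0\<close> \<eta> by auto
    have "sqrt ((R + 2) - (- R - 2)) = L" by (simp add: L_def)
    then have n2: "norm2 (\<lambda>u. G (u + t) - G u) \<le> e / 4" using n(2) L by (simp add: \<eta>_def field_simps)
    have G': "sq_integrable (\<lambda>u. G u - f u)" using sq_integrable_diff[OF G f] .
    have s: "sq_integrable (\<lambda>u. G (u + t) - f (u + t))" "norm2 (\<lambda>u. G (u + t) - f (u + t)) < e / 3"
      using sq_integrable_affine(3,4)[OF G', of "-t"] Ge by simp_all
    have "norm2 (\<lambda>u. (G (u + t) - G u) - (G (u + t) - f (u + t)) + (G u - f u)) < e"
      using norm2_triangle[OF sq_integrable_diff[OF n(1) s(1)] G'] norm2_triangle_diff[OF n(1) s(1)] n2 s(2) Ge \<open>e > 0\<close>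
      by linarith
    moreover have "(\<lambda>u. (G (u + t) - G u) - (G (u + t) - f (u + t)) + (G u - f u)) = (\<lambda>u. f (u + t) - f u)"
      by (simp add: fun_eq_iff)
    ultimately show ?thesis by simp
  qed
  have d: "sq_integrable (\<lambda>u. f (u + t) - f u)" for t
    using sq_integrable_diff[OF sq_integrable_affine(3)[OF f, of "-t"] f] by simp
  show thesis
  proof (rule that[OF \<delta>(1)])
    fix a b assume ab: "\<bar>a - b\<bar> < \<delta>"
    show "norm2 (\<lambda>u. f (u - a) - f (u - b)) < e"
      using sq_integrable_affine(4)[OF d[of "b - a"], of b] key[of "b - a"] ab by (simp add: abs_minus_commute)
    show "norm2 (\<lambda>u. f (a - u) - f (b - u)) < e"
      using sq_integrable_affine(2)[OF d[of "a - b"], of b] key[of "a - b"] ab by (simp add: abs_minus_commute)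
  qed
qed

text \<open>If \<open>\<parallel>f\<^sub>n\<parallel> = 1\<close> and \<open>(I + H) f\<^sub>n \<rightarrow> 0\<close>, then the functions \<open>H f\<^sub>n\<close> are equicontinuous, so
  that by Arzela-Ascoli a subsequence of \<open>f\<^sub>n\<close> converges, to an element of the kernel.\<close>

lemma convolution_bounded_below:
  assumes h: "sq_integrable h" and supp: "\<And>x. x \<notin> {-R..R} \<Longrightarrow> h x = 0" and "R > 0"
    and inj: "\<And>\<rho> f. \<lbrakk>0 < \<rho>; \<rho> \<le> R; sq_integrable f; \<And>x. x \<notin> {0..\<rho>} \<Longrightarrow> f x = 0;
        AE t in lborel. t \<in> {0..\<rho>} \<longrightarrow> f t + conv h f t = 0\<rbrakk> \<Longrightarrow> AE t in lborel. f t = 0"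
  obtains C where "C > 0" "\<And>r f. \<lbrakk>0 < r; r \<le> R; sq_integrable f; \<And>x. x \<notin> {0..r} \<Longrightarrow> f x = 0\<rbrakk> \<Longrightarrow>
      norm2 f \<le> C * norm2 (cut {0..r} (\<lambda>t. f t + conv h f t))"
proof (rule ccontr)
  define T where "T r f = cut {0..r} (\<lambda>t. f t + conv h f t)" for r f
  assume no: "\<not> thesis"
  have "\<exists>r f. 0 < r \<and> r \<le> R \<and> sq_integrable f \<and> (\<forall>x. x \<notin> {0..r} \<longrightarrow> f x = 0) \<and> norm2 f > real (Suc n) * norm2 (T r f)" for n
  proof (rule ccontr)
    assume "\<not> ?thesis"
    then show False using no that[of "real (Suc n)"] by (force simp: T_def not_less)
  qed
  then obtain rr ff where rr: "\<And>n. 0 < rr n" "\<And>n. rr n \<le> R" and ff: "\<And>n. sq_integrable (ff n)"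
    "\<And>n x. x \<notin> {0..rr n} \<Longrightarrow> ff n x = 0" and ffT: "\<And>n. norm2 (ff n) > real (Suc n) * norm2 (T (rr n) (ff n))"
    by metis
  have hm[measurable]: "h \<in> borel_measurable borel" using h by measurable
  have npos: "norm2 (ff n) > 0" for n
    using ffT[of n] by (meson le_less_trans mult_nonneg_nonneg norm2_nonneg of_nat_0_le_iff)
  define f where "f n = (\<lambda>x. of_real (1 / norm2 (ff n)) * ff n x)" for n
  have f: "sq_integrable (f n)" for n unfolding f_def by (rule sq_integrable_cmult(1)[OF ff(1)])
  have fm[measurable]: "f n \<in> borel_measurable borel" for n using f by measurable
  have f1: "norm2 (f n) = 1" for n
    unfolding f_def sq_integrable_cmult(2)[OF ff(1)] using npos[of n] by (simp add: norm_divide)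
  have f0: "f n x = 0" if "x \<notin> {0..rr n}" for n x using ff(2)[OF that] by (simp add: f_def)
  have Tf: "T (rr n) (f n) = (\<lambda>x. of_real (1 / norm2 (ff n)) * T (rr n) (ff n) x)" for n
    unfolding T_def f_def conv_cmult_right cut_def by (auto simp: fun_eq_iff add_divide_distrib)
  have sqT: "sq_integrable (T r g)" if g: "sq_integrable g" for r g
  proof -
    have [measurable]: "g \<in> borel_measurable borel" using g by measurable
    have "sq_integrable (cut {0..max r 0} (conv h g))"
      by (rule sq_integrable_interval(1)[where a=0 and b="max r 0" and B="norm2 h * norm2 g"])
         (auto simp: cut_def conv_bound[OF h g])
    from sq_integrable_add[OF sq_integrable_cut(1)[OF g, of "{0..max r 0}"] this]
    have "sq_integrable (T (max r 0) g)" by (simp add: T_def cut_def if_distrib cong: if_cong)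
    then show ?thesis
      by (rule sq_integrable_bound(1)[rotated]) (auto simp: T_def cut_def)
  qed
  have Tlim: "(\<lambda>n. norm2 (T (rr n) (f n))) \<longlonglongrightarrow> 0"
  proof (rule tendsto_sandwich[OF _ _ tendsto_const LIMSEQ_inverse_real_of_nat])
    have "norm2 (T (rr n) (f n)) \<le> inverse (real (Suc n))" for n
    proof -
      have "norm2 (T (rr n) (f n)) = norm2 (T (rr n) (ff n)) / norm2 (ff n)"
        unfolding Tf sq_integrable_cmult(2)[OF sqT[OF ff(1)]] using npos[of n] by (simp add: norm_divide)
      also have "\<dots> \<le> inverse (real (Suc n))"
        using ffT[of n] npos[of n] by (simp add: field_simps del: of_nat_Suc)
      finally show ?thesis .
    qed
    then show "\<forall>\<^sub>F n in sequentially. norm2 (T (rr n) (f n)) \<le> inverse (real (Suc n))" by simp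
  qed simp
  \<comment> \<open>The constant has to serve all radii at once, so the radii vary along the
    sequence and must converge too.\<close>
  have "seq_compact {0..R}" by (simp add: compact_imp_seq_compact)
  moreover have "\<forall>n. rr n \<in> {0..R}" using rr by (auto intro: less_imp_le)
  ultimately obtain \<rho> s1 where \<rho>: "\<rho> \<in> {0..R}" and s1: "strict_mono s1" "(rr \<circ> s1) \<longlonglongrightarrow> \<rho>"
    unfolding seq_compact_def by blast
  have Fb: "cmod (conv h (f n) x) \<le> norm2 h" for n x
    using conv_bound[OF h f, of n x] f1 by simp
  obtain G s2 where G: "continuous_on {0..R} G" and s2: "strict_mono (s2 :: nat \<Rightarrow> nat)"
    and unif: "\<And>e. 0 < e \<Longrightarrow> \<exists>N. \<forall>n x. n \<ge> N \<and> x \<in> {0..R} \<longrightarrow> norm (conv h (f (s1 (s2 n))) x - G x) < e"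
  proof (rule Arzela_Ascoli[of "{0..R}" "\<lambda>n. conv h (f (s1 n))" "norm2 h"])
    show "compact {0..R}" by simp
    show "norm (conv h (f (s1 n)) x) \<le> norm2 h" for n x by (rule Fb)
    fix x e :: real assume "0 < e"
    obtain \<delta> where \<delta>: "\<delta> > 0" "\<And>a b. \<bar>a - b\<bar> < \<delta> \<Longrightarrow> norm2 (\<lambda>u. h (a - u) - h (b - u)) < e"
      using translation_continuity[OF h supp \<open>R > 0\<close> \<open>0 < e\<close>] by metis
    have "norm (conv h (f (s1 n)) x - conv h (f (s1 n)) y) < e" if "norm (x - y) < \<delta>" for n y
    proof -
      have "conv h (f (s1 n)) x - conv h (f (s1 n)) y = (LINT u|lborel. (h (x - u) - h (y - u)) * f (s1 n) u)"
        unfolding conv_def using conv_integrable[OF h f]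
        by (subst Bochner_Integration.integral_diff[symmetric]) (auto simp: algebra_simps)
      also have "cmod \<dots> \<le> norm2 (\<lambda>u. h (x - u) - h (y - u)) * norm2 (f (s1 n))"
        by (rule integral_mult_le_norm2(2)[OF sq_integrable_diff[OF sq_integrable_affine(1)[OF h] sq_integrable_affine(1)[OF h]] f])
      also have "\<dots> < e" using \<delta>(2)[of x y] that f1 by simp
      finally show ?thesis .
    qed
    then show "\<exists>d>0. \<forall>n y. y \<in> {0..R} \<and> norm (x - y) < d \<longrightarrow> norm (conv h (f (s1 n)) x - conv h (f (s1 n)) y) < e"
      using \<delta>(1) by blast
  qed blast
  define s where "s = s1 \<circ> s2"
  have s: "strict_mono s" unfolding s_def by (intro strict_mono_o s1 s2)
  have slim: "(\<lambda>n. rr (s n)) \<longlonglongrightarrow> \<rho>"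
    using LIMSEQ_subseq_LIMSEQ[OF s1(2) s2] by (simp add: s_def o_def)
  have Tlim': "(\<lambda>n. norm2 (T (rr (s n)) (f (s n)))) \<longlonglongrightarrow> 0"
    using LIMSEQ_subseq_LIMSEQ[OF Tlim s] by (simp add: o_def)
  have ptw: "(\<lambda>n. conv h (f (s n)) x) \<longlonglongrightarrow> G x" if "x \<in> {0..R}" for x
    unfolding LIMSEQ_iff s_def o_def using unif that by blast
  have Gb: "cmod (G x) \<le> norm2 h" if "x \<in> {0..R}" for x
    by (rule LIMSEQ_le_const2[OF tendsto_norm[OF ptw[OF that]]]) (use Fb in blast)
  have cGm[measurable]: "cut {0..r} G \<in> borel_measurable borel" if "r \<le> R" for r
  proof -
    have "cut {0..r} G = (\<lambda>x. indicator {0..r} x *\<^sub>R G x)" by (auto simp: cut_def)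
    then show ?thesis
      using borel_measurable_continuous_on_indicator[OF _ continuous_on_subset[OF G], of "{0..r}"] that by simp
  qed
  \<comment> \<open>As \<open>T (rr n) (f n)\<close> tends to 0, f n is close to minus its own
    convolution with h, and these convolutions tend to G.\<close>
  define v where "v = cut {0..\<rho>} (\<lambda>x. - G x)"
  have v_eq: "v = (\<lambda>x. - cut {0..\<rho>} G x)" by (auto simp: v_def cut_def)
  have vm[measurable]: "v \<in> borel_measurable borel"
    unfolding v_eq using cGm[of \<rho>] \<rho> by simp
  have v: "sq_integrable v"
    by (rule sq_integrable_interval(1)[OF vm, where a=0 and b=\<rho> and B="norm2 h"]) (use \<rho> Gb in \<open>auto simp: v_def cut_def\<close>)
  define d where "d = cut {0..R} (\<lambda>x. of_real (2 * norm2 h))"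
  have d: "sq_integrable d"
    by (rule sq_integrable_interval(1)[where a=0 and b=R and B="2 * norm2 h"]) (use \<open>R > 0\<close> in \<open>auto simp: d_def cut_def\<close>)
  have lim1: "(\<lambda>n. norm2 (\<lambda>x. cut {0..rr (s n)} (conv h (f (s n))) x - cut {0..\<rho>} G x)) \<longlonglongrightarrow> 0"
  proof (rule norm2_tendsto[OF _ _ d])
    show "cut {0..\<rho>} G \<in> borel_measurable borel" using cGm \<rho> by simp
    have "AE x in lborel. x \<noteq> \<rho>" by (rule AE_lborel_singleton)
    then show "AE x in lborel. (\<lambda>n. cut {0..rr (s n)} (conv h (f (s n))) x) \<longlonglongrightarrow> cut {0..\<rho>} G x"
    proof eventually_elim
      case (elim x)
      show ?case
      proof (cases "x \<in> {0..\<rho>}")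
        case True
        then have x: "x < \<rho>" "x \<ge> 0" using elim by auto
        have ev: "\<forall>\<^sub>F n in sequentially. cut {0..rr (s n)} (conv h (f (s n))) x = conv h (f (s n)) x"
          using order_tendstoD(1)[OF slim x(1)] by eventually_elim (use x in \<open>simp add: cut_def\<close>)
        have "(\<lambda>n. conv h (f (s n)) x) \<longlonglongrightarrow> cut {0..\<rho>} G x"
          using ptw[of x] True \<rho> by (simp add: cut_def)
        then show ?thesis using ev by (simp add: tendsto_cong)
      next
        case False
        have "\<forall>\<^sub>F n in sequentially. cut {0..rr (s n)} (conv h (f (s n))) x = 0"
        proof (cases "x < 0")
          case False
          with \<open>x \<notin> {0..\<rho>}\<close> have "\<rho> < x" by auto
          from order_tendstoD(2)[OF slim this] show ?thesis by eventually_elim (simp add: cut_def)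
        qed (simp add: cut_def)
        moreover have "cut {0..\<rho>} G x = 0" using False by (auto simp: cut_def)
        ultimately show ?thesis by (simp add: tendsto_eventually)
      qed
    qed
    show "AE x in lborel. cmod (cut {0..rr (s n)} (conv h (f (s n))) x - cut {0..\<rho>} G x) \<le> cmod (d x)" for n
    proof (rule AE_I2)
      fix x
      show "cmod (cut {0..rr (s n)} (conv h (f (s n))) x - cut {0..\<rho>} G x) \<le> cmod (d x)"
      proof (cases "x \<in> {0..R}")
        case True
        have "cmod (cut {0..rr (s n)} (conv h (f (s n))) x) \<le> norm2 h" "cmod (cut {0..\<rho>} G x) \<le> norm2 h"
          using Fb Gb[OF True] by (auto simp: cut_def)
        then show ?thesis using True norm_triangle_ineq4[of "cut {0..rr (s n)} (conv h (f (s n))) x" "cut {0..\<rho>} G x"]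
          by (simp add: d_def cut_def[of "{0..R}"])
      next
        case False
        then have "x \<notin> {0..rr (s n)}" "x \<notin> {0..\<rho>}" using rr(2)[of "s n"] \<rho> by auto
        then show ?thesis by (auto simp: cut_def)
      qed
    qed
  qed measurable
  have sqc: "sq_integrable (cut {0..rr n} (conv h (f n)))" for n
    by (rule sq_integrable_interval(1)[where a=0 and b="rr n" and B="norm2 h"])
       (use rr[of n] Fb in \<open>auto simp: cut_def intro: less_imp_le\<close>)
  have sqG: "sq_integrable (cut {0..\<rho>} G)"
    using sq_integrable_cmult(1)[OF v, of "-1"] by (simp add: v_eq)
  have fv: "f n x - v x = T (rr n) (f n) x - (cut {0..rr n} (conv h (f n)) x - cut {0..\<rho>} G x)" for n x
    using f0[of x n] by (auto simp: v_eq T_def cut_def)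
  have "norm2 (\<lambda>x. f (s n) x - v x) \<le> norm2 (T (rr (s n)) (f (s n)))
      + norm2 (\<lambda>x. cut {0..rr (s n)} (conv h (f (s n))) x - cut {0..\<rho>} G x)" for n
    unfolding fv by (rule norm2_triangle_diff[OF sqT[OF f] sq_integrable_diff[OF sqc sqG]])
  then have fvlim: "(\<lambda>n. norm2 (\<lambda>x. f (s n) x - v x)) \<longlonglongrightarrow> 0"
    by (intro tendsto_sandwich[OF _ _ tendsto_const tendsto_add_zero[OF Tlim' lim1]]) auto
  have "1 \<le> norm2 v + norm2 (\<lambda>x. f (s n) x - v x)" for n
    using norm2_triangle[OF v sq_integrable_diff[OF f[of "s n"] v]] f1[of "s n"] by simp
  then have v1: "1 \<le> norm2 v"
    using LIMSEQ_le_const[OF tendsto_add[OF tendsto_const fvlim], of 1 "norm2 v"] by auto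
  have cv: "conv h v x = G x" if "x \<in> {0..R}" for x
  proof -
    have "cmod (conv h (f (s n)) x - conv h v x) \<le> norm2 h * norm2 (\<lambda>x. f (s n) x - v x)" for n
      using conv_bound[OF h sq_integrable_diff[OF f v]] conv_diff_right[OF h f v] by metis
    then have "(\<lambda>n. conv h (f (s n)) x - conv h v x) \<longlonglongrightarrow> 0"
      by (intro Lim_null_comparison[OF _ tendsto_mult_right_zero[OF fvlim, of "norm2 h"]]) auto
    then have "(\<lambda>n. conv h (f (s n)) x) \<longlonglongrightarrow> conv h v x" by (simp add: LIM_zero_iff)
    then show ?thesis using ptw[OF that] LIMSEQ_unique by blast
  qed
  \<comment> \<open>\<open>inj\<close> speaks of positive radii only. Were the limit radius 0, v
    would live on a single point and could not have norm at least 1.\<close>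
  have "\<rho> > 0"
  proof (rule ccontr)
    assume "\<not> \<rho> > 0"
    then have "v x = 0" if "x \<noteq> 0" for x using \<rho> that by (auto simp: v_def cut_def)
    then have "AE x in lborel. v x = 0"
      using AE_lborel_singleton[of 0] by (auto elim!: eventually_mono)
    then have "norm2 v = norm2 (\<lambda>x. 0)" by (intro norm2_cong_AE) auto
    then show False using v1 by (simp add: norm2_def)
  qed
  moreover have "v t + conv h v t = 0" if "t \<in> {0..\<rho>}" for t
    using cv[of t] \<rho> that by (simp add: v_def cut_def)
  ultimately have "AE t in lborel. v t = 0"
    using \<rho> by (intro inj[of \<rho> v] v) (auto simp: v_def cut_def)
  then have "norm2 v = norm2 (\<lambda>x. 0)" by (intro norm2_cong_AE) auto
  then show False using v1 by (simp add: norm2_def)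
qed

subsection \<open>Transforms of measures on an interval\<close>

text \<open>The class \<open>transforms r\<close> is stable under moving zeroes; this replaces the Paley-Wiener
  theorem.\<close>

definition transform :: "complex \<Rightarrow> (real \<Rightarrow> complex) \<Rightarrow> complex \<Rightarrow> complex" where
  "transform c w l = c + (LINT x|lborel. w x * exp (- \<i> * l * of_real x))"

definition density_on :: "real \<Rightarrow> (real \<Rightarrow> complex) \<Rightarrow> bool" where
  "density_on r w \<longleftrightarrow> integrable lborel w \<and> (\<forall>x. x \<notin> {0..r} \<longrightarrow> w x = 0)"

definition transforms :: "real \<Rightarrow> (complex \<Rightarrow> complex) set" where
  "transforms r = {F. \<exists>c w. density_on r w \<and> F = transform c w}"

lemma density_onD:
  assumes "density_on r w"
  shows "integrable lborel w" "x \<notin> {0..r} \<Longrightarrow> w x = 0"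
  using assms by (auto simp: density_on_def)

lemma cmod_exp_bound:
  assumes "x \<in> {0..r}"
  shows "cmod (exp (- \<i> * l * of_real x)) \<le> exp (cmod l * r)"
proof -
  have "cmod (exp (- \<i> * l * of_real x)) = exp (Im l * x)" by simp
  also have "Im l * x \<le> cmod l * r"
    using assms abs_Im_le_cmod[of l] mult_mono[of "Im l" "cmod l" x r] by auto
  finally show ?thesis by simp
qed

lemma transform_integrable:
  assumes "density_on r w"
  shows "integrable lborel (\<lambda>x. w x * exp (- \<i> * l * of_real x))"
proof (rule Bochner_Integration.integrable_bound)
  note w = density_onD[OF assms]
  have [measurable]: "w \<in> borel_measurable borel" using w(1) by (auto dest: borel_measurable_integrable)
  show "integrable lborel (\<lambda>x. exp (cmod l * r) * cmod (w x))" using w(1) by simp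
  show "(\<lambda>x. w x * exp (- \<i> * l * of_real x)) \<in> borel_measurable lborel" by measurable
  have "cmod (w x * exp (- \<i> * l * of_real x)) \<le> exp (cmod l * r) * cmod (w x)" for x
  proof (cases "x \<in> {0..r}")
    case True
    then show ?thesis
      using mult_right_mono[OF cmod_exp_bound[OF True, of l], of "cmod (w x)"] by (simp add: norm_mult mult.commute)
  qed (simp add: w)
  then show "AE x in lborel. norm (w x * exp (- \<i> * l * of_real x)) \<le> norm (exp (cmod l * r) * cmod (w x))"
    by (simp add: abs_mult)
qed

lemma transforms_add:
  assumes "F \<in> transforms r" "G \<in> transforms r"
  shows "(\<lambda>l. F l + G l) \<in> transforms r"
proof -
  obtain c w where F: "density_on r w" "F = transform c w" using assms(1) by (auto simp: transforms_def)
  obtain d v where G: "density_on r v" "G = transform d v" using assms(2) by (auto simp: transforms_def)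
  have "density_on r (\<lambda>x. w x + v x)" using F(1) G(1) by (auto simp: density_on_def)
  moreover have "(\<lambda>l. F l + G l) = transform (c + d) (\<lambda>x. w x + v x)"
    using transform_integrable[OF F(1)] transform_integrable[OF G(1)]
    by (auto simp: F(2) G(2) transform_def algebra_simps fun_eq_iff)
  ultimately show ?thesis by (auto simp: transforms_def)
qed

lemma transforms_cmult:
  assumes "F \<in> transforms r"
  shows "(\<lambda>l. a * F l) \<in> transforms r"
proof -
  obtain c w where F: "density_on r w" "F = transform c w" using assms by (auto simp: transforms_def)
  have "density_on r (\<lambda>x. a * w x)" using F(1) by (auto simp: density_on_def)
  moreover have "(\<lambda>l. a * F l) = transform (a * c) (\<lambda>x. a * w x)"
    by (simp add: F(2) transform_def distrib_left mult.assoc fun_eq_iff)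
  ultimately show ?thesis by (auto simp: transforms_def)
qed


text \<open>Multiplied through by m, so that m = 0 is no special case.\<close>

lemma integral_exp_Icc:
  fixes m :: complex
  assumes "0 \<le> t"
  shows "m * (LINT x|lborel. (if x \<in> {0..t} then exp (m * of_real x) else 0)) = exp (m * of_real t) - 1"
proof -
  have "(LINT x|lborel. indicator {0..t} x *\<^sub>R (m * exp (m * of_real x))) = exp (m * of_real t) - exp (m * of_real 0)"
  proof (rule integral_FTC_atLeastAtMost[OF assms])
    show "((\<lambda>x. exp (m * of_real x)) has_vector_derivative m * exp (m * of_real x)) (at x within {0..t})" for x
      by (rule has_vector_derivative_real_field) (auto intro!: derivative_eq_intros)
  qed (intro continuous_intros)
  moreover have "(LINT x|lborel. indicator {0..t} x *\<^sub>R (m * exp (m * of_real x))) =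
      (LINT x|lborel. m * (if x \<in> {0..t} then exp (m * of_real x) else 0))"
    by (intro Bochner_Integration.integral_cong) auto
  ultimately show ?thesis by simp
qed

lemma Fubini_product_bound:
  fixes f :: "'a \<Rightarrow> 'b \<Rightarrow> complex"
  assumes "sigma_finite_measure M1" "sigma_finite_measure M2"
    and f [measurable]: "case_prod f \<in> borel_measurable (M1 \<Otimes>\<^sub>M M2)"
    and a: "integrable M1 a" and b: "integrable M2 b"
    and bound: "\<And>x y. cmod (f x y) \<le> a x * b y"
  shows "(LINT x|M1. LINT y|M2. f x y) = (LINT y|M2. LINT x|M1. f x y)"
    and "integrable M1 (\<lambda>x. LINT y|M2. f x y)" "integrable M2 (\<lambda>y. LINT x|M1. f x y)"
proof -
  interpret M1: sigma_finite_measure M1 by fact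
  interpret M2: sigma_finite_measure M2 by fact
  interpret pair_sigma_finite M1 M2 ..
  have am [measurable]: "a \<in> borel_measurable M1" and bm [measurable]: "b \<in> borel_measurable M2"
    using a b by (auto dest: borel_measurable_integrable)
  have "integrable (M1 \<Otimes>\<^sub>M M2) (\<lambda>p. a (fst p) * b (snd p))"
  proof (rule Fubini_integrable)
    show "(\<lambda>p. a (fst p) * b (snd p)) \<in> borel_measurable (M1 \<Otimes>\<^sub>M M2)" by measurable
    show "integrable M1 (\<lambda>x. LINT y|M2. norm (a (fst (x, y)) * b (snd (x, y))))"
      using a by (simp add: abs_mult)
    show "AE x in M1. integrable M2 (\<lambda>y. a (fst (x, y)) * b (snd (x, y)))"
      using b by simp
  qed
  then have "integrable (M1 \<Otimes>\<^sub>M M2) (case_prod f)"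
    by (rule Bochner_Integration.integrable_bound)
       (use bound in \<open>auto intro!: AE_I2 order_trans[OF _ abs_ge_self]\<close>)
  then show "(LINT x|M1. LINT y|M2. f x y) = (LINT y|M2. LINT x|M1. f x y)"
    "integrable M1 (\<lambda>x. LINT y|M2. f x y)" "integrable M2 (\<lambda>y. LINT x|M1. f x y)"
    using Fubini_integral[of f] integrable_fst'[of "case_prod f"] integrable_snd[of f] by auto
qed

lemma exp_diff_factor: "exp (- \<i> * l * of_real t) = exp (- \<i> * z * of_real t) * exp (- \<i> * (l - z) * of_real t)"
  for l z :: complex
  unfolding exp_add[symmetric] by (simp add: algebra_simps)

text \<open>The difference e^(-ilt) - e^(-izt) is -i (l - z) e^(-izt) times the integral of e^(-i(l
  - z)x) over x in [0, t]. Exchanging the integrals over x and t exhibits the quotient as the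
  transform of the density \<open>g\<close>, again supported in [0, r] and now without an
  atom.\<close>

lemma transforms_difference_quotient:
  assumes F: "F \<in> transforms r" and r: "r \<ge> 0"
  obtains G where "G \<in> transforms r" "\<And>l. F l - F z = (l - z) * G l"
proof -
  obtain c w where w: "density_on r w" and Fw: "F = transform c w" using F by (auto simp: transforms_def)
  note wD = density_onD[OF w]
  have [measurable]: "w \<in> borel_measurable borel" using wD(1) by (auto dest: borel_measurable_integrable)
  define wz where "wz = (\<lambda>t. w t * exp (- \<i> * z * of_real t))"
  have wz: "integrable lborel wz" unfolding wz_def by (rule transform_integrable[OF w])
  have wzm[measurable]: "wz \<in> borel_measurable borel" unfolding wz_def by measurable
  define K where "K l x t = (if x \<in> {0..r} \<and> x \<le> t then - \<i> * wz t * exp (- \<i> * (l - z) * of_real x) else 0)" for l x t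
  define g where "g x = (if x \<in> {0..r} then - \<i> * exp (\<i> * z * of_real x) * (LINT t|lborel. (if x \<le> t then wz t else 0)) else 0)" for x
  have gm[measurable]: "g \<in> borel_measurable borel" unfolding g_def by measurable
  have gK: "g x * exp (- \<i> * l * of_real x) = (LINT t|lborel. K l x t)" for l x
  proof (cases "x \<in> {0..r}")
    case True
    have "K l x t = (- \<i> * exp (- \<i> * (l - z) * of_real x)) * (if x \<le> t then wz t else 0)" for t
      using True by (auto simp: K_def)
    then have "(LINT t|lborel. K l x t) = (- \<i> * exp (- \<i> * (l - z) * of_real x)) * (LINT t|lborel. (if x \<le> t then wz t else 0))"
      by simp
    moreover have "exp (\<i> * z * of_real x) * exp (- \<i> * l * of_real x) = exp (- \<i> * (l - z) * of_real x)"
      unfolding exp_add[symmetric] by (simp add: algebra_simps)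
    ultimately show ?thesis using True by (simp add: g_def mult.assoc mult.left_commute)
  qed (auto simp: g_def K_def)
  have Km: "case_prod (K l) \<in> borel_measurable (lborel \<Otimes>\<^sub>M lborel)" for l
    unfolding K_def by measurable
  define a where "a l x = indicator {0..r} x * exp (cmod (l - z) * r)" for l x
  have a: "integrable lborel (a l)" for l unfolding a_def by (intro integrable_mult_left integrable_real_indicator) (auto simp: emeasure_lborel_Icc_eq)
  have Kb: "cmod (K l x t) \<le> a l x * cmod (wz t)" for l x t
    using mult_right_mono[OF cmod_exp_bound[of x r "l - z"], of "cmod (wz t)"]
    by (auto simp: K_def a_def norm_mult mult.commute)
  note Fub = Fubini_product_bound[OF lborel.sigma_finite_measure_axioms lborel.sigma_finite_measure_axioms Km a integrable_norm[OF wz] Kb]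
  have "integrable lborel g" using Fub(2)[of 0] by (simp add: gK[of _ 0, symmetric])
  then have g: "density_on r g" by (auto simp: density_on_def g_def)
  show thesis
  proof
    show "transform 0 g \<in> transforms r" using g by (auto simp: transforms_def)
    fix l
    have inner: "(l - z) * (LINT x|lborel. K l x t) = wz t * (exp (- \<i> * (l - z) * of_real t) - 1)" for t
    proof (cases "t \<in> {0..r}")
      case True
      have "K l x t = (- \<i> * wz t) * (if x \<in> {0..t} then exp ((- \<i> * (l - z)) * of_real x) else 0)" for x
        using True by (auto simp: K_def)
      then have "(l - z) * (LINT x|lborel. K l x t) =
        wz t * ((- \<i> * (l - z)) * (LINT x|lborel. (if x \<in> {0..t} then exp ((- \<i> * (l - z)) * of_real x) else 0)))"
        by simp
      also have "\<dots> = wz t * (exp (- \<i> * (l - z) * of_real t) - 1)"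
        using integral_exp_Icc[of t "- \<i> * (l - z)"] True by simp
      finally show ?thesis .
    next
      case False
      then have "wz t = 0" using wD(2) by (simp add: wz_def)
      then show ?thesis by (simp add: K_def cong: if_cong)
    qed
    have "(l - z) * transform 0 g l = (l - z) * (LINT x|lborel. LINT t|lborel. K l x t)"
      by (simp add: transform_def gK[symmetric])
    also have "\<dots> = (LINT t|lborel. (l - z) * (LINT x|lborel. K l x t))"
      using Fub(1)[of l] by simp
    also have "\<dots> = (LINT t|lborel. wz t * exp (- \<i> * (l - z) * of_real t) - wz t)"
      by (simp add: inner right_diff_distrib)
    also have "\<dots> = (LINT t|lborel. w t * exp (- \<i> * l * of_real t) - w t * exp (- \<i> * z * of_real t))"
      unfolding wz_def exp_diff_factor[of l _ z] by (simp only: mult.assoc)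
    also have "\<dots> = F l - F z"
      using transform_integrable[OF w] by (simp add: Fw transform_def)
    finally show "F l - F z = (l - z) * transform 0 g l" by simp
  qed
qed

lemma transforms_continuous:
  assumes "F \<in> transforms r"
  shows "isCont F l"
proof -
  obtain c w where w: "density_on r w" and Fw: "F = transform c w" using assms by (auto simp: transforms_def)
  note wD = density_onD[OF w]
  have [measurable]: "w \<in> borel_measurable borel" using wD(1) by (auto dest: borel_measurable_integrable)
  have "(\<lambda>n. LINT x|lborel. w x * exp (- \<i> * s n * of_real x)) \<longlonglongrightarrow> (LINT x|lborel. w x * exp (- \<i> * l * of_real x))"
    if s: "s \<longlonglongrightarrow> l" for s
  proof -
    obtain B where B: "\<And>n. cmod (s n) \<le> B"
      using convergent_imp_Bseq[of s] s by (auto simp: convergent_def Bseq_def)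
    show ?thesis
    proof (rule integral_dominated_convergence)
    show "integrable lborel (\<lambda>x. exp (B * \<bar>r\<bar>) * cmod (w x))" using wD(1) by simp
    show "AE x in lborel. (\<lambda>n. w x * exp (- \<i> * s n * of_real x)) \<longlonglongrightarrow> w x * exp (- \<i> * l * of_real x)"
      by (intro AE_I2 tendsto_intros s)
    have "cmod (w x * exp (- \<i> * s n * of_real x)) \<le> exp (B * \<bar>r\<bar>) * cmod (w x)" for n x
    proof (cases "x \<in> {0..r}")
      case True
      have "cmod (exp (- \<i> * s n * of_real x)) \<le> exp (cmod (s n) * r)" by (rule cmod_exp_bound[OF True])
      also have "\<dots> \<le> exp (B * \<bar>r\<bar>)" using mult_mono[OF B[of n] abs_ge_self[of r]] True B[of n] norm_ge_zero[of "s n"] by (auto intro: mult_mono)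
      finally show ?thesis
        using mult_left_mono[of _ _ "cmod (w x)"] by (simp add: norm_mult mult.commute[of _ "cmod (w x)"])
    qed (simp add: wD)
    then show "AE x in lborel. norm (w x * exp (- \<i> * s n * of_real x)) \<le> exp (B * \<bar>r\<bar>) * cmod (w x)" for n
      by simp
    qed measurable
  qed
  then show ?thesis
    unfolding Fw transform_def by (intro continuous_intros) (simp add: continuous_at_sequentially o_def)
qed

text \<open>The difference quotient at z is itself a transform, hence continuous, and its value at z
  is the derivative.\<close>

lemma transforms_holomorphic:
  assumes "F \<in> transforms r" "r \<ge> 0"
  shows "F holomorphic_on UNIV"
proof -
  have "(F has_field_derivative G z) (at z)" if "G \<in> transforms r" "\<And>l. F l - F z = (l - z) * G l" for G z
    using that by (auto simp: has_field_derivative_iff isCont_def intro!: Lim_transform_within[OF transforms_continuous[OF that(1), of z, unfolded isCont_def], of 1])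
  then show ?thesis
    unfolding holomorphic_on_def field_differentiable_def
    using transforms_difference_quotient[OF assms] by (metis (no_types, lifting) has_field_derivative_at_within)
qed

text \<open>Write S = S(z) + (l - z) S1. Dividing F by l - z leaves the zeroes \<open>zs\<close>
  with the same cofactor E, which handles the constant S(z). For S1 the function F is kept but the
  zero z is counted as part of the cofactor (l - z) E. Both have one zero fewer in the list.\<close>

lemma transforms_move_zeros:
  assumes r: "r \<ge> 0"
  shows "F \<in> transforms r \<Longrightarrow> (\<And>l. F l = (\<Prod>z\<leftarrow>zs. l - z) * E l) \<Longrightarrow> (\<And>l. isCont E l) \<Longrightarrow>
    degree S \<le> length zs \<Longrightarrow> (\<lambda>l. poly S l * E l) \<in> transforms r"
proof (induction zs arbitrary: F E S)
  case Nil
  then obtain s where "S = [:s:]" by (metis degree_0_id le_zero_eq list.size(3) degree_eq_zeroE)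
  moreover have "F = E" using Nil(2) by auto
  ultimately show ?case using transforms_cmult[OF Nil(1)] by simp
next
  case (Cons z zs)
  obtain G where G: "G \<in> transforms r" "\<And>l. F l - F z = (l - z) * G l"
    using transforms_difference_quotient[OF Cons.prems(1) r] by metis
  have Fz: "F z = 0" using Cons.prems(2)[of z] by simp
  have GE: "G l = (\<Prod>z\<leftarrow>zs. l - z) * E l" if "l \<noteq> z" for l
    using G(2)[of l] Cons.prems(2)[of l] Fz that by (simp add: mult.assoc)
  have "isCont (\<lambda>l. \<Prod>z\<leftarrow>zs. l - z) z" by (induction zs) (auto intro!: continuous_intros)
  then have "isCont (\<lambda>l. (\<Prod>z\<leftarrow>zs. l - z) * E l) z" using Cons.prems(3) by (intro continuous_intros)
  \<comment> \<open>At l = z the factor l - z cannot be cancelled; the two sides agree there by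
    continuity.\<close>
  moreover have "((\<lambda>l. (\<Prod>z\<leftarrow>zs. l - z) * E l) \<longlongrightarrow> G z) (at z)"
    by (rule Lim_transform_within[OF transforms_continuous[OF G(1), unfolded isCont_def], of 1]) (auto simp: GE)
  ultimately have "G z = (\<Prod>y\<leftarrow>zs. z - y) * E z"
    unfolding isCont_def by (rule LIM_unique[rotated])
  then have GE': "G l = (\<Prod>z\<leftarrow>zs. l - z) * E l" for l using GE by (cases "l = z") auto
  define S1 where "S1 = synthetic_div S z"
  have S: "poly S l = poly S z + (l - z) * poly S1 l" for l
    using arg_cong[OF synthetic_div_correct'[of z S], of "\<lambda>p. poly p l"] by (simp add: S1_def algebra_simps)
  have "(\<lambda>l. poly [:poly S z:] l * E l) \<in> transforms r"
    by (rule Cons.IH[OF G(1) GE' Cons.prems(3)]) auto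
  moreover have "(\<lambda>l. poly S1 l * ((l - z) * E l)) \<in> transforms r"
    by (rule Cons.IH[OF Cons.prems(1)])
       (use Cons.prems in \<open>auto simp: S1_def degree_synthetic_div intro!: continuous_intros\<close>)
  ultimately have "(\<lambda>l. poly [:poly S z:] l * E l + poly S1 l * ((l - z) * E l)) \<in> transforms r"
    by (rule transforms_add)
  moreover have "(\<lambda>l. poly [:poly S z:] l * E l + poly S1 l * ((l - z) * E l)) = (\<lambda>l. poly S l * E l)"
  proof
    fix l
    show "poly [:poly S z:] l * E l + poly S1 l * ((l - z) * E l) = poly S l * E l"
      unfolding S[of l] by (simp add: algebra_simps)
  qed
  ultimately show ?case by simp
qed

subsection \<open>The Krein system of an accelerant\<close>

text \<open>Absolute continuity of the norm: an approximant bounded by B contributes at most B sqrt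
  (b - a) on (a, b], whence the choice of \<open>\<delta>\<close>.\<close>

lemma norm2_cut_small:
  assumes f: "sq_integrable f" and supp: "\<And>x. x \<notin> {-R..R} \<Longrightarrow> f x = 0" and "R > 0" "e > 0"
  obtains \<delta> where "\<delta> > 0" "\<And>a b. a \<le> b \<Longrightarrow> b - a < \<delta> \<Longrightarrow> norm2 (cut {a<..b} f) < e"
proof -
  obtain G where Gc: "continuous_on UNIV G" and G0: "\<And>x. x \<notin> {-R-1..R+1} \<Longrightarrow> G x = 0"
    and G: "sq_integrable G" and Ge: "norm2 (\<lambda>x. G x - f x) < e / 2"
    using continuous_approx_norm2[OF f supp \<open>R > 0\<close>, of "e/2"] \<open>e > 0\<close> by auto
  have [measurable]: "G \<in> borel_measurable borel" using G by measurable
  have "bounded (G ` {-R-1..R+1})"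
    by (intro compact_imp_bounded compact_continuous_image continuous_on_subset[OF Gc]) auto
  then obtain B0 where B0: "\<And>x. x \<in> {-R-1..R+1} \<Longrightarrow> cmod (G x) \<le> B0"
    unfolding bounded_iff by blast
  define B where "B = max B0 1"
  have B: "B > 0" "cmod (G x) \<le> B" for x
  proof -
    show "cmod (G x) \<le> B"
      using B0[of x] G0[of x] by (cases "x \<in> {-R-1..R+1}") (simp_all only: B_def norm_zero, auto)
  qed (simp add: B_def)
  define \<delta> where "\<delta> = (e / (2 * B))\<^sup>2"
  have d: "\<delta> > 0" using B(1) \<open>e > 0\<close> by (simp add: \<delta>_def)
  show thesis
  proof (rule that[OF d])
    fix a b :: real assume ab: "a \<le> b" "b - a < \<delta>"
    have "norm2 (cut {a<..b} G) \<le> B * sqrt (b - a)"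
      by (rule sq_integrable_interval(2)) (use ab B in \<open>auto simp: cut_def intro: less_imp_le\<close>)
    also have "sqrt (b - a) < e / (2 * B)"
      using real_sqrt_less_mono[OF ab(2)] B \<open>e > 0\<close> by (simp add: \<delta>_def)
    then have "B * sqrt (b - a) < e / 2" using B(1) by (simp add: field_simps)
    finally have 1: "norm2 (cut {a<..b} G) < e / 2" .
    have D: "sq_integrable (\<lambda>x. G x - f x)" by (rule sq_integrable_diff[OF G f])
    have 2: "norm2 (cut {a<..b} (\<lambda>x. G x - f x)) < e / 2"
      using sq_integrable_cut(2)[OF D, of "{a<..b}"] Ge by simp
    have eq: "cut {a<..b} f = (\<lambda>x. cut {a<..b} G x - cut {a<..b} (\<lambda>x. G x - f x) x)"
      by (auto simp: cut_def)
    show "norm2 (cut {a<..b} f) < e"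
      unfolding eq using norm2_triangle_diff[OF sq_integrable_cut(1)[OF G, of "{a<..b}"] sq_integrable_cut(1)[OF D, of "{a<..b}"]] 1 2 by simp
  qed
qed

lemma norm2_cut_split:
  assumes f: "sq_integrable f" and "a \<le> b" "b \<le> c"
  shows "(norm2 (cut {a<..c} f))\<^sup>2 = (norm2 (cut {a<..b} f))\<^sup>2 + (norm2 (cut {b<..c} f))\<^sup>2"
proof -
  have "(LINT x|lborel. (cmod (cut {a<..c} f x))\<^sup>2) =
      (LINT x|lborel. (cmod (cut {a<..b} f x))\<^sup>2 + (cmod (cut {b<..c} f x))\<^sup>2)"
    using assms(2,3) by (intro Bochner_Integration.integral_cong) (auto simp: cut_def)
  also have "\<dots> = (LINT x|lborel. (cmod (cut {a<..b} f x))\<^sup>2) + (LINT x|lborel. (cmod (cut {b<..c} f x))\<^sup>2)"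
    by (intro Bochner_Integration.integral_add sq_integrableD sq_integrable_cut f) auto
  finally show ?thesis by (simp add: norm2_square)
qed

lemma AE_lborel_reflect:
  assumes "AE x in lborel. P (x::real)"
  shows "AE x in lborel. P (c - x)"
proof -
  obtain N where N: "N \<in> null_sets lborel" "{x. \<not> P x} \<subseteq> N"
    using assms by (auto simp: eventually_ae_filter)
  have Nb[measurable]: "N \<in> sets borel" using N(1) by auto
  have "(\<lambda>x. c - x) \<in> borel_measurable borel" by measurable
  from measurable_sets[OF this Nb] have vb: "(\<lambda>x. c - x) -` N \<in> sets borel" by simp
  have "emeasure lborel ((\<lambda>x. c - x) -` N) = (\<integral>\<^sup>+x. indicator N (c + (-1) * x) \<partial>lborel)"
    using nn_integral_indicator[of "(\<lambda>x. c - x) -` N" lborel] vb by (simp add: indicator_def)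
  also have "\<dots> = (\<integral>\<^sup>+x. indicator N x \<partial>lborel)"
    by (subst nn_integral_real_affine[where c="-1" and t=c and f="indicator N"]) auto
  also have "\<dots> = 0" using N(1) by auto
  finally have "(\<lambda>x. c - x) -` N \<in> null_sets lborel"
    using vb by (intro null_setsI) simp_all
  then show ?thesis by (rule AE_I') (use N(2) in auto)
qed

text \<open>Minkowski's integral inequality for the weight |w|. Splitting |w| into two square roots
  and applying Cauchy-Schwarz for fixed t leaves one factor |w| under the double integral, where the
  order of integration can be exchanged.\<close>

lemma norm2_integral_le:
  fixes K :: "real \<Rightarrow> real \<Rightarrow> complex"
  assumes K [measurable]: "case_prod K \<in> borel_measurable (borel \<Otimes>\<^sub>M borel)"
    and w: "integrable lborel w" and \<omega>: "\<omega> \<ge> 0"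
    and sq: "\<And>u. w u \<noteq> 0 \<Longrightarrow> sq_integrable (\<lambda>t. K t u)" and bound: "\<And>u. w u \<noteq> 0 \<Longrightarrow> norm2 (\<lambda>t. K t u) \<le> \<omega>"
  shows "sq_integrable (\<lambda>t. LINT u|lborel. K t u * w u)"
    and "norm2 (\<lambda>t. LINT u|lborel. K t u * w u) \<le> \<omega> * (LINT u|lborel. cmod (w u))"
proof -
  define k where "k t = (LINT u|lborel. K t u * w u)" for t
  define W where "W = (LINT u|lborel. cmod (w u))"
  have wm[measurable]: "w \<in> borel_measurable borel" using w by (auto dest: borel_measurable_integrable)
  have km[measurable]: "k \<in> borel_measurable borel" unfolding k_def by measurable
  have W: "(\<integral>\<^sup>+u. ennreal (cmod (w u)) \<partial>lborel) = ennreal W" "W \<ge> 0"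
    unfolding W_def using w by (auto intro!: nn_integral_eq_integral)
  have pt: "ennreal ((cmod (k t))\<^sup>2) \<le> (\<integral>\<^sup>+u. ennreal ((cmod (K t u))\<^sup>2 * cmod (w u)) \<partial>lborel) * ennreal W" for t
  proof -
    have "ennreal (cmod (k t)) \<le> (\<integral>\<^sup>+u. ennreal (cmod (K t u * w u)) \<partial>lborel)"
      unfolding k_def by (cases "integrable lborel (\<lambda>u. K t u * w u)")
        (auto intro: integral_norm_bound_ennreal simp: not_integrable_integral_eq)
    also have "\<dots> = (\<integral>\<^sup>+u. ennreal (cmod (K t u) * sqrt (cmod (w u))) * ennreal (sqrt (cmod (w u))) \<partial>lborel)"
      by (intro nn_integral_cong) (auto simp: norm_mult ennreal_mult[symmetric])
    finally have "(ennreal (cmod (k t)))\<^sup>2 \<le> (\<integral>\<^sup>+u. ennreal (cmod (K t u) * sqrt (cmod (w u))) * ennreal (sqrt (cmod (w u))) \<partial>lborel)\<^sup>2"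
      by (intro power_mono) auto
    also have "\<dots> \<le> (\<integral>\<^sup>+u. (ennreal (cmod (K t u) * sqrt (cmod (w u))))\<^sup>2 \<partial>lborel) * (\<integral>\<^sup>+u. (ennreal (sqrt (cmod (w u))))\<^sup>2 \<partial>lborel)"
      by (rule Cauchy_Schwarz_nn_integral) measurable
    also have "\<dots> = (\<integral>\<^sup>+u. ennreal ((cmod (K t u))\<^sup>2 * cmod (w u)) \<partial>lborel) * ennreal W"
      by (simp add: ennreal_power power_mult_distrib W(1)[symmetric])
    finally show ?thesis by (simp add: ennreal_power)
  qed
  have inner: "(\<integral>\<^sup>+t. ennreal ((cmod (K t u))\<^sup>2 * cmod (w u)) \<partial>lborel) \<le> ennreal (\<omega>\<^sup>2) * ennreal (cmod (w u))" for u
  proof (cases "w u = 0")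
    case False
    have "(\<integral>\<^sup>+t. ennreal ((cmod (K t u))\<^sup>2) \<partial>lborel) = ennreal ((norm2 (\<lambda>t. K t u))\<^sup>2)"
      unfolding norm2_square using sq_integrableD[OF sq[OF False]] by (intro nn_integral_eq_integral) auto
    also have "\<dots> \<le> ennreal (\<omega>\<^sup>2)"
      using bound[OF False] by (intro ennreal_leI power_mono) auto
    finally have "(\<integral>\<^sup>+t. ennreal ((cmod (K t u))\<^sup>2) \<partial>lborel) * ennreal (cmod (w u)) \<le> ennreal (\<omega>\<^sup>2) * ennreal (cmod (w u))"
      by (intro mult_right_mono) auto
    then show ?thesis by (subst (asm) nn_integral_multc[symmetric]) (auto simp: ennreal_mult)
  qed simp
  have "(\<integral>\<^sup>+t. ennreal ((cmod (k t))\<^sup>2) \<partial>lborel) \<le> (\<integral>\<^sup>+t. (\<integral>\<^sup>+u. ennreal ((cmod (K t u))\<^sup>2 * cmod (w u)) \<partial>lborel) * ennreal W \<partial>lborel)"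
    by (intro nn_integral_mono pt)
  also have "\<dots> = (\<integral>\<^sup>+t. (\<integral>\<^sup>+u. ennreal ((cmod (K t u))\<^sup>2 * cmod (w u)) \<partial>lborel) \<partial>lborel) * ennreal W"
    by (rule nn_integral_multc) measurable
  also have "(\<integral>\<^sup>+t. (\<integral>\<^sup>+u. ennreal ((cmod (K t u))\<^sup>2 * cmod (w u)) \<partial>lborel) \<partial>lborel) =
      (\<integral>\<^sup>+u. (\<integral>\<^sup>+t. ennreal ((cmod (K t u))\<^sup>2 * cmod (w u)) \<partial>lborel) \<partial>lborel)"
    by (rule lborel_pair.Fubini') measurable
  also have "\<dots> \<le> (\<integral>\<^sup>+u. ennreal (\<omega>\<^sup>2) * ennreal (cmod (w u)) \<partial>lborel)"
    by (intro nn_integral_mono inner)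
  also have "\<dots> = ennreal (\<omega>\<^sup>2 * W)"
    using W by (subst nn_integral_cmult) (auto simp: ennreal_mult)
  finally have *: "(\<integral>\<^sup>+t. ennreal ((cmod (k t))\<^sup>2) \<partial>lborel) \<le> ennreal ((\<omega> * W)\<^sup>2)"
    using W by (simp add: ennreal_mult[symmetric] power2_eq_square mult_ac mult_right_mono)
  then have "integrable lborel (\<lambda>t. (cmod (k t))\<^sup>2)"
    by (intro integrableI_bounded) (auto simp: order_le_less_trans[OF _ ennreal_less_top])
  then show kk: "sq_integrable (\<lambda>t. LINT u|lborel. K t u * w u)"
    using km by (simp add: sq_integrable_def k_def[symmetric])
  have "ennreal ((norm2 k)\<^sup>2) \<le> ennreal ((\<omega> * W)\<^sup>2)"
    using * nn_integral_eq_integral[OF sq_integrableD[OF kk]] by (simp add: norm2_square k_def)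
  then have "(norm2 k)\<^sup>2 \<le> (\<omega> * W)\<^sup>2" by simp
  then have "norm2 k \<le> \<omega> * W" by (rule power2_le_imp_le) (use \<omega> W in simp)
  then show "norm2 (\<lambda>t. LINT u|lborel. K t u * w u) \<le> \<omega> * (LINT u|lborel. cmod (w u))"
    by (simp add: k_def[symmetric] W_def)
qed

text \<open>A substitute for the fundamental theorem of calculus when F has no derivative at
  individual points. Errors e m(a, b) over a subdivision add up to e m(0, r) because m is additive,
  and e is arbitrary.\<close>

lemma increments_eq_integral:
  fixes F k :: "real \<Rightarrow> complex" and m :: "real \<Rightarrow> real \<Rightarrow> real"
  assumes "integrable lborel k"
    and m: "\<And>a b c. \<lbrakk>0 \<le> a; a \<le> b; b \<le> c; c \<le> R\<rbrakk> \<Longrightarrow> m a c = m a b + m b c"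
    and small: "\<And>e. e > 0 \<Longrightarrow> \<exists>\<delta>>0. \<forall>a b. 0 \<le> a \<and> a < b \<and> b \<le> R \<and> b - a < \<delta> \<longrightarrow>
       cmod (F b - F a - (LINT x|lborel. indicator {a<..b} x *\<^sub>R k x)) \<le> e * m a b"
    and r: "0 \<le> r" "r \<le> R"
  shows "F r = F 0 + (LINT x|lborel. indicator {0<..r} x *\<^sub>R k x)"
proof -
  define D where "D a b = F b - F a - (LINT x|lborel. indicator {a<..b} x *\<^sub>R k x)" for a b
  have int: "integrable lborel (\<lambda>x. indicator {a<..b} x *\<^sub>R k x)" for a b
    by (rule Bochner_Integration.integrable_bound[OF assms(1)])
       (use borel_measurable_integrable[OF assms(1)] in \<open>auto simp: indicator_def\<close>)
  have D_add: "D a c = D a b + D b c" if "a \<le> b" "b \<le> c" for a b c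
  proof -
    have "(LINT x|lborel. indicator {a<..c} x *\<^sub>R k x) = (LINT x|lborel. indicator {a<..b} x *\<^sub>R k x + indicator {b<..c} x *\<^sub>R k x)"
      using that by (intro Bochner_Integration.integral_cong) (auto simp: indicator_def)
    then show ?thesis using int by (simp add: D_def)
  qed
  have D0: "D a a = 0" and m0: "0 \<le> a \<Longrightarrow> a \<le> R \<Longrightarrow> m a a = 0" for a using m[of a a a] by (auto simp: D_def)
  have "cmod (D 0 r) \<le> e * m 0 r" if "e > 0" for e
  proof -
    obtain \<delta> where \<delta>: "\<delta> > 0" and small': "\<And>a b. 0 \<le> a \<Longrightarrow> a < b \<Longrightarrow> b \<le> R \<Longrightarrow> b - a < \<delta> \<Longrightarrow> cmod (D a b) \<le> e * m a b"
      using small[OF \<open>e > 0\<close>] unfolding D_def by blast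
    have "0 \<le> b \<Longrightarrow> b \<le> R \<Longrightarrow> b \<le> real n * (\<delta> / 2) \<Longrightarrow> cmod (D 0 b) \<le> e * m 0 b" for n b
    proof (induction n arbitrary: b)
      case 0
      then show ?case using D0 m0 by simp
    next
      case (Suc n)
      \<comment> \<open>One step back of half the admissible length, which keeps the inequality
        \<open>b - a < \<delta>\<close> strict.\<close>
      define a where "a = max 0 (b - \<delta> / 2)"
      have a: "0 \<le> a" "a \<le> b" "b - a < \<delta>" "a \<le> real n * (\<delta> / 2)"
        using Suc.prems \<delta> mult_nonneg_nonneg[of \<delta> "real n"] by (auto simp: a_def max_def algebra_simps)
      have "cmod (D a b) \<le> e * m a b"
        using small'[of a b] a Suc.prems D0[of a] m0[of a] by (cases "a = b") auto
      moreover have "cmod (D 0 a) \<le> e * m 0 a" using Suc.IH[of a] a Suc.prems by auto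
      ultimately show ?case
        using D_add[of 0 a b] m[of 0 a b] a Suc.prems norm_triangle_ineq[of "D 0 a" "D a b"] by (simp add: distrib_left)
    qed
    moreover obtain n :: nat where "r / (\<delta> / 2) \<le> real n" using real_arch_simple by blast
    then have "r \<le> real n * (\<delta> / 2)" using \<delta> by (simp add: field_simps)
    ultimately show ?thesis using r by blast
  qed
  then have "cmod (D 0 r) \<le> 0 + e" if "e > 0" for e
  proof -
    have "e / (\<bar>m 0 r\<bar> + 1) > 0" using that by simp
    from \<open>\<And>e. 0 < e \<Longrightarrow> cmod (D 0 r) \<le> e * m 0 r\<close>[OF this] have "cmod (D 0 r) \<le> e / (\<bar>m 0 r\<bar> + 1) * m 0 r" .
    also have "\<dots> \<le> e / (\<bar>m 0 r\<bar> + 1) * (\<bar>m 0 r\<bar> + 1)" using that by (intro mult_left_mono) auto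
    finally show ?thesis by simp
  qed
  then have "cmod (D 0 r) \<le> 0" by (rule field_le_epsilon)
  then show ?thesis by (simp add: D_def algebra_simps)
qed

text \<open>The data of the problem with Borel representatives, the accelerant being cut off
  outside \<open>[-R, R]\<close>: \<open>g r\<close> is \<open>\<Gamma>\<^sub>r(\<cdot>, 0)\<close> extended by zero.\<close>

locale truncated_accelerant =
  fixes R :: real and h :: "real \<Rightarrow> complex" and g :: "real \<Rightarrow> real \<Rightarrow> complex" and A :: "real \<Rightarrow> complex"
  assumes R: "R > 0"
    and h: "sq_integrable h" and h_supp: "x \<notin> {-R..R} \<Longrightarrow> h x = 0" and h_cnj: "h (- x) = cnj (h x)"
    and g: "0 \<le> r \<Longrightarrow> r \<le> R \<Longrightarrow> sq_integrable (g r)"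
    and g_supp: "x \<notin> {0..r} \<Longrightarrow> g r x = 0"
    and g_eq: "0 < r \<Longrightarrow> r \<le> R \<Longrightarrow> AE t in lborel. t \<in> {0..r} \<longrightarrow> g r t + conv h (g r) t = h t"
    and inj: "\<And>\<rho> f. \<lbrakk>0 < \<rho>; \<rho> \<le> R; sq_integrable f; \<And>x. x \<notin> {0..\<rho>} \<Longrightarrow> f x = 0;
        AE t in lborel. t \<in> {0..\<rho>} \<longrightarrow> f t + conv h f t = 0\<rbrakk> \<Longrightarrow> AE t in lborel. f t = 0"
    and A: "sq_integrable A" and A_supp: "x \<notin> {-R..R} \<Longrightarrow> A x = 0"
    and A_eq: "AE r in lborel. r \<in> {0<..R} \<longrightarrow> cnj (A r) = h r - conv h (g r) r"
begin

section \<open>Resolvent bounds uniform in r, and increments of the resolvent kernel\<close>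

definition T :: "real \<Rightarrow> (real \<Rightarrow> complex) \<Rightarrow> real \<Rightarrow> complex" where
  "T r f = cut {0..r} (\<lambda>t. f t + conv h f t)"

text \<open>A common bound for the inverses of I + H on L^2[0, r], for all r in (0, R];
  \<open>convolution_bounded_below\<close> provides one.\<close>

definition C :: real where
  "C = (SOME C. C > 0 \<and> (\<forall>r f. 0 < r \<longrightarrow> r \<le> R \<longrightarrow> sq_integrable f \<longrightarrow> (\<forall>x. x \<notin> {0..r} \<longrightarrow> f x = 0) \<longrightarrow>
      norm2 f \<le> C * norm2 (T r f)))"

lemma C_ex: "\<exists>C. C > 0 \<and> (\<forall>r f. 0 < r \<longrightarrow> r \<le> R \<longrightarrow> sq_integrable f \<longrightarrow> (\<forall>x. x \<notin> {0..r} \<longrightarrow> f x = 0) \<longrightarrow>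
      norm2 f \<le> C * norm2 (T r f))"
proof (rule convolution_bounded_below[OF h _ R])
  fix C assume "C > 0" and bound: "\<And>r f. \<lbrakk>0 < r; r \<le> R; sq_integrable f; \<And>x. x \<notin> {0..r} \<Longrightarrow> f x = 0\<rbrakk> \<Longrightarrow>
      norm2 f \<le> C * norm2 (cut {0..r} (\<lambda>t. f t + conv h f t))"
  show ?thesis
  proof (intro exI[of _ C] conjI allI impI)
    fix r f assume *: "0 < r" "r \<le> R" "sq_integrable f" "\<forall>x. x \<notin> {0..r} \<longrightarrow> f x = 0"
    show "norm2 f \<le> C * norm2 (T r f)" unfolding T_def by (rule bound[OF *(1-3)]) (use *(4) in auto)
  qed fact
next
  fix \<rho> :: real and f :: "real \<Rightarrow> complex"
  assume "0 < \<rho>" "\<rho> \<le> R" "sq_integrable f" "\<And>x. x \<notin> {0..\<rho>} \<Longrightarrow> f x = 0"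
    "AE t in lborel. t \<in> {0..\<rho>} \<longrightarrow> f t + conv h f t = 0"
  then show "AE t in lborel. f t = 0" by (rule inj)
qed (rule h_supp)

lemma C_pos: "C > 0"
  using someI_ex[OF C_ex] unfolding C_def[symmetric] by (rule conjunct1)

lemma C_bound:
  assumes "0 < r" "r \<le> R" "sq_integrable f" "\<And>x. x \<notin> {0..r} \<Longrightarrow> f x = 0"
  shows "norm2 f \<le> C * norm2 (T r f)"
  using conjunct2[OF someI_ex[OF C_ex], folded C_def, rule_format, OF assms] .

lemma h_m [measurable]: "h \<in> borel_measurable borel" using h by measurable

lemma A_m [measurable]: "A \<in> borel_measurable borel" using A by measurable

lemma norm2_g: "0 \<le> r \<Longrightarrow> r \<le> R \<Longrightarrow> norm2 (g r) \<le> C * norm2 h"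
proof -
  assume r: "0 \<le> r" "r \<le> R"
  have [measurable]: "g r \<in> borel_measurable borel" using g[OF r] by measurable
  show ?thesis
  proof (cases "r = 0")
    case True
    have "AE x in lborel. g r x = 0"
      using AE_lborel_singleton[of 0] by eventually_elim (use g_supp[of _ r] True in auto)
    then have "norm2 (g r) = norm2 (\<lambda>x. 0)" by (intro norm2_cong_AE) auto
    then show ?thesis using C_pos by (simp add: norm2_def)
  next
    case False
    then have "norm2 (g r) \<le> C * norm2 (T r (g r))"
      using r by (intro C_bound g g_supp) auto
    also have "norm2 (T r (g r)) \<le> norm2 h"
    proof (rule sq_integrable_bound(2)[OF _ h])
      have "AE t in lborel. t \<in> {0..r} \<longrightarrow> g r t + conv h (g r) t = h t" using g_eq r False by simp
      then show "AE x in lborel. cmod (T r (g r) x) \<le> cmod (h x)"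
        by eventually_elim (auto simp: T_def cut_def)
    qed (simp add: T_def)
    finally show ?thesis using C_pos by simp
  qed
qed

text \<open>An additive function of intervals whose root dominates both the norm of h on (a, b] and
  sqrt (b - a). Error terms will be products of two such roots and thus be controlled by
  \<open>m a b\<close> itself.\<close>

definition m :: "real \<Rightarrow> real \<Rightarrow> real" where
  "m a b = (norm2 (cut {a<..b} h))\<^sup>2 + (norm2 (cut {a<..b} A))\<^sup>2 + (b - a)"

lemma m_add: "a \<le> b \<Longrightarrow> b \<le> c \<Longrightarrow> m a c = m a b + m b c"
  unfolding m_def using norm2_cut_split[OF h, of a b c] norm2_cut_split[OF A, of a b c] by simp

lemma m_nonneg: "a \<le> b \<Longrightarrow> 0 \<le> m a b"
  by (simp add: m_def)

lemma m_mono: "a \<le> u \<Longrightarrow> u \<le> b \<Longrightarrow> m u b \<le> m a b"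
  using m_add[of a u b] m_nonneg[of a u] by simp

lemma m_ge: "a \<le> b \<Longrightarrow> norm2 (cut {a<..b} h) \<le> sqrt (m a b)" "a \<le> b \<Longrightarrow> sqrt (b - a) \<le> sqrt (m a b)"
  "a \<le> b \<Longrightarrow> b - a \<le> m a b"
  by (auto intro!: real_le_rsqrt simp: m_def)

lemma m_small:
  assumes "e > 0"
  obtains \<delta> where "\<delta> > 0" "\<And>a b. a \<le> b \<Longrightarrow> b - a < \<delta> \<Longrightarrow> sqrt (m a b) < e"
proof -
  define e' where "e' = e / 2"
  have e': "e' > 0" "4 * e'\<^sup>2 = e\<^sup>2" using assms by (auto simp: e'_def power2_eq_square)
  obtain d1 where d1: "d1 > 0" "\<And>a b. a \<le> b \<Longrightarrow> b - a < d1 \<Longrightarrow> norm2 (cut {a<..b} h) < e'"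
    using norm2_cut_small[OF h h_supp R e'(1)] by metis
  obtain d2 where d2: "d2 > 0" "\<And>a b. a \<le> b \<Longrightarrow> b - a < d2 \<Longrightarrow> norm2 (cut {a<..b} A) < e'"
    using norm2_cut_small[OF A A_supp R e'(1)] by metis
  show thesis
  proof (rule that[of "min (min d1 d2) (e'\<^sup>2)"])
    show "0 < min (min d1 d2) (e'\<^sup>2)" using d1 d2 e' by simp
    fix a b :: real assume ab: "a \<le> b" "b - a < min (min d1 d2) (e'\<^sup>2)"
    have "(norm2 (cut {a<..b} h))\<^sup>2 < e'\<^sup>2" "(norm2 (cut {a<..b} A))\<^sup>2 < e'\<^sup>2"
      using d1(2)[of a b] d2(2)[of a b] ab by (auto intro!: power_strict_mono)
    then have "m a b < 4 * e'\<^sup>2" using ab by (simp add: m_def)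
    then have "sqrt (m a b) < sqrt (e\<^sup>2)" unfolding e' by (rule real_sqrt_less_mono)
    then show "sqrt (m a b) < e" using assms by simp
  qed
qed

definition C1 :: real where "C1 = C * (1 + norm2 h * (C * norm2 h))"

lemma C1_nonneg: "C1 \<ge> 0" using C_pos by (simp add: C1_def)

text \<open>On \<open>[0, b]\<close> the difference \<open>\<psi> = g b - g a\<close> solves \<open>(I + H)\<psi> = 0\<close> except on \<open>(a, b]\<close>.\<close>

lemma norm2_g_diff:
  assumes ab: "0 \<le> a" "a \<le> b" "b \<le> R"
  shows "norm2 (\<lambda>x. g b x - g a x) \<le> C1 * sqrt (m a b)"
proof (cases "a = b")
  case True
  then show ?thesis using C1_nonneg m_nonneg[of a b] ab by (simp add: norm2_def)
next
  case False
  have ga: "sq_integrable (g a)" and gb: "sq_integrable (g b)" using g ab by auto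
  have [measurable]: "g a \<in> borel_measurable borel" "g b \<in> borel_measurable borel" using ga gb by measurable
  define \<psi> where "\<psi> = (\<lambda>x. g b x - g a x)"
  have \<psi>: "sq_integrable \<psi>" unfolding \<psi>_def by (rule sq_integrable_diff[OF gb ga])
  have \<psi>0: "\<psi> x = 0" if "x \<notin> {0..b}" for x using that g_supp[of x b] g_supp[of x a] ab by (auto simp: \<psi>_def)
  have conv: "conv h \<psi> t = conv h (g b) t - conv h (g a) t" for t
    unfolding \<psi>_def by (rule conv_diff_right[OF h gb ga])
  have "AE t in lborel. t \<in> {0..b} \<longrightarrow> g b t + conv h (g b) t = h t" using g_eq ab False by simp
  moreover have "AE t in lborel. t \<in> {0..a} \<longrightarrow> g a t + conv h (g a) t = h t"
  proof (cases "a = 0")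
    case True
    show ?thesis using AE_lborel_singleton[of 0] by eventually_elim (use True in auto)
  qed (use g_eq ab in auto)
  \<comment> \<open>On [0, a] the two resolvent equations cancel. On (a, b] the function
    \<open>g a\<close> vanishes, but its convolution with h does not.\<close>
  ultimately have AE: "AE t in lborel. T b \<psi> t = cut {a<..b} h t - cut {a<..b} (conv h (g a)) t"
    by eventually_elim (use ab g_supp[of _ a] in \<open>auto simp: T_def cut_def conv[unfolded \<psi>_def] \<psi>_def algebra_simps not_le\<close>)
  have c2: "sq_integrable (cut {a<..b} (conv h (g a)))" "norm2 (cut {a<..b} (conv h (g a))) \<le> (norm2 h * (C * norm2 h)) * sqrt (b - a)"
  proof -
    have "cmod (conv h (g a) x) \<le> norm2 h * (C * norm2 h)" for x
      by (rule order_trans[OF conv_bound[OF h ga] mult_left_mono]) (use norm2_g ab in auto)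
    then have "cmod (cut {a<..b} (conv h (g a)) x) \<le> norm2 h * (C * norm2 h)" for x
      using C_pos by (simp add: cut_def)
    moreover have "cut {a<..b} (conv h (g a)) x = 0" if "x \<notin> {a..b}" for x using that by (auto simp: cut_def)
    ultimately show "sq_integrable (cut {a<..b} (conv h (g a)))" "norm2 (cut {a<..b} (conv h (g a))) \<le> (norm2 h * (C * norm2 h)) * sqrt (b - a)"
      using sq_integrable_interval[of "cut {a<..b} (conv h (g a))" a b "norm2 h * (C * norm2 h)"] ab C_pos
      by auto
  qed
  have "norm2 (T b \<psi>) = norm2 (\<lambda>t. cut {a<..b} h t - cut {a<..b} (conv h (g a)) t)"
  proof (rule norm2_cong_AE[OF _ _ AE])
    have [measurable]: "\<psi> \<in> borel_measurable borel" using \<psi> by measurable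
    show "T b \<psi> \<in> borel_measurable borel" unfolding T_def by measurable
    show "(\<lambda>t. cut {a<..b} h t - cut {a<..b} (conv h (g a)) t) \<in> borel_measurable borel" by measurable
  qed
  also have "\<dots> \<le> norm2 (cut {a<..b} h) + norm2 (cut {a<..b} (conv h (g a)))"
    by (rule norm2_triangle_diff[OF sq_integrable_cut(1)[OF h] c2(1)]) simp
  also have "\<dots> \<le> sqrt (m a b) + (norm2 h * (C * norm2 h)) * sqrt (m a b)"
    using m_ge(1,2)[OF ab(2)] c2(2) C_pos
    by (intro add_mono order_trans[OF c2(2)] mult_left_mono) auto
  finally have "norm2 (T b \<psi>) \<le> (1 + norm2 h * (C * norm2 h)) * sqrt (m a b)" by (simp add: algebra_simps)
  moreover have "norm2 \<psi> \<le> C * norm2 (T b \<psi>)" using C_bound[OF _ _ \<psi> \<psi>0] ab False by simp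
  ultimately have "norm2 \<psi> \<le> C * ((1 + norm2 h * (C * norm2 h)) * sqrt (m a b))"
    using C_pos by (meson mult_left_mono less_imp_le order_trans)
  then show ?thesis by (simp add: \<psi>_def C1_def mult.assoc)
qed

text \<open>By \<open>A_eq\<close> the number cnj (A u) is what the resolvent equation of
  \<open>g u\<close> assigns to the endpoint u, so on (a, b] it differs from \<open>g b\<close> only
  by the convolution of h with g b - g u. Convolution with h turns the small L^2 norm of that
  difference into a small pointwise bound.\<close>

lemma g_diff_A:
  assumes ab: "0 \<le> a" "a < b" "b \<le> R"
  shows "AE u in lborel. u \<in> {a<..b} \<longrightarrow> cmod ((g b u - g a u) - cnj (A u)) \<le> norm2 h * C1 * sqrt (m a b)"
proof -
  have "AE t in lborel. t \<in> {0..b} \<longrightarrow> g b t + conv h (g b) t = h t" using g_eq ab by simp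
  then show ?thesis using A_eq
  proof eventually_elim
    case (elim u)
    show ?case
    proof
      assume u: "u \<in> {a<..b}"
      have gu: "sq_integrable (g u)" and gb: "sq_integrable (g b)" using g ab u by auto
      have "(g b u - g a u) - cnj (A u) = - conv h (\<lambda>x. g b x - g u x) u"
      proof -
        have "g b u = h u - conv h (g b) u" using elim(1) u ab by (simp add: eq_diff_eq)
        moreover have "cnj (A u) = h u - conv h (g u) u" using elim(2) u ab by simp
        moreover have "g a u = 0" using g_supp u by simp
        ultimately show ?thesis unfolding conv_diff_right[OF h gb gu] by simp
      qed
      then have "cmod ((g b u - g a u) - cnj (A u)) \<le> norm2 h * norm2 (\<lambda>x. g b x - g u x)"
        using conv_bound[OF h sq_integrable_diff[OF gb gu], of u] by simp
      also have "\<dots> \<le> norm2 h * (C1 * sqrt (m u b))"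
        using norm2_g_diff[of u b] u ab by (intro mult_left_mono) auto
      also have "\<dots> \<le> norm2 h * (C1 * sqrt (m a b))"
        using m_mono[of a u b] u C1_nonneg by (intro mult_left_mono) auto
      finally show "cmod ((g b u - g a u) - cnj (A u)) \<le> norm2 h * C1 * sqrt (m a b)" by (simp add: mult.assoc)
    qed
  qed
qed

text \<open>The derivative of \<open>g r\<close> in \<open>r\<close> at \<open>t\<close> is \<open>- \<Gamma>\<^sub>r(t, r) \<Gamma>\<^sub>r(r, 0)\<close>, and \<open>\<Gamma>\<^sub>r(t, r)\<close> is the
  conjugate of \<open>g r (r - t)\<close>; the error comes from replacing \<open>h (t - u)\<close> by \<open>h (t - a)\<close> for
  \<open>u\<close> in \<open>(a, b]\<close>.\<close>

definition err :: "real \<Rightarrow> real \<Rightarrow> real \<Rightarrow> complex" where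
  "err a b = cut {0..a} (\<lambda>t. (g b t - g a t) + cnj (g a (a - t)) * (LINT u|lborel. cut {a<..b} (\<lambda>u. g b u - g a u) u))"

text \<open>Apply I + H on [0, a] to the three pieces of \<open>err\<close>: the increment \<psi> is
  annihilated, the reflected function \<phi> gives h(t - a), and the part w of \<psi> on (a, b]
  contributes its convolution with h. As \<beta> is the integral of w, what remains is minus the
  integral of (h(t - u) - h(t - a)) w(u), controlled by the modulus \<omega> times the L^1 norm of
  w. Each of the two factors in the bound of that norm is at most a multiple of sqrt (m a
  b).\<close>

lemma err_bound:
  assumes ab: "0 \<le> a" "a < b" "b \<le> R" and \<omega>: "\<omega> \<ge> 0"
    and mod: "\<And>u. u \<in> {a<..b} \<Longrightarrow> norm2 (\<lambda>t. h (t - u) - h (t - a)) \<le> \<omega>"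
  shows "sq_integrable (err a b)" "norm2 (err a b) \<le> C * \<omega> * C1 * m a b"
proof -
  have ga: "sq_integrable (g a)" and gb: "sq_integrable (g b)" using g ab by auto
  have [measurable]: "g a \<in> borel_measurable borel" "g b \<in> borel_measurable borel" using ga gb by measurable
  define \<psi> where "\<psi> = (\<lambda>x. g b x - g a x)"
  have \<psi>: "sq_integrable \<psi>" unfolding \<psi>_def by (rule sq_integrable_diff[OF gb ga])
  have [measurable]: "\<psi> \<in> borel_measurable borel" using \<psi> by measurable
  define w where "w = cut {a<..b} \<psi>"
  have w: "sq_integrable w" "norm2 w \<le> norm2 \<psi>" unfolding w_def using sq_integrable_cut[OF \<psi>, of "{a<..b}"] by auto
  have w0: "w x = 0" if "x \<notin> {a..b}" for x using that by (auto simp: w_def cut_def)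
  have wi: "integrable lborel w" "(LINT x|lborel. cmod (w x)) \<le> sqrt (b - a) * norm2 w"
    using sq_integrable_imp_integrable[OF w(1), of a b] w0 ab by auto
  define \<beta> where "\<beta> = (LINT u|lborel. w u)"
  define \<phi> where "\<phi> = (\<lambda>t. cnj (g a (a - t)))"
  have \<phi>: "sq_integrable \<phi>" unfolding \<phi>_def by (rule sq_integrable_cnj(1)[OF sq_integrable_affine(1)[OF ga]])
  have \<phi>0: "\<phi> t = 0" if "t \<notin> {0..a}" for t using that g_supp[of "a - t" a] by (auto simp: \<phi>_def)
  have err_eq: "err a b = (\<lambda>t. (\<psi> t - w t) + \<beta> * \<phi> t)"
  proof
    fix t
    have "\<psi> t = 0" if "t \<notin> {0..b}" using that g_supp[of t b] g_supp[of t a] ab by (auto simp: \<psi>_def)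
    moreover have "err a b t = (if t \<in> {0..a} then \<psi> t + \<beta> * \<phi> t else 0)"
      by (simp add: err_def \<beta>_def w_def \<psi>_def \<phi>_def) (simp add: cut_def)
    moreover have "w t = (if t \<in> {a<..b} then \<psi> t else 0)" by (simp add: w_def cut_def)
    ultimately show "err a b t = (\<psi> t - w t) + \<beta> * \<phi> t"
      using \<phi>0[of t] ab by auto
  qed
  have c\<phi>: "sq_integrable (\<lambda>t. \<beta> * \<phi> t)" by (rule sq_integrable_cmult(1)[OF \<phi>])
  show err: "sq_integrable (err a b)"
    unfolding err_eq by (intro sq_integrable_add sq_integrable_diff \<psi> w c\<phi>)
  have err0: "err a b t = 0" if "t \<notin> {0..a}" for t using that by (auto simp: err_def cut_def)
  show "norm2 (err a b) \<le> C * \<omega> * C1 * m a b"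
  proof (cases "a = 0")
    case True
    have "AE x in lborel. err a b x = 0"
      using AE_lborel_singleton[of 0] by eventually_elim (use err0 True in auto)
    then have "norm2 (err a b) = norm2 (\<lambda>x. 0)" using err by (intro norm2_cong_AE) auto
    then show ?thesis using C_pos C1_nonneg \<omega> m_nonneg[of a b] ab by (simp add: norm2_def)
  next
    case False
    then have a: "a > 0" using ab by simp
    define K where "K t u = h (t - u) - h (t - a)" for t u
    define k where "k t = (LINT u|lborel. K t u * w u)" for t
    \<comment> \<open>Hermitian symmetry of h makes the convolution commute with the reflection t ->
      a - t followed by conjugation.\<close>
    have conv\<phi>: "conv h \<phi> t = cnj (conv h (g a) (a - t))" for t
    proof -
      have "conv h \<phi> t = (LINT u|lborel. h (t - (a + (-1) * u)) * cnj (g a (a - (a + (-1) * u))))"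
        unfolding conv_def \<phi>_def by (subst lborel_integral_real_affine[of "-1" _ a]) auto
      also have "\<dots> = (LINT u|lborel. cnj (h (a - t - u) * g a u))"
        by (intro Bochner_Integration.integral_cong) (auto simp: h_cnj[symmetric] algebra_simps)
      also have "\<dots> = cnj (conv h (g a) (a - t))" by (simp add: conv_def del: complex_cnj_mult)
      finally show ?thesis .
    qed
    have "AE t in lborel. t \<in> {0..a} \<longrightarrow> g a t + conv h (g a) t = h t" using g_eq ab a by simp
    then have "AE t in lborel. a - t \<in> {0..a} \<longrightarrow> g a (a - t) + conv h (g a) (a - t) = h (a - t)"
      by (rule AE_lborel_reflect)
    then have 1: "AE t in lborel. t \<in> {0..a} \<longrightarrow> \<phi> t + conv h \<phi> t = h (t - a)"
    proof eventually_elim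
      case (elim t)
      show ?case
      proof
        assume "t \<in> {0..a}"
        then have "cnj (g a (a - t) + conv h (g a) (a - t)) = cnj (h (a - t))" using elim by simp
        then show "\<phi> t + conv h \<phi> t = h (t - a)" unfolding conv\<phi> by (simp add: \<phi>_def h_cnj[symmetric])
      qed
    qed
    have 2: "AE t in lborel. t \<in> {0..a} \<longrightarrow> \<psi> t + conv h \<psi> t = 0"
    proof -
      have "AE t in lborel. t \<in> {0..a} \<longrightarrow> g a t + conv h (g a) t = h t" using g_eq ab a by simp
      moreover have "AE t in lborel. t \<in> {0..b} \<longrightarrow> g b t + conv h (g b) t = h t" using g_eq ab a by simp
      ultimately show ?thesis
        by eventually_elim (use ab in \<open>auto simp: \<psi>_def conv_diff_right[OF h gb ga] algebra_simps\<close>)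
    qed
    have k_eq: "k t = conv h w t - \<beta> * h (t - a)" for t
      unfolding k_def K_def conv_def \<beta>_def using conv_integrable[OF h w(1), of t] wi(1)
      by (simp add: algebra_simps)
    have "AE t in lborel. T a (err a b) t = cut {0..a} (\<lambda>t. - k t) t"
      using 1 2
    proof eventually_elim
      case (elim t)
      show ?case
      proof (cases "t \<in> {0..a}")
        case True
        then have wt: "w t = 0" by (simp add: w_def cut_def)
        have c: "conv h (err a b) t = (conv h \<psi> t - conv h w t) + \<beta> * conv h \<phi> t"
          unfolding err_eq using conv_add_right[OF h sq_integrable_diff[OF \<psi> w(1)] c\<phi>] conv_diff_right[OF h \<psi> w(1)] conv_cmult_right[of h \<beta> \<phi>]
          by simp
        have e: "err a b t = \<psi> t + \<beta> * \<phi> t" by (simp add: err_eq wt)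
        have "err a b t + conv h (err a b) t = (\<psi> t + conv h \<psi> t) + \<beta> * (\<phi> t + conv h \<phi> t) - conv h w t"
          unfolding c e by (simp add: algebra_simps)
        then show ?thesis using elim True by (simp add: T_def cut_def k_eq)
      qed (auto simp: T_def cut_def)
    qed
    moreover have Km: "case_prod K \<in> borel_measurable (borel \<Otimes>\<^sub>M borel)" unfolding K_def by measurable
    have Ksq: "sq_integrable (\<lambda>t. K t u)" for u
      unfolding K_def by (intro sq_integrable_diff sq_integrable_affine h)
    have k: "sq_integrable k" "norm2 k \<le> \<omega> * (LINT u|lborel. cmod (w u))"
      unfolding k_def
      by (rule norm2_integral_le[OF Km wi(1) \<omega> Ksq]; use mod in \<open>auto simp: K_def w_def cut_def split: if_splits\<close>)+
    have [measurable]: "k \<in> borel_measurable borel" using k by measurable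
    have [measurable]: "err a b \<in> borel_measurable borel" using err by measurable
    ultimately have "norm2 (T a (err a b)) = norm2 (cut {0..a} (\<lambda>t. - k t))"
      by (intro norm2_cong_AE) (auto simp: T_def)
    also have "\<dots> \<le> norm2 k"
      by (rule sq_integrable_bound(2)[OF _ k(1)]) (auto simp: cut_def)
    also have "\<dots> \<le> \<omega> * (sqrt (b - a) * norm2 \<psi>)"
      using k(2) wi(2) w(2) \<omega> ab by (meson mult_left_mono order_trans real_sqrt_ge_zero diff_ge_0_iff_ge less_imp_le)
    also have "\<dots> \<le> \<omega> * (sqrt (m a b) * (C1 * sqrt (m a b)))"
      using m_ge(2)[of a b] norm2_g_diff[of a b] ab \<omega> m_nonneg[of a b]
      by (intro mult_left_mono mult_mono) (auto simp: \<psi>_def)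
    also have "\<dots> = \<omega> * (C1 * m a b)" using m_nonneg[of a b] ab by (simp add: algebra_simps real_sqrt_mult_self)
    finally have "norm2 (T a (err a b)) \<le> \<omega> * (C1 * m a b)" .
    then have "norm2 (err a b) \<le> C * (\<omega> * (C1 * m a b))"
      using C_bound[OF a _ err err0] ab C_pos by (meson mult_left_mono less_imp_le order_trans)
    then show ?thesis by (simp add: mult.assoc)
  qed
qed

end

section \<open>Integral inequalities\<close>

text \<open>If f is not integrable its integral has the default value 0, and w is nonnegative almost
  everywhere.\<close>

lemma norm_integral_le:
  fixes f :: "'a \<Rightarrow> complex"
  assumes "integrable M w" "AE x in M. cmod (f x) \<le> w x"
  shows "cmod (LINT x|M. f x) \<le> (LINT x|M. w x)"
proof (cases "integrable M f")
  case True
  have "cmod (LINT x|M. f x) \<le> (LINT x|M. cmod (f x))" by (rule integral_norm_bound)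
  also have "\<dots> \<le> (LINT x|M. w x)"
    by (rule integral_mono_AE) (use True assms in auto)
  finally show ?thesis .
next
  case False
  have "AE x in M. 0 \<le> w x" using assms(2) by eventually_elim (rule order_trans[OF norm_ge_zero])
  then have "0 \<le> (LINT x|M. w x)" by (rule integral_nonneg_AE)
  then show ?thesis using False by (simp add: not_integrable_integral_eq)
qed

text \<open>Over an interval on which k has integral at most 1/2 and to the left of which D
  vanishes, the maximum of D is at most half of itself. Steps of length \<delta>/2 cover
  [0, R].\<close>

lemma gronwall_zero:
  fixes D k :: "real \<Rightarrow> real"
  assumes cont: "continuous_on {0..R} D" and nn: "\<And>x. x \<in> {0..R} \<Longrightarrow> 0 \<le> D x"
    and k: "integrable lborel k" "\<And>x. 0 \<le> k x"
    and \<delta>: "\<delta> > 0" "\<And>a b. \<lbrakk>0 \<le> a; a \<le> b; b \<le> R; b - a < \<delta>\<rbrakk> \<Longrightarrow> (LINT u|lborel. indicator {a<..b} u * k u) \<le> 1 / 2"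
    and le: "\<And>x. x \<in> {0..R} \<Longrightarrow> D x \<le> (LINT u|lborel. indicator {0<..x} u * (k u * D u))"
    and x: "x \<in> {0..R}"
  shows "D x = 0"
proof -
  have km[measurable]: "k \<in> borel_measurable borel" using k(1) by (auto dest: borel_measurable_integrable)
  have "x \<in> {0..R} \<Longrightarrow> x \<le> real n * (\<delta> / 2) \<Longrightarrow> D x = 0" for n x
  proof (induction n arbitrary: x)
    case 0
    then have "x = 0" by auto
    then show ?case using le[of 0] nn[of 0] 0 by simp
  next
    case (Suc n)
    show ?case
    proof (cases "x \<le> real n * (\<delta> / 2)")
      case False
      define a where "a = real n * (\<delta> / 2)"
      have a: "0 \<le> a" "a < x" "x - a < \<delta>" "x \<le> R"
        using False Suc.prems \<delta> by (auto simp: a_def algebra_simps)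
      have ca: "continuous_on {a..x} D" using continuous_on_subset[OF cont, of "{a..x}"] a by auto
      obtain y where y: "y \<in> {a..x}" and ymax: "\<And>t. t \<in> {a..x} \<Longrightarrow> D t \<le> D y"
        using continuous_attains_sup[OF compact_Icc _ ca] a by auto
      have ii: "integrable lborel (\<lambda>u. indicator {a<..y} u * k u * D y)"
        by (intro integrable_mult_left Bochner_Integration.integrable_bound[OF k(1)]) (auto simp: indicator_def k(2))
      have "D y \<le> (LINT u|lborel. indicator {0<..y} u * (k u * D u))" using le[of y] y a by auto
      also have "\<dots> \<le> (LINT u|lborel. indicator {a<..y} u * k u * D y)"
      proof (cases "integrable lborel (\<lambda>u. indicator {0<..y} u * (k u * D u))")
        case True
        show ?thesis
        proof (rule integral_mono[OF True ii])
          fix u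
          show "indicator {0<..y} u * (k u * D u) \<le> indicator {a<..y} u * k u * D y"
          proof (cases "u \<in> {a<..y}")
            case True
            then show ?thesis using ymax[of u] y a k(2)[of u] by (simp add: mult_left_mono)
          next
            case u: False
            show ?thesis
            proof (cases "u \<in> {0<..y}")
              case True
              then have "D u = 0" using u Suc.IH[of u] y a by (auto simp: a_def)
              then show ?thesis using k(2)[of u] nn[of y] y a u by simp
            qed (use u in simp)
          qed
        qed
      next
        case False
        have "0 \<le> indicator {a<..y} u * k u * D y" for u using k(2) nn[of y] y a by simp
        then have "0 \<le> (LINT u|lborel. indicator {a<..y} u * k u * D y)" by (rule Bochner_Integration.integral_nonneg)
        then show ?thesis using False by (simp add: not_integrable_integral_eq)
      qed
      also have "\<dots> = (LINT u|lborel. indicator {a<..y} u * k u) * D y" by simp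
      also have "\<dots> \<le> 1 / 2 * D y"
        using \<delta>(2)[of a y] y a nn[of y] by (intro mult_right_mono) auto
      finally have "D y \<le> 0" by simp
      then show ?thesis using ymax[of x] nn[of x] a by auto
    qed (use Suc in auto)
  qed
  moreover obtain n :: nat where "x / (\<delta> / 2) \<le> real n" using real_arch_simple by blast
  then have "x \<le> real n * (\<delta> / 2)" using \<delta> by (simp add: field_simps)
  ultimately show ?thesis using x by blast
qed

section \<open>The Krein equations for the functions made from the resolvent kernel\<close>

context truncated_accelerant
begin

definition Q :: "real \<Rightarrow> complex \<Rightarrow> complex" where "Q r = transform 1 (\<lambda>x. - g r x)"

definition p :: "real \<Rightarrow> complex \<Rightarrow> complex" where "p r l = exp (\<i> * l * of_real r) * Q r l"

text \<open>This is e^(ilr) times the conjugate of \<open>p r (cnj l)\<close>, the usual reversal of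
  P; the exponentials cancel.\<close>

definition ps :: "real \<Rightarrow> complex \<Rightarrow> complex" where "ps r l = cnj (Q r (cnj l))"

lemma g_integrable: "0 \<le> r \<Longrightarrow> r \<le> R \<Longrightarrow> integrable lborel (g r)"
  using sq_integrable_imp_integrable(1)[OF g _ g_supp] by blast

lemma g_density: "0 \<le> r \<Longrightarrow> r \<le> R \<Longrightarrow> density_on r (\<lambda>x. - g r x)"
  using g_integrable g_supp by (auto simp: density_on_def)

lemma Q_eq: "Q r l = 1 - (LINT x|lborel. g r x * exp (- \<i> * l * of_real x))"
  by (simp add: Q_def transform_def)

lemma Q_transforms: "0 \<le> r \<Longrightarrow> r \<le> R \<Longrightarrow> Q r \<in> transforms r"
  using g_density by (auto simp: Q_def transforms_def)

definition EB :: "complex \<Rightarrow> real" where "EB l = exp (cmod l * R) * sqrt R"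

lemma EB_nonneg: "EB l \<ge> 0" using R by (simp add: EB_def)

lemma exp_integral_bound:
  assumes f: "sq_integrable f" and supp: "\<And>x. x \<notin> {0..R} \<Longrightarrow> f x = 0"
  shows "integrable lborel (\<lambda>x. f x * exp (- \<i> * l * of_real x))"
    and "cmod (LINT x|lborel. f x * exp (- \<i> * l * of_real x)) \<le> norm2 f * EB l"
proof -
  define e where "e = cut {0..R} (\<lambda>x. exp (- \<i> * l * of_real x))"
  have em: "e \<in> borel_measurable borel" unfolding e_def by measurable
  have "cmod (e x) \<le> exp (cmod l * R)" if "x \<in> {0..R}" for x
    using cmod_exp_bound[OF that, of l] that by (simp add: e_def cut_def)
  moreover have "e x = 0" if "x \<notin> {0..R}" for x using that by (auto simp: e_def cut_def)
  ultimately have e: "sq_integrable e" "norm2 e \<le> exp (cmod l * R) * sqrt R"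
    using sq_integrable_interval[OF em, of 0 R "exp (cmod l * R)"] R by auto
  have eq: "(\<lambda>x. f x * exp (- \<i> * l * of_real x)) = (\<lambda>x. f x * e x)"
    using supp by (auto simp: e_def cut_def fun_eq_iff)
  show "integrable lborel (\<lambda>x. f x * exp (- \<i> * l * of_real x))"
    unfolding eq by (rule integral_mult_le_norm2(1)[OF f e(1)])
  show "cmod (LINT x|lborel. f x * exp (- \<i> * l * of_real x)) \<le> norm2 f * EB l"
    unfolding eq by (rule order_trans[OF integral_mult_le_norm2(2)[OF f e(1)]])
      (use e(2) in \<open>auto simp: EB_def intro: mult_left_mono\<close>)
qed

lemma g_supp_R: "0 \<le> r \<Longrightarrow> r \<le> R \<Longrightarrow> x \<notin> {0..R} \<Longrightarrow> g r x = 0"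
  using g_supp[of x r] by auto

lemma Q_diff:
  assumes ab: "0 \<le> a" "a \<le> b" "b \<le> R"
  shows "Q b l - Q a l = - (LINT x|lborel. (g b x - g a x) * exp (- \<i> * l * of_real x))"
    and "cmod (Q b l - Q a l) \<le> C1 * sqrt (m a b) * EB l"
proof -
  have ga: "sq_integrable (g a)" and gb: "sq_integrable (g b)" using g ab by auto
  have s: "g a x = 0" "g b x = 0" if "x \<notin> {0..R}" for x using g_supp_R[OF _ _ that] ab by auto
  show eq: "Q b l - Q a l = - (LINT x|lborel. (g b x - g a x) * exp (- \<i> * l * of_real x))"
    using exp_integral_bound(1)[OF ga s(1), of l] exp_integral_bound(1)[OF gb s(2), of l]
    by (simp add: Q_eq left_diff_distrib)
  have "cmod (Q b l - Q a l) \<le> norm2 (\<lambda>x. g b x - g a x) * EB l"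
    unfolding eq norm_minus_cancel by (rule exp_integral_bound(2)[OF sq_integrable_diff[OF gb ga]]) (simp add: s)
  also have "\<dots> \<le> C1 * sqrt (m a b) * EB l"
    using norm2_g_diff[OF ab] EB_nonneg by (rule mult_right_mono)
  finally show "cmod (Q b l - Q a l) \<le> C1 * sqrt (m a b) * EB l" .
qed

lemma Q_0: "Q 0 l = 1"
proof -
  have "AE x in lborel. g 0 x * exp (- \<i> * l * of_real x) = 0"
    using AE_lborel_singleton[of 0] by eventually_elim (use g_supp[of _ 0] in auto)
  then have "(LINT x|lborel. g 0 x * exp (- \<i> * l * of_real x)) = 0" by (rule integral_eq_zero_AE)
  then show ?thesis by (simp add: Q_eq)
qed

lemma Q_continuous: "continuous_on {0..R} (\<lambda>r. Q r l)"
  unfolding continuous_on_iff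
proof (intro ballI allI impI)
  fix x e :: real assume x: "x \<in> {0..R}" and e: "0 < e"
  have pos: "C1 * EB l + 1 > 0" using C1_nonneg EB_nonneg[of l] by (simp add: add_nonneg_pos)
  obtain \<delta> where \<delta>: "\<delta> > 0" "\<And>a b. a \<le> b \<Longrightarrow> b - a < \<delta> \<Longrightarrow> sqrt (m a b) < e / (C1 * EB l + 1)"
    using m_small[of "e / (C1 * EB l + 1)"] e pos by auto
  have main: "dist (Q b l) (Q a l) < e" if "0 \<le> a" "a \<le> b" "b \<le> R" "b - a < \<delta>" for a b
  proof -
    have "dist (Q b l) (Q a l) \<le> (C1 * EB l) * sqrt (m a b)"
      using Q_diff(2)[OF that(1-3), of l] by (simp add: dist_norm mult_ac)
    also have "\<dots> \<le> (C1 * EB l) * (e / (C1 * EB l + 1))"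
      using \<delta>(2)[OF that(2,4)] C1_nonneg EB_nonneg[of l] by (intro mult_left_mono) auto
    also have "\<dots> < e" using pos e by (simp add: field_simps)
    finally show ?thesis .
  qed
  have "dist (Q y l) (Q x l) < e" if "y \<in> {0..R}" "dist y x < \<delta>" for y
    using main[of x y] main[of y x] that x by (cases "x \<le> y") (auto simp: dist_real_def dist_commute)
  then show "\<exists>d>0. \<forall>y\<in>{0..R}. dist y x < d \<longrightarrow> dist (Q y l) (Q x l) < e" using \<delta>(1) by blast
qed

lemma p_continuous: "continuous_on {0..R} (\<lambda>r. p r l)"
  and ps_continuous: "continuous_on {0..R} (\<lambda>r. ps r l)"
  unfolding p_def ps_def by (intro continuous_intros Q_continuous)+

lemma g_diff_decomposition:
  assumes ab: "0 \<le> a" "a < b" "b \<le> R"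
  defines "\<beta> \<equiv> (LINT u|lborel. cut {a<..b} (\<lambda>u. g b u - g a u) u)"
  shows "g b t - g a t = err a b t + cut {a<..b} (\<lambda>u. g b u - g a u) t - \<beta> * cnj (g a (a - t))"
proof -
  have "g b t - g a t = 0" if "t \<notin> {0..b}" using that g_supp[of t b] g_supp[of t a] ab by auto
  moreover have "g a (a - t) = 0" if "t \<notin> {0..a}" using that g_supp[of "a - t" a] by auto
  ultimately show ?thesis
    using ab unfolding err_def \<beta>_def[symmetric] by (auto simp: cut_def)
qed

lemma reflected_transform:
  assumes "0 \<le> a" "a \<le> R"
  shows "(LINT t|lborel. cnj (g a (a - t)) * exp (- \<i> * l * of_real t)) = exp (- \<i> * l * of_real a) * (1 - ps a l)"
proof -
  have "(LINT t|lborel. cnj (g a (a - t)) * exp (- \<i> * l * of_real t)) =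
      (LINT t|lborel. cnj (g a (a - (a + (-1) * t))) * exp (- \<i> * l * of_real (a + (-1) * t)))"
    by (subst lborel_integral_real_affine[of "-1" _ a]) auto
  also have "\<dots> = (LINT t|lborel. exp (- \<i> * l * of_real a) * cnj (g a t * exp (- \<i> * cnj l * of_real t)))"
    by (intro Bochner_Integration.integral_cong) (auto simp: exp_cnj exp_add[symmetric] algebra_simps exp_minus_inverse)
  also have "\<dots> = exp (- \<i> * l * of_real a) * (1 - ps a l)"
    by (simp add: ps_def Q_eq del: complex_cnj_mult)
  finally show ?thesis .
qed

text \<open>The first Krein equation with the exponential factored out. By
  \<open>g_diff_decomposition\<close> the increment of Q over (a, b] comes from the transform of
  \<open>err\<close>, from that of the new piece w of the kernel on (a, b], and from \<beta> times a
  reflected transform. Were w concentrated at a, the last two would combine to -\<beta> e^(-ila)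
  ps(a, l), and \<beta> is nearly the integral of cnj A.\<close>

lemma Q_krein:
  assumes r: "0 \<le> r" "r \<le> R"
  shows "Q r l = 1 - (LINT u|lborel. indicator {0<..r} u *\<^sub>R (cnj (A u) * (exp (- \<i> * l * of_real u) * ps u l)))"
proof -
  define q where "q u = exp (- \<i> * l * of_real u) * ps u l" for u
  define q0 where "q0 = cut {0..R} q"
  have qc: "continuous_on {0..R} q" unfolding q_def by (intro continuous_intros ps_continuous)
  have q0_eq: "q0 = (\<lambda>x. indicator {0..R} x *\<^sub>R q x)" by (auto simp: q0_def cut_def)
  have q0m [measurable]: "q0 \<in> borel_measurable borel"
    unfolding q0_eq by (rule borel_measurable_continuous_on_indicator[OF _ qc]) simp
  have "bounded (q ` {0..R})" by (intro compact_imp_bounded compact_continuous_image qc) auto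
  then obtain B0 where B0: "\<And>x. x \<in> {0..R} \<Longrightarrow> cmod (q x) \<le> B0" unfolding bounded_iff by blast
  define B where "B = max B0 0"
  have B: "B \<ge> 0" "x \<in> {0..R} \<Longrightarrow> cmod (q x) \<le> B" for x using B0[of x] by (auto simp: B_def)
  have q0: "sq_integrable q0"
    by (rule sq_integrable_interval(1)[OF q0m, where a=0 and b=R and B=B]) (use B R in \<open>auto simp: q0_def cut_def\<close>)
  define k where "k u = - (cnj (A u) * q0 u)" for u
  have k: "integrable lborel k"
    unfolding k_def using integral_mult_le_norm2(1)[OF sq_integrable_cnj(1)[OF A] q0] by simp
  \<comment> \<open>One summand for each error term of \<open>decomp\<close>: the transform of
    \<open>err\<close>, the variation of the exponential, the difference between cnj A and the
    kernel, the variation of q.\<close>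
  define N where "N = EB l * (C * C1) + C1 + B * (norm2 h * C1) + C1"
  have N: "N \<ge> 0" unfolding N_def using C_pos C1_nonneg B(1) EB_nonneg[of l] by (intro add_nonneg_nonneg mult_nonneg_nonneg) auto
  have main: "cmod (Q b l - Q a l - (LINT x|lborel. indicator {a<..b} x *\<^sub>R k x)) \<le> e * N * m a b"
    if ab: "0 \<le> a" "a < b" "b \<le> R" and e: "e \<ge> 0"
      and e1: "\<And>u. u \<in> {a<..b} \<Longrightarrow> norm2 (\<lambda>t. h (t - u) - h (t - a)) \<le> e"
      and e2: "\<And>u. u \<in> {a<..b} \<Longrightarrow> cmod (exp (- \<i> * l * of_real u) - exp (- \<i> * l * of_real a)) \<le> e"
      and e3: "\<And>u. u \<in> {a<..b} \<Longrightarrow> cmod (q u - q a) \<le> e"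
      and e4: "sqrt (m a b) \<le> e" for a b e
  proof -
    have ga: "sq_integrable (g a)" and gb: "sq_integrable (g b)" using g ab by auto
    define E where "E x = exp (- \<i> * l * of_real x)" for x :: real
    define \<psi> where "\<psi> = (\<lambda>x. g b x - g a x)"
    have \<psi>: "sq_integrable \<psi>" unfolding \<psi>_def by (rule sq_integrable_diff[OF gb ga])
    have [measurable]: "\<psi> \<in> borel_measurable borel" using \<psi> by measurable
    define w where "w = cut {a<..b} \<psi>"
    have w: "sq_integrable w" "norm2 w \<le> norm2 \<psi>" unfolding w_def using sq_integrable_cut[OF \<psi>, of "{a<..b}"] by auto
    have w0: "w x = 0" if "x \<notin> {a<..b}" for x using that by (auto simp: w_def cut_def)
    have wi: "integrable lborel w" "(LINT x|lborel. cmod (w x)) \<le> sqrt (b - a) * norm2 w"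
      using sq_integrable_imp_integrable[OF w(1), of a b] w0 ab by auto
    have mp: "m a b \<ge> 0" using m_nonneg ab by simp
    have "sqrt (b - a) * norm2 w \<le> sqrt (m a b) * (C1 * sqrt (m a b))"
      using m_ge(2)[of a b] ab w(2) norm2_g_diff[of a b] by (intro mult_mono) (auto simp: \<psi>_def)
    then have w1: "(LINT x|lborel. cmod (w x)) \<le> C1 * m a b" using wi(2) mp by (simp add: mult_ac real_sqrt_mult_self)
    define \<beta> where "\<beta> = (LINT u|lborel. w u)"
    note err = err_bound[OF ab e e1]
    have err0: "err a b x = 0" if "x \<notin> {0..R}" for x using that ab by (auto simp: err_def cut_def)
    note errE = exp_integral_bound[OF err(1) err0, of l, folded E_def]
    have wE: "integrable lborel (\<lambda>x. w x * E x)"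
      unfolding E_def by (rule exp_integral_bound(1)[OF w(1)]) (use w0 ab in auto)
    have \<phi>E: "integrable lborel (\<lambda>t. cnj (g a (a - t)) * E t)"
      unfolding E_def by (rule exp_integral_bound(1)[OF sq_integrable_cnj(1)[OF sq_integrable_affine(1)[OF ga]]])
        (use g_supp[of "a - _" a] ab in auto)
    have "Q b l - Q a l = - (LINT x|lborel. \<psi> x * E x)"
      using Q_diff(1)[of a b l] ab by (simp add: \<psi>_def E_def)
    also have "\<dots> = - (LINT x|lborel. err a b x * E x + w x * E x - \<beta> * (cnj (g a (a - x)) * E x))"
    proof -
      have psi_eq: "\<psi> x = err a b x + w x - \<beta> * cnj (g a (a - x))" for x
        using g_diff_decomposition[OF ab, of x] by (simp only: \<psi>_def w_def \<beta>_def)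
      have "\<psi> x * E x = err a b x * E x + w x * E x - \<beta> * (cnj (g a (a - x)) * E x)" for x
        unfolding psi_eq by (simp only: algebra_simps)
      then show ?thesis by simp
    qed
    also have "\<dots> = - (LINT x|lborel. err a b x * E x) - (LINT x|lborel. w x * E x) + \<beta> * (E a * (1 - ps a l))"
      using errE(1) wE \<phi>E reflected_transform[of a l] ab by (simp add: E_def)
    finally have Qinc: "Q b l - Q a l = - (LINT x|lborel. err a b x * E x) - (LINT x|lborel. w x * E x) + \<beta> * (E a * (1 - ps a l))" .
    have iA: "integrable lborel (\<lambda>x. indicator {a<..b} x *\<^sub>R (cnj (A x) * q0 x))"
      by (rule Bochner_Integration.integrable_bound[OF integral_mult_le_norm2(1)[OF sq_integrable_cnj(1)[OF A] q0]])
         (auto simp: indicator_def)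
    have iw: "integrable lborel (\<lambda>x. w x * q0 x)" by (rule integral_mult_le_norm2(1)[OF w(1) q0])
    have q0q: "q0 x = q x" if "x \<in> {a<..b}" for x using that ab by (simp add: q0_def cut_def)
    have I2: "(LINT x|lborel. w x * (E x - E a)) = (LINT x|lborel. w x * E x) - \<beta> * E a"
      using wE wi(1) by (simp add: right_diff_distrib \<beta>_def)
    have I3: "(LINT x|lborel. indicator {a<..b} x *\<^sub>R (cnj (A x) * q0 x) - w x * q0 x) =
        - (LINT x|lborel. indicator {a<..b} x *\<^sub>R k x) - (LINT x|lborel. w x * q0 x)"
      using iA iw by (simp add: k_def)
    have I4: "(LINT x|lborel. w x * (q0 x - q a)) = (LINT x|lborel. w x * q0 x) - \<beta> * q a"
      using iw wi(1) by (simp add: right_diff_distrib \<beta>_def)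
    have qa: "q a = E a * ps a l" by (simp add: q_def E_def)
    \<comment> \<open>Inside the interval, E and q are replaced by their values at a and w by cnj A.
      The terms with \<beta> then cancel exactly, since q(a) is E(a) ps(a, l).\<close>
    have decomp: "Q b l - Q a l - (LINT x|lborel. indicator {a<..b} x *\<^sub>R k x) =
       - (LINT x|lborel. err a b x * E x) - (LINT x|lborel. w x * (E x - E a))
       + (LINT x|lborel. indicator {a<..b} x *\<^sub>R (cnj (A x) * q0 x) - w x * q0 x) + (LINT x|lborel. w x * (q0 x - q a))"
      unfolding Qinc I2 I3 I4 by (simp add: qa algebra_simps)
    have B1: "cmod (LINT x|lborel. err a b x * E x) \<le> e * (EB l * (C * C1)) * m a b"
    proof -
      have "cmod (LINT x|lborel. err a b x * E x) \<le> (C * e * C1 * m a b) * EB l"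
        by (rule order_trans[OF errE(2) mult_right_mono[OF err(2) EB_nonneg]])
      then show ?thesis by (simp add: mult_ac)
    qed
    have bnd: "cmod (LINT x|lborel. w x * f x) \<le> e * C1 * m a b" if "\<And>x. x \<in> {a<..b} \<Longrightarrow> cmod (f x) \<le> e" for f
    proof -
      have "cmod (LINT x|lborel. w x * f x) \<le> (LINT x|lborel. e * cmod (w x))"
      proof (rule norm_integral_le)
        show "integrable lborel (\<lambda>x. e * cmod (w x))" using wi(1) by simp
        have "cmod (w x * f x) \<le> e * cmod (w x)" for x
          using that[of x] w0[of x] by (cases "x \<in> {a<..b}") (auto simp: norm_mult mult.commute[of "cmod (w x)"] intro: mult_right_mono)
        then show "AE x in lborel. cmod (w x * f x) \<le> e * cmod (w x)" by simp
      qed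
      also have "\<dots> \<le> e * (C1 * m a b)" using w1 e by (simp add: mult_left_mono)
      finally show ?thesis by (simp add: mult_ac)
    qed
    have B2: "cmod (LINT x|lborel. w x * (E x - E a)) \<le> e * C1 * m a b"
      by (rule bnd) (use e2 in \<open>simp add: E_def\<close>)
    have B4: "cmod (LINT x|lborel. w x * (q0 x - q a)) \<le> e * C1 * m a b"
      by (rule bnd) (use e3 q0q in simp)
    have B3: "cmod (LINT x|lborel. indicator {a<..b} x *\<^sub>R (cnj (A x) * q0 x) - w x * q0 x) \<le> e * (B * (norm2 h * C1)) * m a b"
    proof -
      have "cmod (LINT x|lborel. indicator {a<..b} x *\<^sub>R (cnj (A x) * q0 x) - w x * q0 x) \<le>
          (LINT x|lborel. (norm2 h * C1 * sqrt (m a b) * B) * indicator {a<..b} x)"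
      proof (rule norm_integral_le)
        show "integrable lborel (\<lambda>x. (norm2 h * C1 * sqrt (m a b) * B) * indicator {a<..b} x)"
          using ab by (intro integrable_mult_right integrable_real_indicator) auto
        show "AE x in lborel. cmod (indicator {a<..b} x *\<^sub>R (cnj (A x) * q0 x) - w x * q0 x) \<le> (norm2 h * C1 * sqrt (m a b) * B) * indicator {a<..b} x"
          using g_diff_A[OF ab]
        proof eventually_elim
          case (elim x)
          show ?case
          proof (cases "x \<in> {a<..b}")
            case True
            then have "cmod (\<psi> x - cnj (A x)) * cmod (q x) \<le> (norm2 h * C1 * sqrt (m a b)) * B"
              using elim B(2)[of x] ab C1_nonneg mp by (intro mult_mono) (auto simp: \<psi>_def)
            moreover have "cmod (cnj (A x) * q x - \<psi> x * q x) = cmod (\<psi> x - cnj (A x)) * cmod (q x)"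
              by (simp add: norm_mult[symmetric] left_diff_distrib norm_minus_commute)
            ultimately show ?thesis using True q0q[OF True] by (simp add: w_def cut_def)
          qed (simp add: w0)
        qed
      qed
      also have "\<dots> = (norm2 h * C1 * B) * (sqrt (m a b) * (b - a))" using ab by simp
      also have "\<dots> \<le> (norm2 h * C1 * B) * (e * m a b)"
        using m_ge(3)[of a b] ab e4 e B(1) C1_nonneg mp by (intro mult_left_mono mult_mono) auto
      finally show ?thesis by (simp add: mult_ac)
    qed
    have "cmod (Q b l - Q a l - (LINT x|lborel. indicator {a<..b} x *\<^sub>R k x)) \<le>
       cmod (LINT x|lborel. err a b x * E x) + cmod (LINT x|lborel. w x * (E x - E a))
       + cmod (LINT x|lborel. indicator {a<..b} x *\<^sub>R (cnj (A x) * q0 x) - w x * q0 x) + cmod (LINT x|lborel. w x * (q0 x - q a))"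
      unfolding decomp by (intro norm_triangle_le add_mono norm_triangle_le_diff) auto
    also have "\<dots> \<le> e * (EB l * (C * C1)) * m a b + e * C1 * m a b + e * (B * (norm2 h * C1)) * m a b + e * C1 * m a b"
      by (intro add_mono B1 B2 B3 B4)
    also have "\<dots> = e * N * m a b" by (simp add: N_def algebra_simps)
    finally show ?thesis .
  qed
  have "Q r l = Q 0 l + (LINT u|lborel. indicator {0<..r} u *\<^sub>R k u)"
  proof (rule increments_eq_integral[OF k _ _ r])
    show "m a c = m a b + m b c" if "0 \<le> a" "a \<le> b" "b \<le> c" "c \<le> R" for a b c using m_add that by blast
    fix \<epsilon> :: real assume \<epsilon>: "\<epsilon> > 0"
    define e where "e = \<epsilon> / (N + 1)"
    have e: "e > 0" "e * N \<le> \<epsilon>" using \<epsilon> N by (auto simp: e_def field_simps)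
    obtain d1 where d1: "d1 > 0" "\<And>a b. \<bar>a - b\<bar> < d1 \<Longrightarrow> norm2 (\<lambda>u. h (u - a) - h (u - b)) < e"
      using translation_continuity[OF h h_supp R e(1)] by metis
    have "uniformly_continuous_on {0..R} q" by (intro compact_uniformly_continuous qc) auto
    then obtain d2 where d2: "d2 > 0" "\<And>x y. x \<in> {0..R} \<Longrightarrow> y \<in> {0..R} \<Longrightarrow> dist y x < d2 \<Longrightarrow> dist (q y) (q x) < e"
      unfolding uniformly_continuous_on_def using e(1) by metis
    have "uniformly_continuous_on {0..R} (\<lambda>u. exp (- \<i> * l * of_real u))"
      by (intro compact_uniformly_continuous continuous_intros) auto
    then obtain d3 where d3: "d3 > 0" "\<And>x y. x \<in> {0..R} \<Longrightarrow> y \<in> {0..R} \<Longrightarrow> dist y x < d3 \<Longrightarrow>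
        dist (exp (- \<i> * l * of_real y)) (exp (- \<i> * l * of_real x)) < e"
      unfolding uniformly_continuous_on_def using e(1) by metis
    obtain d4 where d4: "d4 > 0" "\<And>a b. a \<le> b \<Longrightarrow> b - a < d4 \<Longrightarrow> sqrt (m a b) < e"
      using m_small[OF e(1)] by metis
    define d where "d = min (min d1 d2) (min d3 d4)"
    have "cmod (Q b l - Q a l - (LINT x|lborel. indicator {a<..b} x *\<^sub>R k x)) \<le> \<epsilon> * m a b"
      if ab: "0 \<le> a" "a < b" "b \<le> R" "b - a < d" for a b
    proof -
      have "cmod (Q b l - Q a l - (LINT x|lborel. indicator {a<..b} x *\<^sub>R k x)) \<le> e * N * m a b"
      proof (rule main[OF ab(1-3)])
        fix u assume u: "u \<in> {a<..b}"
        show "norm2 (\<lambda>t. h (t - u) - h (t - a)) \<le> e"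
          using d1(2)[of u a] u ab by (auto simp: d_def)
        show "cmod (exp (- \<i> * l * of_real u) - exp (- \<i> * l * of_real a)) \<le> e"
          using d3(2)[of a u] u ab by (auto simp: d_def dist_norm)
        show "cmod (q u - q a) \<le> e"
          using d2(2)[of a u] u ab by (auto simp: d_def dist_norm)
      next
        show "sqrt (m a b) \<le> e" using d4(2)[of a b] ab by (auto simp: d_def)
      qed (use e in simp)
      also have "\<dots> \<le> \<epsilon> * m a b" using e(2) m_nonneg[of a b] ab by (intro mult_right_mono) auto
      finally show ?thesis .
    qed
    moreover have "d > 0" using d1 d2 d3 d4 by (simp add: d_def)
    ultimately show "\<exists>\<delta>>0. \<forall>a b. 0 \<le> a \<and> a < b \<and> b \<le> R \<and> b - a < \<delta> \<longrightarrow>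
        cmod (Q b l - Q a l - (LINT x|lborel. indicator {a<..b} x *\<^sub>R k x)) \<le> \<epsilon> * m a b" by blast
  qed
  also have "(LINT u|lborel. indicator {0<..r} u *\<^sub>R k u) = (LINT u|lborel. - (indicator {0<..r} u *\<^sub>R (cnj (A u) * q u)))"
    using r by (intro Bochner_Integration.integral_cong) (auto simp: k_def q0_def cut_def indicator_def)
  finally show ?thesis by (simp add: Q_0 q_def)
qed

end

lemma sq_integrable_cut_continuous:
  assumes "continuous_on {a..b} f" "a \<le> b"
  shows "sq_integrable (cut {a..b} f)"
proof -
  have eq: "cut {a..b} f = (\<lambda>x. indicator {a..b} x *\<^sub>R f x)" by (auto simp: cut_def)
  have "cut {a..b} f \<in> borel_measurable borel"
    unfolding eq by (rule borel_measurable_continuous_on_indicator[OF _ assms(1)]) simp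
  moreover have "bounded (f ` {a..b})" by (intro compact_imp_bounded compact_continuous_image assms) auto
  then obtain B where B: "\<And>x. x \<in> {a..b} \<Longrightarrow> cmod (f x) \<le> B" unfolding bounded_iff by blast
  moreover have "B \<ge> 0" using order_trans[OF norm_ge_zero B[of a]] assms(2) by simp
  ultimately show ?thesis
    using assms(2) by (intro sq_integrable_interval(1)[where a=a and b=b and B=B]) (auto simp: cut_def)
qed

lemma integral_exp_segment:
  fixes m :: complex
  assumes "u \<le> r"
  shows "(LINT x|lborel. (if x \<in> {u..r} then m * exp (m * of_real x) else 0)) = exp (m * of_real r) - exp (m * of_real u)"
proof -
  have "(LINT x|lborel. indicator {u..r} x *\<^sub>R (m * exp (m * of_real x))) = exp (m * of_real r) - exp (m * of_real u)"
  proof (rule integral_FTC_atLeastAtMost[OF assms])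
    show "((\<lambda>x. exp (m * of_real x)) has_vector_derivative m * exp (m * of_real x)) (at x within {u..r})" for x
      by (rule has_vector_derivative_real_field) (auto intro!: derivative_eq_intros)
  qed (intro continuous_intros)
  moreover have "(LINT x|lborel. indicator {u..r} x *\<^sub>R (m * exp (m * of_real x))) =
      (LINT x|lborel. (if x \<in> {u..r} then m * exp (m * of_real x) else 0))"
    by (intro Bochner_Integration.integral_cong) auto
  ultimately show ?thesis by simp
qed

context truncated_accelerant
begin

lemma integrable_A_continuous:
  assumes "continuous_on {0..R} f" "0 \<le> a" "b \<le> R"
  shows "integrable lborel (\<lambda>u. indicator {a<..b} u *\<^sub>R (A u * f u))" (is ?A)
    and "integrable lborel (\<lambda>u. indicator {a<..b} u *\<^sub>R (cnj (A u) * f u))" (is ?B)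
    and "integrable lborel (\<lambda>u. indicator {a<..b} u *\<^sub>R f u)" (is ?C)
proof -
  have cf: "sq_integrable (cut {0..R} f)" using assms(1) R by (intro sq_integrable_cut_continuous) auto
  have i: "integrable lborel (cut {0..R} f)"
    by (rule sq_integrable_imp_integrable(1)[OF cf, of 0 R]) (use R in \<open>auto simp: cut_def\<close>)
  have ind: "indicator {a<..b} u *\<^sub>R (c * f u) = indicator {a<..b} u *\<^sub>R (c * cut {0..R} f u)" for u c
    using assms(2,3) by (auto simp: indicator_def cut_def)
  have ind': "indicator {a<..b} u *\<^sub>R f u = indicator {a<..b} u *\<^sub>R cut {0..R} f u" for u
    using assms(2,3) by (auto simp: indicator_def cut_def)
  have bd: "integrable lborel (\<lambda>u. indicator {a<..b} u *\<^sub>R F u)" if "integrable lborel F" for F :: "real \<Rightarrow> complex"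
    by (rule Bochner_Integration.integrable_bound[OF that])
       (use borel_measurable_integrable[OF that] in \<open>auto simp: indicator_def\<close>)
  show ?A unfolding ind by (intro bd integral_mult_le_norm2(1)[OF A cf])
  show ?B unfolding ind by (intro bd integral_mult_le_norm2(1)[OF sq_integrable_cnj(1)[OF A] cf])
  show ?C unfolding ind' by (intro bd i)
qed

text \<open>\<open>Q_krein\<close> at the point \<open>cnj l\<close>, conjugated: the exponential
  then turns ps back into p.\<close>

lemma ps_krein:
  assumes r: "0 \<le> r" "r \<le> R"
  shows "ps r l = 1 - (LINT u|lborel. indicator {0<..r} u *\<^sub>R (A u * p u l))"
proof -
  have eq: "cnj (indicator {0<..r} u *\<^sub>R (cnj (A u) * (exp (- \<i> * cnj l * of_real u) * ps u (cnj l)))) =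
      indicator {0<..r} u *\<^sub>R (A u * p u l)" for u
    by (simp add: ps_def p_def exp_cnj)
  have "cnj (LINT u|lborel. indicator {0<..r} u *\<^sub>R (cnj (A u) * (exp (- \<i> * cnj l * of_real u) * ps u (cnj l)))) =
      (LINT u|lborel. indicator {0<..r} u *\<^sub>R (A u * p u l))"
    by (simp only: Bochner_Integration.integral_cnj[symmetric] eq)
  then show ?thesis using Q_krein[OF r, of "cnj l"] by (simp add: ps_def)
qed

text \<open>The product rule for e^(ilr) Q in integrated form: the integral of E(s) k(u) over the
  triangle 0 < u <= s <= r is evaluated in both orders, where E is the derivative of the exponential
  and k that of -Q.\<close>

lemma p_krein:
  assumes r: "0 \<le> r" "r \<le> R"
  shows "p r l = 1 + (LINT u|lborel. indicator {0<..r} u *\<^sub>R (\<i> * l * p u l - cnj (A u) * ps u l))"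
proof -
  define q where "q u = exp (- \<i> * l * of_real u) * ps u l" for u
  have qc: "continuous_on {0..R} q" unfolding q_def by (intro continuous_intros ps_continuous)
  define k where "k u = indicator {0<..r} u *\<^sub>R (cnj (A u) * q u)" for u
  have k: "integrable lborel k" unfolding k_def by (rule integrable_A_continuous(2)[OF qc]) (use r in auto)
  have [measurable]: "k \<in> borel_measurable borel" using k by (auto dest: borel_measurable_integrable)
  define E where "E s = \<i> * l * exp (\<i> * l * of_real s)" for s :: real
  define f where "f s u = (if 0 < u \<and> u \<le> s \<and> s \<le> r then E s * k u else 0)" for s u
  have fm: "case_prod f \<in> borel_measurable (lborel \<Otimes>\<^sub>M lborel)"
    unfolding f_def E_def by measurable
  define a where "a s = indicator {0..r} s * (cmod l * exp (cmod (- l) * r))" for s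
  have a: "integrable lborel a"
    unfolding a_def using r by (intro integrable_mult_left integrable_real_indicator) auto
  have bound: "cmod (f s u) \<le> a s * cmod (k u)" for s u
  proof (cases "0 < u \<and> u \<le> s \<and> s \<le> r")
    case True
    then have "cmod (exp (- \<i> * (- l) * of_real s)) \<le> exp (cmod (- l) * r)" by (intro cmod_exp_bound) auto
    then have "cmod (E s) \<le> cmod l * exp (cmod (- l) * r)" by (simp add: E_def norm_mult mult_left_mono)
    then show ?thesis using True by (simp add: f_def a_def norm_mult mult_right_mono)
  qed (auto simp: f_def a_def)
  note Fub = Fubini_product_bound[OF lborel.sigma_finite_measure_axioms lborel.sigma_finite_measure_axioms fm a integrable_norm[OF k] bound]
  have Qs: "Q s l = 1 - (LINT u|lborel. (if 0 < u \<and> u \<le> s then k u else 0))" if "0 \<le> s" "s \<le> r" for s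
  proof -
    have "(LINT u|lborel. indicator {0<..s} u *\<^sub>R (cnj (A u) * (exp (- \<i> * l * of_real u) * ps u l))) =
        (LINT u|lborel. (if 0 < u \<and> u \<le> s then k u else 0))"
      using that by (intro Bochner_Integration.integral_cong) (auto simp: k_def q_def)
    then show ?thesis using Q_krein[of s l] that r by simp
  qed
  have inner: "(LINT s|lborel. f s u) = exp (\<i> * l * of_real r) * k u - indicator {0<..r} u *\<^sub>R (cnj (A u) * ps u l)" for u
  proof (cases "u \<in> {0<..r}")
    case True
    have "f s u = (if s \<in> {u..r} then (\<i> * l) * exp ((\<i> * l) * of_real s) else 0) * k u" for s
      using True by (auto simp: f_def E_def)
    then have "(LINT s|lborel. f s u) = (exp (\<i> * l * of_real r) - exp (\<i> * l * of_real u)) * k u"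
      using integral_exp_segment[of u r "\<i> * l"] True by simp
    moreover have "exp (\<i> * l * of_real u) * exp (- \<i> * l * of_real u) = 1" by (simp add: exp_minus_inverse)
    then have "exp (\<i> * l * of_real u) * k u = cnj (A u) * ps u l"
      using True by (simp add: k_def q_def)
    ultimately show ?thesis using True by (simp add: left_diff_distrib)
  next
    case False
    then show ?thesis by (auto simp: f_def k_def cong: if_cong)
  qed
  have i0: "integrable lborel (\<lambda>s. indicator {0<..r} s *\<^sub>R E s)"
    unfolding E_def by (rule integrable_A_continuous(3)) (use r in \<open>auto intro!: continuous_intros\<close>)
  have E0: "(LINT s|lborel. indicator {0<..r} s *\<^sub>R E s) = exp (\<i> * l * of_real r) - 1"
  proof -
    have "(LINT s|lborel. indicator {0<..r} s *\<^sub>R E s) = (LINT s|lborel. (if s \<in> {0..r} then E s else 0))"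
    proof (rule integral_cong_AE)
      show "AE s in lborel. indicator {0<..r} s *\<^sub>R E s = (if s \<in> {0..r} then E s else 0)"
        using AE_lborel_singleton[of 0] by eventually_elim (auto simp: indicator_def)
    qed (unfold E_def, measurable)
    then show ?thesis unfolding E_def using integral_exp_segment[of 0 r "\<i> * l"] r by simp
  qed
  have "(LINT u|lborel. indicator {0<..r} u *\<^sub>R (\<i> * l * p u l)) =
      (LINT s|lborel. indicator {0<..r} s *\<^sub>R E s - (LINT u|lborel. f s u))"
  proof (intro Bochner_Integration.integral_cong refl)
    fix s :: real
    show "indicator {0<..r} s *\<^sub>R (\<i> * l * p s l) = indicator {0<..r} s *\<^sub>R E s - (LINT u|lborel. f s u)"
    proof (cases "s \<in> {0<..r}")
      case True
      have "f s u = E s * (if 0 < u \<and> u \<le> s then k u else 0)" for u using True by (simp add: f_def)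
      then have "(LINT u|lborel. f s u) = E s * (1 - Q s l)" using Qs[of s] True by simp
      then show ?thesis using True by (simp add: p_def E_def algebra_simps)
    next
      case False
      have "f s u = 0" for u using False by (auto simp: f_def)
      then show ?thesis using False by simp
    qed
  qed
  also have "\<dots> = exp (\<i> * l * of_real r) - 1 - (LINT u|lborel. LINT s|lborel. f s u)"
    using i0 Fub(1,2) E0 by simp
  also have "(LINT u|lborel. LINT s|lborel. f s u) = exp (\<i> * l * of_real r) * (LINT u|lborel. k u) - (LINT u|lborel. indicator {0<..r} u *\<^sub>R (cnj (A u) * ps u l))"
    unfolding inner using k integrable_A_continuous(2)[OF ps_continuous, of 0 r l] r by simp
  also have "(LINT u|lborel. k u) = 1 - Q r l"
  proof -
    have "(LINT u|lborel. (if 0 < u \<and> u \<le> r then k u else 0)) = (LINT u|lborel. k u)"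
      by (intro Bochner_Integration.integral_cong) (auto simp: k_def)
    then show ?thesis using Qs[of r] r by simp
  qed
  finally have "(LINT u|lborel. indicator {0<..r} u *\<^sub>R (\<i> * l * p u l)) - (LINT u|lborel. indicator {0<..r} u *\<^sub>R (cnj (A u) * ps u l)) = p r l - 1"
    by (simp add: p_def algebra_simps)
  moreover have "integrable lborel (\<lambda>u. indicator {0<..r} u *\<^sub>R (\<i> * l * p u l))"
    by (rule integrable_A_continuous(3)) (use r in \<open>auto intro!: continuous_intros p_continuous\<close>)
  then have "(LINT u|lborel. indicator {0<..r} u *\<^sub>R (\<i> * l * p u l - cnj (A u) * ps u l)) =
    (LINT u|lborel. indicator {0<..r} u *\<^sub>R (\<i> * l * p u l)) - (LINT u|lborel. indicator {0<..r} u *\<^sub>R (cnj (A u) * ps u l))"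
    using integrable_A_continuous(2)[OF ps_continuous, of 0 r l] r
    by (subst Bochner_Integration.integral_diff[symmetric]) (auto simp: scaleR_diff_right)
  ultimately show ?thesis by simp
qed

section \<open>Uniqueness for the Krein system, and absence of real zeroes\<close>

lemma small_A_integral:
  assumes "c \<ge> 0"
  obtains \<delta> where "\<delta> > 0" "\<And>a b. a \<le> b \<Longrightarrow> b - a < \<delta> \<Longrightarrow>
    (LINT u|lborel. indicator {a<..b} u * (cmod (A u) + c)) \<le> 1 / 2"
proof -
  \<comment> \<open>The constant c and, through Cauchy-Schwarz, the function A may each contribute
    1/4.\<close>
  define \<delta> where "\<delta> = min (1 / (4 * (c + 1))) ((1 / (4 * (norm2 A + 1)))\<^sup>2)"
  have d: "\<delta> > 0" using assms by (simp add: \<delta>_def add_nonneg_pos) (insert norm2_nonneg[of A], linarith)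
  show thesis
  proof (rule that[OF d])
    fix a b :: real assume ab: "a \<le> b" "b - a < \<delta>"
    define w where "w = cut {a<..b} A"
    have w: "sq_integrable w" "norm2 w \<le> norm2 A" unfolding w_def by (intro sq_integrable_cut A; simp)+
    have w0: "w x = 0" if "x \<notin> {a..b}" for x using that by (auto simp: w_def cut_def)
    note wi = sq_integrable_imp_integrable[OF w(1) ab(1) w0]
    have "b - a \<le> (1 / (4 * (norm2 A + 1)))\<^sup>2" using ab by (simp add: \<delta>_def)
    then have "sqrt (b - a) \<le> 1 / (4 * (norm2 A + 1))" by (intro real_le_lsqrt) (use ab in auto)
    then have "sqrt (b - a) * norm2 w \<le> 1 / (4 * (norm2 A + 1)) * (norm2 A + 1)"
      using w(2) ab by (intro mult_mono) auto
    also have "\<dots> = 1 / 4"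
      by (simp add: field_simps) (insert norm2_nonneg[of A], linarith)
    finally have 1: "(LINT x|lborel. cmod (w x)) \<le> 1 / 4" using wi(2) by simp
    have "c * (b - a) \<le> c * (1 / (4 * (c + 1)))" using ab assms by (intro mult_left_mono) (auto simp: \<delta>_def)
    also have "\<dots> \<le> 1 / 4" using assms by (simp add: field_simps)
    finally have 2: "c * (b - a) \<le> 1 / 4" .
    have "(LINT u|lborel. indicator {a<..b} u * (cmod (A u) + c)) = (LINT u|lborel. cmod (w u) + c * indicator {a<..b} u)"
      by (intro Bochner_Integration.integral_cong) (auto simp: w_def cut_def)
    also have "\<dots> = (LINT u|lborel. cmod (w u)) + c * (b - a)"
      using wi(1) ab by (subst Bochner_Integration.integral_add) (auto intro!: integrable_real_indicator)
    finally show "(LINT u|lborel. indicator {a<..b} u * (cmod (A u) + c)) \<le> 1 / 2" using 1 2 by simp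
  qed
qed

text \<open>The differences of two solutions satisfy the homogeneous equations, so the sum of their
  moduli meets the hypothesis of \<open>gronwall_zero\<close> with k = |A| + |l|.\<close>

lemma krein_unique:
  assumes Pc: "continuous_on {0..R} P" and Psc: "continuous_on {0..R} Ps"
    and P: "\<And>r. r \<in> {0..R} \<Longrightarrow> P r = 1 + (LINT u|lborel. indicator {0<..r} u *\<^sub>R (\<i> * l * P u - cnj (A u) * Ps u))"
    and Ps: "\<And>r. r \<in> {0..R} \<Longrightarrow> Ps r = 1 - (LINT u|lborel. indicator {0<..r} u *\<^sub>R (A u * P u))"
    and r: "r \<in> {0..R}"
  shows "P r = p r l"
proof -
  define d where "d r = P r - p r l" for r
  define ds where "ds r = Ps r - ps r l" for r
  have dc: "continuous_on {0..R} d" and dsc: "continuous_on {0..R} ds"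
    unfolding d_def ds_def by (intro continuous_intros Pc Psc p_continuous ps_continuous)+
  define D where "D r = cmod (d r) + cmod (ds r)" for r
  have Dc: "continuous_on {0..R} D" unfolding D_def by (intro continuous_intros dc dsc)
  have A': "sq_integrable (cut {0..R} A)" by (rule sq_integrable_cut(1)[OF A]) simp
  define k where "k u = (if u \<in> {0..R} then cmod (A u) + cmod l else 0)" for u
  have k_eq: "k = (\<lambda>u. cmod (cut {0..R} A u) + cmod l * indicator {0..R} u)" by (auto simp: k_def cut_def)
  have "integrable lborel (cut {0..R} A)"
    by (rule sq_integrable_imp_integrable(1)[OF A', of 0 R]) (use R in \<open>auto simp: cut_def\<close>)
  then have k: "integrable lborel k"
    unfolding k_eq using R by (intro Bochner_Integration.integrable_add integrable_mult_right integrable_real_indicator integrable_norm) auto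
  obtain \<delta> where \<delta>: "\<delta> > 0" "\<And>a b. a \<le> b \<Longrightarrow> b - a < \<delta> \<Longrightarrow> (LINT u|lborel. indicator {a<..b} u * (cmod (A u) + cmod l)) \<le> 1 / 2"
    using small_A_integral[of "cmod l"] by auto
  have "D r = 0"
  proof (rule gronwall_zero[OF Dc _ k _ \<delta>(1) _ _ r])
    show "0 \<le> k x" for x by (simp add: k_def)
    show "0 \<le> D x" for x by (simp add: D_def)
    show "(LINT u|lborel. indicator {a<..b} u * k u) \<le> 1 / 2" if "0 \<le> a" "a \<le> b" "b \<le> R" "b - a < \<delta>" for a b
    proof -
      have "(LINT u|lborel. indicator {a<..b} u * k u) = (LINT u|lborel. indicator {a<..b} u * (cmod (A u) + cmod l))"
        using that by (intro Bochner_Integration.integral_cong) (auto simp: k_def indicator_def)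
      then show ?thesis using \<delta>(2)[OF that(2,4)] by simp
    qed
    show "D x \<le> (LINT u|lborel. indicator {0<..x} u * (k u * D u))" if x: "x \<in> {0..R}" for x
    proof -
      have x': "0 \<le> x" "x \<le> R" using x by auto
      note ints = integrable_A_continuous[OF _ order_refl x'(2)]
      have i1: "integrable lborel (\<lambda>u. indicator {0<..x} u *\<^sub>R (\<i> * l * f u - cnj (A u) * fs u))"
        if "continuous_on {0..R} f" "continuous_on {0..R} fs" for f fs
        unfolding scaleR_diff_right
        by (intro Bochner_Integration.integrable_diff ints continuous_intros that)
      have "d x = (LINT u|lborel. indicator {0<..x} u *\<^sub>R (\<i> * l * P u - cnj (A u) * Ps u) - indicator {0<..x} u *\<^sub>R (\<i> * l * p u l - cnj (A u) * ps u l))"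
        using P[OF x] p_krein[OF x'] i1[OF Pc Psc] i1[OF p_continuous ps_continuous] by (simp add: d_def)
      also have "\<dots> = (LINT u|lborel. indicator {0<..x} u *\<^sub>R (\<i> * l * d u - cnj (A u) * ds u))"
        by (intro Bochner_Integration.integral_cong) (auto simp: d_def ds_def algebra_simps)
      finally have dx: "d x = (LINT u|lborel. indicator {0<..x} u *\<^sub>R (\<i> * l * d u - cnj (A u) * ds u))" .
      have "ds x = - (LINT u|lborel. indicator {0<..x} u *\<^sub>R (A u * P u) - indicator {0<..x} u *\<^sub>R (A u * p u l))"
        using Ps[OF x] ps_krein[OF x'] ints(1)[OF Pc] ints(1)[OF p_continuous] by (simp add: ds_def)
      also have "\<dots> = - (LINT u|lborel. indicator {0<..x} u *\<^sub>R (A u * d u))"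
        by (intro arg_cong[where f=uminus] Bochner_Integration.integral_cong) (auto simp: d_def algebra_simps)
      finally have dsx: "cmod (ds x) = cmod (LINT u|lborel. indicator {0<..x} u *\<^sub>R (A u * d u))" by simp
      have w1: "integrable lborel (\<lambda>u. indicator {0<..x} u * (cmod l * cmod (d u) + cmod (A u) * cmod (ds u)))"
      proof -
        have "integrable lborel (\<lambda>u. cmod (indicator {0<..x} u *\<^sub>R (l * d u)) + cmod (indicator {0<..x} u *\<^sub>R (A u * ds u)))"
          by (intro Bochner_Integration.integrable_add integrable_norm ints continuous_intros dc dsc)
        then show ?thesis by (simp add: norm_mult distrib_left)
      qed
      have w2: "integrable lborel (\<lambda>u. indicator {0<..x} u * (cmod (A u) * cmod (d u)))"
        using integrable_norm[OF ints(1)[OF dc]] by (simp add: norm_mult)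
      have w3: "integrable lborel (\<lambda>u. indicator {0<..x} u * (cmod l * cmod (ds u)))"
      proof -
        have "integrable lborel (\<lambda>u. cmod (indicator {0<..x} u *\<^sub>R (l * ds u)))"
          by (intro integrable_norm ints continuous_intros dsc)
        then show ?thesis by (simp add: norm_mult)
      qed
      have "cmod (d x) \<le> (LINT u|lborel. indicator {0<..x} u * (cmod l * cmod (d u) + cmod (A u) * cmod (ds u)))"
        unfolding dx
      proof (rule norm_integral_le[OF w1], rule AE_I2)
        fix u
        show "cmod (indicator {0<..x} u *\<^sub>R (\<i> * l * d u - cnj (A u) * ds u)) \<le> indicator {0<..x} u * (cmod l * cmod (d u) + cmod (A u) * cmod (ds u))"
          using norm_triangle_ineq4[of "\<i> * l * d u" "cnj (A u) * ds u"] by (simp add: norm_mult mult_left_mono)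
      qed
      moreover have "cmod (ds x) \<le> (LINT u|lborel. indicator {0<..x} u * (cmod (A u) * cmod (d u)))"
        unfolding dsx by (rule norm_integral_le[OF w2]) (simp add: norm_mult)
      ultimately have "D x \<le> (LINT u|lborel. indicator {0<..x} u * (cmod l * cmod (d u) + cmod (A u) * cmod (ds u))) + (LINT u|lborel. indicator {0<..x} u * (cmod (A u) * cmod (d u)))"
        by (simp add: D_def)
      \<comment> \<open>The nonnegative term with |l| |ds| is added to make the majorant the product
        of k and D.\<close>
      also have "\<dots> \<le> \<dots> + (LINT u|lborel. indicator {0<..x} u * (cmod l * cmod (ds u)))" by simp
      also have "\<dots> = (LINT u|lborel. indicator {0<..x} u * (cmod l * cmod (d u) + cmod (A u) * cmod (ds u)) + indicator {0<..x} u * (cmod (A u) * cmod (d u)) + indicator {0<..x} u * (cmod l * cmod (ds u)))"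
        using w1 w2 w3 by simp
      also have "\<dots> = (LINT u|lborel. indicator {0<..x} u * (k u * D u))"
        using x' by (intro Bochner_Integration.integral_cong) (auto simp: k_def D_def indicator_def algebra_simps)
      finally show ?thesis .
    qed
  qed
  then have "cmod (d r) = 0" unfolding D_def using norm_ge_zero[of "d r"] norm_ge_zero[of "ds r"] by linarith
  then show ?thesis by (simp add: d_def)
qed

text \<open>On the real line ps and Q have equal modulus, so \<open>Q_krein\<close> bounds the
  change of Q by the integral of |A| |Q|. Run backwards from r, Gronwall's argument would carry a
  zero at r down to radius 0, where Q is 1. The nonvanishing makes the final positivity
  strict.\<close>

lemma Q_real_nonzero:
  assumes r: "0 < r" "r \<le> R"
  shows "Q r (of_real x) \<noteq> 0"
proof
  define l where "l = complex_of_real x"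
  assume "Q r (of_real x) = 0"
  then have Q0: "Q r l = 0" by (simp add: l_def)
  define D where "D y = cmod (Q (r - y) l)" for y
  define k where "k y = cmod (cut {0..r} A (r - y))" for y
  have Dc: "continuous_on {0..r} D"
    unfolding D_def by (intro continuous_intros continuous_on_compose2[OF Q_continuous]) (use r in auto)
  have A': "sq_integrable (cut {0..r} A)" by (rule sq_integrable_cut(1)[OF A]) simp
  have "integrable lborel (\<lambda>y. cut {0..r} A (r - y))"
    by (rule sq_integrable_imp_integrable(1)[OF sq_integrable_affine(1)[OF A'], of 0 r]) (use r in \<open>auto simp: cut_def\<close>)
  then have k: "integrable lborel k" unfolding k_def by (rule integrable_norm)
  obtain \<delta> where \<delta>: "\<delta> > 0" "\<And>a b. a \<le> b \<Longrightarrow> b - a < \<delta> \<Longrightarrow> (LINT u|lborel. indicator {a<..b} u * (cmod (A u) + 0)) \<le> 1 / 2"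
    using small_A_integral[of 0] by auto
  have qn: "cmod (exp (- \<i> * l * of_real v) * ps v l) = cmod (Q v l)" for v
    by (simp add: norm_mult ps_def l_def)
  have qc: "continuous_on {0..R} (\<lambda>v. exp (- \<i> * l * of_real v) * ps v l)"
    by (intro continuous_intros ps_continuous)
  have refl: "(LINT u|lborel. F u) = (LINT u|lborel. F (r - u))" for F :: "real \<Rightarrow> real"
    by (subst lborel_integral_real_affine[of "-1" _ r]) auto
  have "D r = 0"
  proof (rule gronwall_zero[OF Dc _ k _ \<delta>(1)])
    show "0 \<le> k x" for x by (simp add: k_def)
    show "0 \<le> D x" for x by (simp add: D_def)
    show "(LINT u|lborel. indicator {a<..b} u * k u) \<le> 1 / 2" if ab: "0 \<le> a" "a \<le> b" "b \<le> r" "b - a < \<delta>" for a b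
    proof -
      have "(LINT u|lborel. indicator {a<..b} u * k u) = (LINT u|lborel. indicator {a<..b} (r - u) * k (r - u))" by (rule refl)
      also have "\<dots> = (LINT u|lborel. indicator {r - b<..r - a} u * (cmod (A u) + 0))"
      proof (rule integral_cong_AE)
        show "AE u in lborel. indicator {a<..b} (r - u) * k (r - u) = indicator {r - b<..r - a} u * (cmod (A u) + 0)"
          using AE_lborel_singleton[of "r - a"] AE_lborel_singleton[of "r - b"]
          by eventually_elim (use ab r in \<open>auto simp: k_def cut_def indicator_def\<close>)
      qed (unfold k_def, measurable)
      finally show ?thesis using \<delta>(2)[of "r - b" "r - a"] ab by simp
    qed
    show "D y \<le> (LINT u|lborel. indicator {0<..y} u * (k u * D u))" if y: "y \<in> {0..r}" for y
    proof -
      have i: "integrable lborel (\<lambda>u. indicator {a<..b} u *\<^sub>R (cnj (A u) * (exp (- \<i> * l * of_real u) * ps u l)))" if "0 \<le> a" "b \<le> R" for a b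
        by (rule integrable_A_continuous(2)[OF qc that])
      have "Q (r - y) l - Q r l = (LINT u|lborel. indicator {0<..r} u *\<^sub>R (cnj (A u) * (exp (- \<i> * l * of_real u) * ps u l)) - indicator {0<..r - y} u *\<^sub>R (cnj (A u) * (exp (- \<i> * l * of_real u) * ps u l)))"
        using Q_krein[of "r - y" l] Q_krein[of r l] i[of 0 r] i[of 0 "r - y"] y r by simp
      also have "\<dots> = (LINT u|lborel. indicator {r - y<..r} u *\<^sub>R (cnj (A u) * (exp (- \<i> * l * of_real u) * ps u l)))"
        using y by (intro Bochner_Integration.integral_cong) (auto simp: indicator_def)
      finally have "D y = cmod (LINT u|lborel. indicator {r - y<..r} u *\<^sub>R (cnj (A u) * (exp (- \<i> * l * of_real u) * ps u l)))"
        by (simp add: D_def Q0)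
      also have "\<dots> \<le> (LINT u|lborel. cmod (indicator {r - y<..r} u *\<^sub>R (cnj (A u) * (exp (- \<i> * l * of_real u) * ps u l))))"
        by (rule integral_norm_bound)
      also have "\<dots> = (LINT u|lborel. indicator {r - y<..r} u * (cmod (A u) * cmod (Q u l)))"
        using qn by (simp add: norm_mult)
      also have "\<dots> = (LINT u|lborel. indicator {r - y<..r} (r - u) * (cmod (A (r - u)) * cmod (Q (r - u) l)))"
        by (rule refl)
      also have "\<dots> = (LINT u|lborel. indicator {0..<y} u * (k u * D u))"
        using y by (intro Bochner_Integration.integral_cong) (auto simp: k_def D_def cut_def indicator_def)
      \<comment> \<open>The reflection u -> r - u has moved the closed end of the half-open interval
        to the other side; a null set.\<close>
      also have "\<dots> = (LINT u|lborel. indicator {0<..y} u * (k u * D u))"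
      proof -
        have eq: "AE u in lborel. indicator {0..<y} u * (k u * D u) = indicator {0<..y} u * (k u * D u)"
          using AE_lborel_singleton[of 0] AE_lborel_singleton[of y] by eventually_elim (auto simp: indicator_def)
        have "(\<lambda>u. indicator {0..r} u *\<^sub>R D u) \<in> borel_measurable borel"
          by (rule borel_measurable_continuous_on_indicator[OF _ Dc]) simp
        then have [measurable]: "(\<lambda>u. indicator {0..r} u * D u) \<in> borel_measurable borel" by simp
        have [measurable]: "k \<in> borel_measurable borel" using k by (auto dest: borel_measurable_integrable)
        have e1: "indicator {0..<y} u * (k u * D u) = indicator {0..<y} u * (k u * (indicator {0..r} u * D u))"
          and e2: "indicator {0<..y} u * (k u * D u) = indicator {0<..y} u * (k u * (indicator {0..r} u * D u))" for u
          using y by (auto simp: indicator_def)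
        show ?thesis
          by (rule integral_cong_AE[OF _ _ eq]) (unfold e1 e2, measurable)
      qed
      finally show ?thesis .
    qed
  qed (use r in auto)
  then show False by (simp add: D_def Q_0)
qed

end

subsection \<open>Orthogonality with respect to the spectral measure\<close>

lemma exp_ii_approx:
  fixes y :: real
  shows "cmod (exp (\<i> * of_real y) - 1 - \<i> * of_real y) \<le> y\<^sup>2"
    and "cmod (exp (\<i> * of_real y) - 1 - \<i> * of_real y + of_real (y\<^sup>2 / 2)) \<le> \<bar>y\<bar> ^ 3"
proof -
  show "cmod (exp (\<i> * of_real y) - 1 - \<i> * of_real y) \<le> y\<^sup>2"
    using Taylor_exp[of "\<i> * of_real y" 1] by (simp add: norm_mult diff_diff_eq power2_eq_square)
  have sum: "(\<Sum>k\<le>2. (\<i> * of_real y) ^ k / fact k) = 1 + \<i> * of_real y - of_real (y\<^sup>2 / 2)"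
    by (simp add: numeral_2_eq_2 power2_eq_square field_simps)
  have "cmod (exp (\<i> * of_real y) - (1 + \<i> * of_real y - of_real (y\<^sup>2 / 2))) \<le> \<bar>y\<bar> ^ 3 / 2"
    using Taylor_exp[of "\<i> * of_real y" 2] unfolding sum by (simp add: norm_mult numeral_3_eq_3)
  moreover have "exp (\<i> * of_real y) - (1 + \<i> * of_real y - of_real (y\<^sup>2 / 2)) = exp (\<i> * of_real y) - 1 - \<i> * of_real y + of_real (y\<^sup>2 / 2)"
    by (simp only: algebra_simps)
  ultimately have "cmod (exp (\<i> * of_real y) - 1 - \<i> * of_real y + of_real (y\<^sup>2 / 2)) \<le> \<bar>y\<bar> ^ 3 / 2" by (simp only:)
  then show "cmod (exp (\<i> * of_real y) - 1 - \<i> * of_real y + of_real (y\<^sup>2 / 2)) \<le> \<bar>y\<bar> ^ 3"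
    using zero_le_power[OF abs_ge_zero, of y 3] by linarith
qed

text \<open>For |l| <= 1 the numerator is of second order in l, for |l| > 1 it is bounded. The
  factor 2 in the constant comes from comparing 1 respectively 1/l^2 with 2/(1 + l^2).\<close>

lemma spectral_integrand_bound:
  assumes "\<bar>x\<bar> \<le> X"
  shows "cmod (spectral_integrand x l) \<le> (2 * X\<^sup>2 + 2 * X + 4) * (1 / (1 + l\<^sup>2))"
proof (cases "l = 0")
  case True
  have "x\<^sup>2 \<le> X\<^sup>2" using assms by (simp add: abs_le_square_iff[symmetric])
  then have "x\<^sup>2 / 2 \<le> 2 * X\<^sup>2 + 2 * X + 4" using assms zero_le_power2[of X] abs_ge_zero[of x] by linarith
  moreover have "cmod (spectral_integrand x l) = x\<^sup>2 / 2"
    using True by (simp add: spectral_integrand_def norm_divide norm_power)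
  ultimately show ?thesis using True by simp
next
  case False
  define N where "N = 1 + \<i> * of_real (l * x) / of_real (1 + l\<^sup>2) - exp (\<i> * of_real (l * x))"
  have X: "X \<ge> 0" and xX: "x\<^sup>2 \<le> X\<^sup>2" using assms by (auto simp: abs_le_square_iff[symmetric])
  have q: "1 + l\<^sup>2 > 0" by (simp add: add_pos_nonneg)
  have S: "cmod (spectral_integrand x l) = cmod N / l\<^sup>2"
    using False by (simp add: spectral_integrand_def N_def norm_divide norm_power)
  show ?thesis
  proof (cases "\<bar>l\<bar> \<le> 1")
    case True
    then have l1: "l\<^sup>2 \<le> 1" by (simp add: abs_square_le_1)
    \<comment> \<open>Trades the regularising term for the exact linear term of the exponential, at
      the cost of a term of third order in l.\<close>
    have dec: "\<i> * of_real (l * x) / of_real (1 + l\<^sup>2) = \<i> * of_real (l * x) - \<i> * of_real (l * x * l\<^sup>2 / (1 + l\<^sup>2))"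
    proof -
      have re: "l * x / (1 + l\<^sup>2) = l * x - l * x * l\<^sup>2 / (1 + l\<^sup>2)" using q by (simp add: field_simps)
      have "\<i> * of_real (l * x) / of_real (1 + l\<^sup>2) = \<i> * of_real (l * x / (1 + l\<^sup>2))" by simp
      then show ?thesis by (simp only: re of_real_diff right_diff_distrib)
    qed
    have "N = - (exp (\<i> * of_real (l * x)) - 1 - \<i> * of_real (l * x)) - \<i> * of_real (l * x * l\<^sup>2 / (1 + l\<^sup>2))"
      unfolding N_def dec by simp
    then have "cmod N \<le> cmod (exp (\<i> * of_real (l * x)) - 1 - \<i> * of_real (l * x)) + cmod (\<i> * of_real (l * x * l\<^sup>2 / (1 + l\<^sup>2)))"
      by (metis norm_minus_cancel norm_triangle_ineq4)
    also have "\<dots> \<le> (l * x)\<^sup>2 + \<bar>l * x\<bar> * l\<^sup>2 / (1 + l\<^sup>2)"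
      by (intro add_mono exp_ii_approx) (simp only: norm_mult norm_of_real, simp add: abs_mult)
    also have "\<bar>l * x\<bar> * l\<^sup>2 / (1 + l\<^sup>2) \<le> X * l\<^sup>2"
    proof -
      have "\<bar>l * x\<bar> \<le> 1 * X" unfolding abs_mult using True assms by (intro mult_mono) auto
      then have "\<bar>l * x\<bar> * l\<^sup>2 \<le> X * l\<^sup>2" by (simp add: mult_right_mono)
      also have "\<dots> \<le> X * l\<^sup>2 * (1 + l\<^sup>2)" using X mult_nonneg_nonneg[of "X * l\<^sup>2" "l\<^sup>2"] by (simp add: distrib_left)
      finally show ?thesis using q by (simp add: pos_divide_le_eq)
    qed
    also have "(l * x)\<^sup>2 \<le> l\<^sup>2 * X\<^sup>2" using xX by (simp add: power_mult_distrib mult_left_mono)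
    finally have "cmod N / l\<^sup>2 \<le> X\<^sup>2 + X" using False by (simp add: field_simps)
    also have "\<dots> \<le> (X\<^sup>2 + X) * (2 / (1 + l\<^sup>2))"
    proof -
      have "1 \<le> 2 / (1 + l\<^sup>2)" using l1 q by simp
      then show ?thesis using X mult_left_mono[of 1 "2 / (1 + l\<^sup>2)" "X\<^sup>2 + X"] by simp
    qed
    also have "\<dots> \<le> (2 * X\<^sup>2 + 2 * X + 4) * (1 / (1 + l\<^sup>2))"
      using q X by (simp add: field_simps)
    finally show ?thesis unfolding S .
  next
    case l: False
    then have l1: "l\<^sup>2 \<ge> 1" by (simp add: one_le_power abs_le_square_iff[of 1 l, simplified, symmetric])
    have "cmod N \<le> cmod (1 + \<i> * of_real (l * x) / of_real (1 + l\<^sup>2)) + cmod (exp (\<i> * of_real (l * x)))"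
      unfolding N_def by (rule norm_triangle_ineq4)
    also have "cmod (1 + \<i> * of_real (l * x) / of_real (1 + l\<^sup>2)) \<le> cmod 1 + cmod (\<i> * of_real (l * x) / of_real (1 + l\<^sup>2))"
      by (rule norm_triangle_ineq)
    also have "cmod (\<i> * of_real (l * x) / of_real (1 + l\<^sup>2)) = \<bar>l\<bar> * \<bar>x\<bar> / (1 + l\<^sup>2)"
      using q by (simp add: norm_divide norm_mult abs_mult del: of_real_add of_real_power of_real_mult)
    also have "\<dots> \<le> \<bar>x\<bar>"
    proof -
      have "\<bar>l\<bar> * 1 \<le> \<bar>l\<bar> * \<bar>l\<bar>" using l by (intro mult_left_mono) auto
      then have "\<bar>l\<bar> \<le> 1 + l\<^sup>2" by (simp add: power2_eq_square abs_mult[symmetric])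
      then have "\<bar>l\<bar> * \<bar>x\<bar> \<le> (1 + l\<^sup>2) * \<bar>x\<bar>" by (intro mult_right_mono) auto
      then show ?thesis using q by (simp add: pos_divide_le_eq mult.commute)
    qed
    finally have "cmod N \<le> 2 + X" using assms by simp
    then have "cmod N / l\<^sup>2 \<le> (2 + X) / l\<^sup>2" by (intro divide_right_mono) auto
    also have "\<dots> \<le> (2 + X) * (2 / (1 + l\<^sup>2))"
    proof -
      have "1 / l\<^sup>2 \<le> 2 / (1 + l\<^sup>2)" using l1 q False by (simp add: divide_simps)
      then show ?thesis using X mult_left_mono[of "1 / l\<^sup>2" "2 / (1 + l\<^sup>2)" "2 + X"] by simp
    qed
    also have "\<dots> \<le> (2 * X\<^sup>2 + 2 * X + 4) * (1 / (1 + l\<^sup>2))"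
      using q X by (simp add: field_simps)
    finally show ?thesis unfolding S .
  qed
qed

lemma spectral_integrand_measurable [measurable]:
  assumes [measurable]: "f \<in> borel_measurable M" "g \<in> borel_measurable M"
  shows "(\<lambda>y. spectral_integrand (f y) (g y)) \<in> borel_measurable M"
  unfolding spectral_integrand_def by measurable

lemma spectral_integrand_minus: "spectral_integrand (- x) l = cnj (spectral_integrand x l)"
  by (simp add: spectral_integrand_def exp_cnj)

text \<open>In other words, the measure \<open>c \<delta> + w(x) dx\<close> annihilates the affine functions.\<close>

lemma transform_moments:
  assumes w: "density_on r w" and F: "isCont F 0" and eq: "\<And>l. transform c w l = l\<^sup>2 * F l" and r: "r \<ge> 0"
  shows "c + (LINT x|lborel. w x) = 0" "(LINT x|lborel. of_real x * w x) = 0"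
    "integrable lborel (\<lambda>x. of_real x * w x)" "integrable lborel (\<lambda>x. of_real (x\<^sup>2) * w x)"
    "F 0 = - (LINT x|lborel. of_real (x\<^sup>2 / 2) * w x)"
proof -
  note wD = density_onD[OF w]
  have wm[measurable]: "w \<in> borel_measurable borel" using wD(1) by (auto dest: borel_measurable_integrable)
  show m0: "c + (LINT x|lborel. w x) = 0" using eq[of 0] by (simp add: transform_def)
  have poly_int: "integrable lborel (\<lambda>x. of_real (x ^ n) * w x)" for n
  proof (rule Bochner_Integration.integrable_bound)
    show "integrable lborel (\<lambda>x. r ^ n * cmod (w x))" using wD(1) by simp
    show "AE x in lborel. norm (of_real (x ^ n) * w x) \<le> norm (r ^ n * cmod (w x))"
    proof (rule AE_I2)
      fix x show "norm (of_real (x ^ n) * w x) \<le> norm (r ^ n * cmod (w x))"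
        using wD(2)[of x] r by (cases "x \<in> {0..r}") (auto simp: norm_mult norm_power intro!: mult_right_mono power_mono)
    qed
  qed measurable
  show i1: "integrable lborel (\<lambda>x. of_real x * w x)" using poly_int[of 1] by simp
  show i2: "integrable lborel (\<lambda>x. of_real (x\<^sup>2) * w x)" by (rule poly_int)
  define I1 where "I1 = (LINT x|lborel. of_real x * w x)"
  define s where "s n = 1 / real (Suc n)" for n
  have s: "s \<longlonglongrightarrow> 0" "s n \<noteq> 0" for n unfolding s_def using LIMSEQ_inverse_real_of_nat by (auto simp: inverse_eq_divide)
  \<comment> \<open>The second order Taylor quotient of the exponential along a sequence of points
    tending to 0: bounded by x^2 and convergent to -x^2/2.\<close>
  define q where "q n x = (exp (\<i> * of_real (- (s n * x))) - 1 - \<i> * of_real (- (s n * x))) / of_real ((s n)\<^sup>2)" for n x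
  have qm[measurable]: "q n \<in> borel_measurable borel" for n unfolding q_def by measurable
  have qb: "cmod (q n x) \<le> x\<^sup>2" for n x
  proof -
    have "cmod (q n x) \<le> (- (s n * x))\<^sup>2 / (s n)\<^sup>2"
      unfolding q_def norm_divide using exp_ii_approx(1)[of "- (s n * x)"] by (simp add: divide_right_mono norm_power)
    also have "\<dots> = x\<^sup>2" using s(2)[of n] by (simp add: power_mult_distrib)
    finally show ?thesis .
  qed
  have ql: "(\<lambda>n. q n x) \<longlonglongrightarrow> - of_real (x\<^sup>2 / 2)" for x
  proof -
    have b: "cmod (q n x - (- of_real (x\<^sup>2 / 2))) \<le> \<bar>x\<bar> ^ 3 * \<bar>s n\<bar>" for n
    proof -
      have "(s n * x)\<^sup>2 / 2 / (s n)\<^sup>2 = x\<^sup>2 / 2" using s(2)[of n] by (simp add: power_mult_distrib)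
      then have "of_real (x\<^sup>2 / 2) = (of_real ((- (s n * x))\<^sup>2 / 2) / of_real ((s n)\<^sup>2) :: complex)"
        by (metis of_real_divide power2_minus)
      then have "q n x - (- of_real (x\<^sup>2 / 2)) = (exp (\<i> * of_real (- (s n * x))) - 1 - \<i> * of_real (- (s n * x)) + of_real ((- (s n * x))\<^sup>2 / 2)) / of_real ((s n)\<^sup>2)"
        by (simp only: q_def add_divide_distrib diff_minus_eq_add)
      then have "cmod (q n x - (- of_real (x\<^sup>2 / 2))) \<le> \<bar>- (s n * x)\<bar> ^ 3 / (s n)\<^sup>2"
        using exp_ii_approx(2)[of "- (s n * x)"] by (simp add: norm_divide divide_right_mono norm_power)
      also have "\<dots> = \<bar>x\<bar> ^ 3 * \<bar>s n\<bar>"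
      proof -
        define t where "t = \<bar>s n\<bar>"
        have t: "t \<noteq> 0" "(s n)\<^sup>2 = t\<^sup>2" "\<bar>- (s n * x)\<bar> = t * \<bar>x\<bar>" using s(2)[of n] by (auto simp: t_def abs_mult)
        show ?thesis unfolding t(2,3) t_def[symmetric] using t(1)
          by (simp add: power_mult_distrib power2_eq_square power3_eq_cube)
      qed
      finally show ?thesis .
    qed
    have z: "(\<lambda>n. \<bar>x\<bar> ^ 3 * \<bar>s n\<bar>) \<longlonglongrightarrow> 0" by (intro tendsto_mult_right_zero tendsto_rabs_zero s)
    have "(\<lambda>n. q n x - (- of_real (x\<^sup>2 / 2))) \<longlonglongrightarrow> 0"
      by (rule Lim_null_comparison[OF always_eventually z]) (use b in blast)
    then show ?thesis by (simp only: LIM_zero_iff)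
  qed
  have wx2: "integrable lborel (\<lambda>x. x\<^sup>2 * cmod (w x))"
    using integrable_norm[OF i2] by (simp add: norm_mult norm_power)
  have qi: "integrable lborel (\<lambda>x. w x * q n x)" for n
    by (rule Bochner_Integration.integrable_bound[OF wx2]) (auto simp: norm_mult mult.commute[of "cmod (w _)"] intro!: mult_right_mono qb)
  have qI: "(\<lambda>n. LINT x|lborel. w x * q n x) \<longlonglongrightarrow> (LINT x|lborel. w x * (- of_real (x\<^sup>2 / 2)))"
  proof (rule integral_dominated_convergence[OF _ _ wx2])
    show "AE x in lborel. (\<lambda>n. w x * q n x) \<longlonglongrightarrow> w x * (- of_real (x\<^sup>2 / 2))"
      by (intro AE_I2 tendsto_intros ql)
    show "AE x in lborel. norm (w x * q n x) \<le> x\<^sup>2 * cmod (w x)" for n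
      by (auto simp: norm_mult mult.commute[of "cmod (w _)"] intro!: mult_right_mono qb)
  qed measurable
  have Wq: "F (of_real (s n)) = (LINT x|lborel. w x * q n x) - \<i> * I1 / of_real (s n)" for n
  proof -
    define S where "S = complex_of_real (s n)"
    have S0: "S \<noteq> 0" using s(2)[of n] by (simp add: S_def)
    have e: "w x * exp (- \<i> * S * of_real x) = S\<^sup>2 * (w x * q n x) + w x - \<i> * S * (of_real x * w x)" for x
    proof -
      have "S\<^sup>2 * q n x = exp (- \<i> * S * of_real x) - 1 + \<i> * S * of_real x"
        using S0 by (simp add: q_def S_def field_simps)
      then have ex: "exp (- \<i> * S * of_real x) = S\<^sup>2 * q n x + 1 - \<i> * S * of_real x" by simp
      show ?thesis unfolding ex by (simp add: algebra_simps)
    qed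
    have "S\<^sup>2 * F S = c + (S\<^sup>2 * (LINT x|lborel. w x * q n x) + (LINT x|lborel. w x) - \<i> * S * I1)"
      unfolding eq[symmetric] transform_def e I1_def using qi[of n] wD(1) i1 by simp
    also have "\<dots> = S\<^sup>2 * (LINT x|lborel. w x * q n x) - \<i> * S * I1" using m0 by (simp add: algebra_simps add_eq_0_iff)
    also have "\<dots> = S\<^sup>2 * ((LINT x|lborel. w x * q n x) - \<i> * I1 / S)"
      using S0 by (simp add: right_diff_distrib power2_eq_square)
    finally show ?thesis using S0 by (simp add: S_def)
  qed
  have sF: "(\<lambda>n. F (of_real (s n))) \<longlonglongrightarrow> F 0"
    by (rule isCont_tendsto_compose[OF F]) (use tendsto_of_real[OF s(1)] in simp)
  \<comment> \<open>F converges along the sequence, so in \<open>Wq\<close> the term with I1 / s n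
    cannot blow up; multiplication by s n isolates it.\<close>
  have "(\<lambda>n. of_real (s n) * ((LINT x|lborel. w x * q n x) - F (of_real (s n)))) \<longlonglongrightarrow> of_real 0 * ((LINT x|lborel. w x * (- of_real (x\<^sup>2 / 2))) - F 0)"
    by (intro tendsto_intros s qI sF)
  moreover have "of_real (s n) * ((LINT x|lborel. w x * q n x) - F (of_real (s n))) = \<i> * I1" for n
    using Wq[of n] s(2)[of n] by simp
  ultimately have "\<i> * I1 = 0" by (simp add: LIMSEQ_const_iff)
  then have I10: "I1 = 0" by simp
  then show "(LINT x|lborel. of_real x * w x) = 0" by (simp add: I1_def)
  have "(\<lambda>n. F (of_real (s n))) \<longlonglongrightarrow> (LINT x|lborel. w x * (- of_real (x\<^sup>2 / 2)))"
    using qI unfolding Wq I10 by simp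
  then have "F 0 = (LINT x|lborel. w x * (- of_real (x\<^sup>2 / 2)))" using sF LIMSEQ_unique by blast
  then show "F 0 = - (LINT x|lborel. of_real (x\<^sup>2 / 2) * w x)" by (simp add: mult.commute)
qed

text \<open>As a function of x, \<open>spectral_integrand (s - x) l\<close> is affine apart from the
  exponential. The measure c \<delta> + w dx annihilates the affine part, and the exponential yields
  the transform l^2 F divided by l^2. At l = 0 the integrand is quadratic and the second moment
  gives F 0.\<close>

lemma transform_spectral_integrand:
  assumes w: "density_on r w" and F: "isCont F 0" and eq: "\<And>l. transform c w l = l\<^sup>2 * F l" and r: "r \<ge> 0"
  shows "c * spectral_integrand s l + (LINT x|lborel. w x * spectral_integrand (s - x) l) = - exp (\<i> * of_real (l * s)) * F (of_real l)"
proof -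
  note wD = density_onD[OF w]
  note mom = transform_moments[OF assms]
  have lin: "(LINT x|lborel. \<alpha> * w x + \<beta> * (of_real x * w x)) = - (\<alpha> * c)" for \<alpha> \<beta> :: complex
    using wD(1) mom(1-3) by (simp add: add_eq_0_iff)
  show ?thesis
  proof (cases "l = 0")
    case True
    have "w x * spectral_integrand (s - x) l = (of_real (s\<^sup>2 / 2) * w x + (- of_real s) * (of_real x * w x)) + of_real (1/2) * (of_real (x\<^sup>2) * w x)" for x
      using True by (simp add: spectral_integrand_def power2_eq_square field_simps)
    then have "(LINT x|lborel. w x * spectral_integrand (s - x) l) = - (of_real (s\<^sup>2 / 2) * c) + of_real (1/2) * (LINT x|lborel. of_real (x\<^sup>2) * w x)"
      using lin[of "of_real (s\<^sup>2 / 2)" "- of_real s"] wD(1) mom(3,4) by simp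
    moreover have "F 0 = - (of_real (1/2) * (LINT x|lborel. of_real (x\<^sup>2) * w x))"
      unfolding mom(5) by simp
    ultimately show ?thesis using True by (simp add: spectral_integrand_def diff_divide_distrib)
  next
    case False
    define L where "L = complex_of_real l"
    have L: "L \<noteq> 0" using False by (simp add: L_def)
    define e where "e = exp (\<i> * of_real (l * s))"
    define d where "d = \<i> * of_real l / of_real (1 + l\<^sup>2)"
    have wE: "integrable lborel (\<lambda>x. w x * exp (- \<i> * L * of_real x))" by (rule transform_integrable[OF w])
    have S: "spectral_integrand (s - x) l = (1 + d * of_real s - d * of_real x - e * exp (- \<i> * L * of_real x)) / L\<^sup>2" for x
    proof -
      have "exp (\<i> * of_real (l * (s - x))) = e * exp (- \<i> * L * of_real x)"
        unfolding e_def exp_add[symmetric] L_def by (simp add: algebra_simps)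
      moreover have "\<i> * of_real (l * (s - x)) / of_real (1 + l\<^sup>2) = d * of_real s - d * of_real x"
        by (simp add: d_def diff_divide_distrib algebra_simps)
      ultimately show ?thesis using False by (simp add: spectral_integrand_def L_def)
    qed
    have "w x * spectral_integrand (s - x) l =
       (((1 + d * of_real s) / L\<^sup>2) * w x + (- d / L\<^sup>2) * (of_real x * w x)) - (e / L\<^sup>2) * (w x * exp (- \<i> * L * of_real x))" for x
      unfolding S by (simp add: diff_divide_distrib add_divide_distrib algebra_simps)
    then have "(LINT x|lborel. w x * spectral_integrand (s - x) l) =
       - ((1 + d * of_real s) / L\<^sup>2 * c) - (e / L\<^sup>2) * (LINT x|lborel. w x * exp (- \<i> * L * of_real x))"
      using lin[of "(1 + d * of_real s) / L\<^sup>2" "- d / L\<^sup>2"] wD(1) mom(3) wE by simp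
    also have "(LINT x|lborel. w x * exp (- \<i> * L * of_real x)) = L\<^sup>2 * F L - c"
      unfolding eq[symmetric] by (simp add: transform_def)
    finally have "(LINT x|lborel. w x * spectral_integrand (s - x) l) =
       - ((1 + d * of_real s) / L\<^sup>2 * c) - (e / L\<^sup>2) * (L\<^sup>2 * F L - c)" .
    moreover have "c * spectral_integrand s l = c * ((1 + d * of_real s - e) / L\<^sup>2)"
      using S[of 0] by simp
    moreover have "(e / L\<^sup>2) * (L\<^sup>2 * F L - c) = e * F L - e * c / L\<^sup>2" using L by (simp add: right_diff_distrib)
    ultimately show ?thesis unfolding e_def[symmetric] L_def[symmetric]
      by (simp only:) (simp add: diff_divide_distrib add_divide_distrib algebra_simps)
  qed
qed

text \<open>For convolution kernels such as g(s) h(t - s), whose integral over the second variable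
  is controlled for each value of the first.\<close>

lemma Fubini_iterated_bound:
  fixes f :: "'a \<Rightarrow> 'b \<Rightarrow> complex"
  assumes "sigma_finite_measure M1" "sigma_finite_measure M2"
    and f [measurable]: "case_prod f \<in> borel_measurable (M1 \<Otimes>\<^sub>M M2)"
    and a: "integrable M1 a" and i: "\<And>x. integrable M2 (f x)"
    and bound: "\<And>x. (LINT y|M2. cmod (f x y)) \<le> a x"
  shows "(LINT x|M1. LINT y|M2. f x y) = (LINT y|M2. LINT x|M1. f x y)"
proof -
  interpret M1: sigma_finite_measure M1 by fact
  interpret M2: sigma_finite_measure M2 by fact
  interpret pair_sigma_finite M1 M2 ..
  have "integrable (M1 \<Otimes>\<^sub>M M2) (case_prod f)"
  proof (rule Fubini_integrable[OF f])
    show "integrable M1 (\<lambda>x. LINT y|M2. norm (case_prod f (x, y)))"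
      by (rule Bochner_Integration.integrable_bound[OF a])
         (use bound in \<open>auto intro!: AE_I2 order_trans[OF _ abs_ge_self]\<close>)
    show "AE x in M1. integrable M2 (\<lambda>y. case_prod f (x, y))" using i by simp
  qed
  then show ?thesis using Fubini_integral[of f] by simp
qed

lemma hinge_integrable:
  assumes "integrable lborel w" "\<And>t. t \<notin> {-B..B} \<Longrightarrow> w t = 0" "B \<ge> 0"
  shows "integrable lborel (\<lambda>t. of_real (max (x - t) 0) * w t :: complex)"
proof (rule Bochner_Integration.integrable_bound)
  have [measurable]: "w \<in> borel_measurable borel" using assms(1) by (auto dest: borel_measurable_integrable)
  show "integrable lborel (\<lambda>t. (\<bar>x\<bar> + B) * cmod (w t))" using assms(1) by simp
  show "(\<lambda>t. of_real (max (x - t) 0) * w t) \<in> borel_measurable lborel" by measurable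
  have "cmod (of_real (max (x - t) 0) * w t) \<le> (\<bar>x\<bar> + B) * cmod (w t)" for t
  proof (cases "t \<in> {-B..B}")
    case True
    then have "cmod (of_real (max (x - t) 0)) \<le> \<bar>x\<bar> + B" by (auto simp: abs_if)
    then show ?thesis unfolding norm_mult by (rule mult_right_mono) simp
  qed (simp add: assms(2))
  then show "AE t in lborel. norm (of_real (max (x - t) 0) * w t) \<le> norm ((\<bar>x\<bar> + B) * cmod (w t))"
    using assms(3) by (simp add: abs_mult)
qed

text \<open>The identity defining the spectral measure, brought into a form that is the same for
  both signs of x. It is kept only modulo affine functions of x, since the measures paired with it
  annihilate these.\<close>

locale spectral_accelerant = truncated_accelerant +
  fixes \<sigma> :: "real measure" and a0 a1 :: complex
  assumes sets_\<sigma> [measurable_cong]: "sets \<sigma> = sets borel"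
    and \<sigma>_integrable: "integrable \<sigma> (\<lambda>l. 1 / (1 + l\<^sup>2))"
    and spectral_identity: "\<And>x. x \<in> {-R..R} \<Longrightarrow> (LINT l|\<sigma>. spectral_integrand x l) =
      of_real (max x 0) + (LINT s|lborel. of_real (max (x - s) 0) * h s) + a0 + a1 * of_real x"
begin

lemma sigma_finite_\<sigma>: "sigma_finite_measure \<sigma>"
proof
  have sp: "space \<sigma> = UNIV" using sets_eq_imp_space_eq[OF sets_\<sigma>] by simp
  have "emeasure \<sigma> {- real n..real n} \<noteq> \<infinity>" for n :: nat
  proof -
    have "integrable \<sigma> (indicator {- real n..real n} :: real \<Rightarrow> real)"
    proof (rule Bochner_Integration.integrable_bound)
      show "integrable \<sigma> (\<lambda>l. (1 + (real n)\<^sup>2) * (1 / (1 + l\<^sup>2)))"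
        by (intro integrable_mult_right \<sigma>_integrable)
      have "norm (indicator {- real n..real n} l :: real) \<le> norm ((1 + (real n)\<^sup>2) * (1 / (1 + l\<^sup>2)))" for l
      proof (cases "l \<in> {- real n..real n}")
        case True
        then have "l\<^sup>2 \<le> (real n)\<^sup>2" by (intro abs_le_square_iff[THEN iffD1]) auto
        moreover have "1 + l\<^sup>2 > 0" by (simp add: add_pos_nonneg)
        ultimately show ?thesis using True by (simp add: pos_le_divide_eq)
      qed simp
      then show "AE l in \<sigma>. norm (indicator {- real n..real n} l :: real) \<le> norm ((1 + (real n)\<^sup>2) * (1 / (1 + l\<^sup>2)))"
        by simp
    qed (simp add: sets_\<sigma>)
    then show ?thesis by (simp add: integrable_indicator_iff sp less_top[symmetric])
  qed
  then show "\<exists>A. countable A \<and> A \<subseteq> sets \<sigma> \<and> \<Union> A = space \<sigma> \<and> (\<forall>a\<in>A. emeasure \<sigma> a \<noteq> \<infinity>)"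
  proof (intro exI[of _ "range (\<lambda>n::nat. {- real n..real n})"] conjI)
    have "x \<in> (\<Union>n::nat. {- real n..real n})" for x
    proof -
      obtain n :: nat where "\<bar>x\<bar> \<le> real n" using real_arch_simple by blast
      then show ?thesis by (intro UN_I[of n]) auto
    qed
    then show "\<Union> (range (\<lambda>n::nat. {- real n..real n})) = space \<sigma>" by (auto simp: sp)
  qed (auto simp: sets_\<sigma>)
qed

definition \<Psi> :: "real \<Rightarrow> complex" where "\<Psi> x = (LINT l|\<sigma>. spectral_integrand x l)"

definition CS :: real where "CS = 2 * R\<^sup>2 + 2 * R + 4"

lemma S_bound: "x \<in> {-R..R} \<Longrightarrow> cmod (spectral_integrand x l) \<le> CS * (1 / (1 + l\<^sup>2))"
  unfolding CS_def by (rule spectral_integrand_bound) auto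

lemma \<sigma>_integrable_bound:
  assumes "f \<in> borel_measurable borel" "\<And>l. cmod (f l) \<le> K * (1 / (1 + l\<^sup>2))"
  shows "integrable \<sigma> f"
proof (rule Bochner_Integration.integrable_bound[OF integrable_mult_right[OF \<sigma>_integrable, of K]])
  show "f \<in> borel_measurable \<sigma>" using assms(1) sets_\<sigma> by (simp cong: measurable_cong_sets)
  show "AE l in \<sigma>. cmod (f l) \<le> norm (K * (1 / (1 + l\<^sup>2)))"
    unfolding real_norm_def by (intro AE_I2 order_trans[OF assms(2) abs_ge_self])
qed

lemma S_integrable: "x \<in> {-R..R} \<Longrightarrow> integrable \<sigma> (spectral_integrand x)"
  by (rule \<sigma>_integrable_bound[OF _ S_bound]) auto

lemma \<Psi>_measurable [measurable]: "\<Psi> \<in> borel_measurable borel"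
proof -
  interpret sigma_finite_measure \<sigma> by (rule sigma_finite_\<sigma>)
  have "(\<lambda>(x, l). spectral_integrand x l) \<in> borel_measurable (borel \<Otimes>\<^sub>M \<sigma>)" by measurable
  then show ?thesis unfolding \<Psi>_def by (rule borel_measurable_lebesgue_integral)
qed

definition C\<Psi> :: real where "C\<Psi> = (LINT l|\<sigma>. CS * (1 / (1 + l\<^sup>2)))"

lemma \<Psi>_bound: "x \<in> {-R..R} \<Longrightarrow> cmod (\<Psi> x) \<le> C\<Psi>"
  unfolding \<Psi>_def C\<Psi>_def
  by (rule norm_integral_le[OF integrable_mult_right[OF \<sigma>_integrable]], rule AE_I2, rule S_bound)

lemma \<Psi>_minus: "\<Psi> (- x) = cnj (\<Psi> x)"
  unfolding \<Psi>_def spectral_integrand_minus by simp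

text \<open>Formally \<open>\<Psi>'' = \<delta> + H\<close>, so the second derivative of the function below is
  \<open>\<delta> + H - g - H * g\<close>, which vanishes on \<open>(0, r]\<close>.\<close>

lemma \<Psi>_minus_convolution_affine:
  assumes r: "0 < r" "r \<le> R"
  obtains a b where "\<And>x. x \<in> {0..r} \<Longrightarrow> \<Psi> x - (LINT s|lborel. g r s * \<Psi> (x - s)) = a + b * of_real x"
proof -
  have gr: "sq_integrable (g r)" using g r by simp
  have gi: "integrable lborel (g r)" using g_integrable r by simp
  have [measurable]: "g r \<in> borel_measurable borel" using gr by measurable
  have hi: "integrable lborel h" using sq_integrable_imp_integrable(1)[OF h, of "-R" R] h_supp R by simp
  define cg where "cg = conv h (g r)"
  have cg0: "cg t = 0" if "t \<notin> {-(2*R)..2*R}" for t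
  proof -
    have "h (t - u) * g r u = 0" for u
      using that h_supp[of "t - u"] g_supp[of u r] r by (cases "u \<in> {0..r}") auto
    then show ?thesis unfolding cg_def conv_def by (simp only: Bochner_Integration.integral_zero)
  qed
  have cgm[measurable]: "cg \<in> borel_measurable borel" unfolding cg_def by measurable
  have "sq_integrable cg"
    by (rule sq_integrable_interval(1)[OF cgm, where a="-(2*R)" and b="2*R" and B="norm2 h * norm2 (g r)"])
       (use R cg0 conv_bound[OF h gr] in \<open>auto simp: cg_def\<close>)
  then have cgi: "integrable lborel cg"
    by (rule sq_integrable_imp_integrable(1)[where a="-(2*R)" and b="2*R"]) (use R cg0 in auto)
  \<comment> \<open>What is left of h - g - h * g under the kernel (x - t)_+ with x <= r: the
    resolvent equation removes [0, r], the kernel removes t > r, and g vanishes on the negative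
    half-line. There the kernel is x - t, so the result is affine in x.\<close>
  define \<kappa> where "\<kappa> = cut {..<0} (\<lambda>t. h t - cg t)"
  have \<kappa>0: "\<kappa> t = 0" if "t \<notin> {-(2*R)..2*R}" for t using that cg0[OF that] h_supp[of t] R by (auto simp: \<kappa>_def cut_def)
  have \<kappa>i: "integrable lborel \<kappa>"
  proof (rule Bochner_Integration.integrable_bound)
    show "integrable lborel (\<lambda>t. h t - cg t)" using hi cgi by simp
    show "\<kappa> \<in> borel_measurable lborel" unfolding \<kappa>_def by measurable
  qed (auto simp: \<kappa>_def cut_def)
  have hg: "integrable lborel (\<lambda>t. of_real (max (x - t) 0) * h t)" "integrable lborel (\<lambda>t. of_real (max (x - t) 0) * cg t)"
    "integrable lborel (\<lambda>t. of_real (max (x - t) 0) * g r t)" for x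
    subgoal by (rule hinge_integrable[OF hi h_supp]) (use R in auto)
    subgoal by (rule hinge_integrable[OF cgi cg0]) (use R in auto)
    subgoal by (rule hinge_integrable[OF gi, of R]) (use g_supp[of _ r] r R in auto)
    done
  have sgi: "integrable lborel (\<lambda>s. of_real s * g r s)" and s\<kappa>i: "integrable lborel (\<lambda>s. of_real s * \<kappa> s)"
  proof -
    have *: "integrable lborel (\<lambda>s. of_real s * w s)" if w: "integrable lborel w" "\<And>t. t \<notin> {-(2*R)..2*R} \<Longrightarrow> w t = 0" for w :: "real \<Rightarrow> complex"
    proof (rule Bochner_Integration.integrable_bound)
      show "integrable lborel (\<lambda>s. 2 * R * cmod (w s))" using w by simp
      show "(\<lambda>s. of_real s * w s) \<in> borel_measurable lborel" using w(1) by (auto dest: borel_measurable_integrable)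
      have "cmod (of_real s * w s) \<le> 2 * R * cmod (w s)" for s
        using w(2)[of s] by (cases "s \<in> {-(2*R)..2*R}") (auto simp: norm_mult intro!: mult_right_mono)
      then show "AE s in lborel. norm (of_real s * w s) \<le> norm (2 * R * cmod (w s))" using R by (simp add: abs_mult)
    qed
    show "integrable lborel (\<lambda>s. of_real s * g r s)" by (rule *[OF gi]) (use g_supp[of _ r] r R in auto)
    show "integrable lborel (\<lambda>s. of_real s * \<kappa> s)" by (rule *[OF \<kappa>i \<kappa>0])
  qed
  define G0 where "G0 = (LINT s|lborel. g r s)"
  define G1 where "G1 = (LINT s|lborel. of_real s * g r s)"
  define k0 where "k0 = (LINT s|lborel. \<kappa> s)"
  define k1 where "k1 = (LINT s|lborel. of_real s * \<kappa> s)"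
  have main: "\<Psi> x - (LINT s|lborel. g r s * \<Psi> (x - s)) =
      (a0 - k1 - a0 * G0 + a1 * G1) + (1 + k0 + a1 - a1 * G0) * of_real x" if x: "x \<in> {0..r}" for x
  proof -
    define M where "M y = (LINT s|lborel. of_real (max (y - s) 0) * h s)" for y
    have Psi: "\<Psi> y = of_real (max y 0) + M y + a0 + a1 * of_real y" if "y \<in> {-R..R}" for y
      unfolding \<Psi>_def M_def by (rule spectral_identity[OF that])
    have Mx: "M (x - s) = (LINT t|lborel. of_real (max (x - t) 0) * h (t - s))" for s
      unfolding M_def by (subst lborel_integral_real_affine[of 1 _ "-s"]) (auto simp: algebra_simps)
    define f where "f s t = g r s * (of_real (max (x - t) 0) * h (t - s))" for s t
    have fm: "case_prod f \<in> borel_measurable (lborel \<Otimes>\<^sub>M lborel)" unfolding f_def by measurable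
    have hs: "integrable lborel (\<lambda>t. h (t - s))" for s
      using lborel_integrable_real_affine[OF hi, of 1 "-s"] by simp
    have hn: "(LINT t|lborel. cmod (h (t - s))) = (LINT t|lborel. cmod (h t))" for s
      using lborel_integral_real_affine[of 1 "\<lambda>t. cmod (h t)" "-s"] by simp
    have fi: "integrable lborel (f s)" and fb: "(LINT t|lborel. cmod (f s t)) \<le> 2 * R * (LINT t|lborel. cmod (h t)) * cmod (g r s)" for s
    proof -
      have b: "cmod (f s t) \<le> 2 * R * cmod (g r s) * cmod (h (t - s))" for t
      proof (cases "s \<in> {0..r} \<and> t - s \<in> {-R..R}")
        case True
        then have "cmod (of_real (max (x - t) 0)) \<le> 2 * R" using x r by auto
        then have "cmod (of_real (max (x - t) 0)) * (cmod (g r s) * cmod (h (t - s))) \<le> 2 * R * (cmod (g r s) * cmod (h (t - s)))"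
          by (rule mult_right_mono) simp
        then show ?thesis by (simp add: f_def norm_mult mult_ac)
      next
        case False
        then show ?thesis using g_supp[of s r] h_supp[of "t - s"] R by (auto simp: f_def)
      qed
      have wi: "integrable lborel (\<lambda>t. 2 * R * cmod (g r s) * cmod (h (t - s)))" using hs by simp
      show fi: "integrable lborel (f s)"
      proof (rule Bochner_Integration.integrable_bound[OF wi])
        show "f s \<in> borel_measurable lborel" unfolding f_def by measurable
        show "AE t in lborel. cmod (f s t) \<le> norm (2 * R * cmod (g r s) * cmod (h (t - s)))"
          unfolding real_norm_def by (intro AE_I2 order_trans[OF b abs_ge_self])
      qed
      have "(LINT t|lborel. cmod (f s t)) \<le> (LINT t|lborel. 2 * R * cmod (g r s) * cmod (h (t - s)))"
        by (rule integral_mono[OF integrable_norm[OF fi] wi b])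
      then show "(LINT t|lborel. cmod (f s t)) \<le> 2 * R * (LINT t|lborel. cmod (h t)) * cmod (g r s)"
        by (simp add: hn mult_ac)
    qed
    have ai: "integrable lborel (\<lambda>s. 2 * R * (LINT t|lborel. cmod (h t)) * cmod (g r s))" using gi by simp
    have "(LINT s|lborel. g r s * M (x - s)) = (LINT s|lborel. LINT t|lborel. f s t)"
      unfolding Mx f_def by simp
    also have "\<dots> = (LINT t|lborel. LINT s|lborel. f s t)"
      by (rule Fubini_iterated_bound[OF lborel.sigma_finite_measure_axioms lborel.sigma_finite_measure_axioms fm ai fi fb])
    also have "\<dots> = (LINT t|lborel. of_real (max (x - t) 0) * cg t)"
    proof (intro Bochner_Integration.integral_cong refl)
      fix t
      have "f s t = of_real (max (x - t) 0) * (h (t - s) * g r s)" for s by (simp add: f_def)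
      then show "(LINT s|lborel. f s t) = of_real (max (x - t) 0) * cg t" by (simp add: cg_def conv_def)
    qed
    finally have gM: "(LINT s|lborel. g r s * M (x - s)) = (LINT t|lborel. of_real (max (x - t) 0) * cg t)" .
    have gMi: "integrable lborel (\<lambda>s. g r s * M (x - s))"
    proof (rule Bochner_Integration.integrable_bound[OF ai])
      show "(\<lambda>s. g r s * M (x - s)) \<in> borel_measurable lborel" unfolding M_def by measurable
      have "cmod (g r s * M (x - s)) \<le> 2 * R * (LINT t|lborel. cmod (h t)) * cmod (g r s)" for s
      proof -
        have "g r s * M (x - s) = (LINT t|lborel. f s t)" unfolding Mx f_def by simp
        then have "cmod (g r s * M (x - s)) \<le> (LINT t|lborel. cmod (f s t))" by (simp add: integral_norm_bound)
        then show ?thesis using fb[of s] by linarith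
      qed
      then show "AE s in lborel. norm (g r s * M (x - s)) \<le> norm (2 * R * (LINT t|lborel. cmod (h t)) * cmod (g r s))"
        by (auto intro!: AE_I2 order_trans[OF _ abs_ge_self])
    qed
    have gP: "g r s * \<Psi> (x - s) = of_real (max (x - s) 0) * g r s + g r s * M (x - s) + ((a0 + a1 * of_real x) * g r s - a1 * (of_real s * g r s))" for s
    proof (cases "s \<in> {0..r}")
      case True
      then have "x - s \<in> {-R..R}" using x r by auto
      note P = Psi[OF this]
      show ?thesis unfolding P by (simp add: algebra_simps)
    qed (use g_supp[of s r] in simp)
    have "(LINT s|lborel. g r s * \<Psi> (x - s)) = (LINT s|lborel. of_real (max (x - s) 0) * g r s) + (LINT t|lborel. of_real (max (x - t) 0) * cg t)
       + ((a0 + a1 * of_real x) * G0 - a1 * G1)"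
      unfolding gP G0_def G1_def gM[symmetric] using hg gMi gi sgi by simp
    moreover have "\<Psi> x = of_real x + (LINT s|lborel. of_real (max (x - s) 0) * h s) + a0 + a1 * of_real x"
      using Psi[of x] x r by (simp add: M_def)
    moreover have "(LINT s|lborel. of_real (max (x - s) 0) * h s) - (LINT s|lborel. of_real (max (x - s) 0) * g r s) - (LINT t|lborel. of_real (max (x - t) 0) * cg t)
        = of_real x * k0 - k1"
    proof -
      have "(LINT s|lborel. of_real (max (x - s) 0) * h s) - (LINT s|lborel. of_real (max (x - s) 0) * g r s) - (LINT t|lborel. of_real (max (x - t) 0) * cg t)
         = (LINT t|lborel. of_real (max (x - t) 0) * h t - of_real (max (x - t) 0) * g r t - of_real (max (x - t) 0) * cg t)"
        using hg by simp
      also have "\<dots> = (LINT t|lborel. of_real x * \<kappa> t - of_real t * \<kappa> t)"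
      proof (rule integral_cong_AE)
        have "AE t in lborel. t \<in> {0..r} \<longrightarrow> g r t + cg t = h t" unfolding cg_def using g_eq r by simp
        then show "AE t in lborel. of_real (max (x - t) 0) * h t - of_real (max (x - t) 0) * g r t - of_real (max (x - t) 0) * cg t = of_real x * \<kappa> t - of_real t * \<kappa> t"
        proof eventually_elim
          case (elim t)
          consider "t < 0" | "t \<in> {0..r}" | "t > r" by fastforce
          then show ?case
          proof cases
            case 1
            then have "g r t = 0" "max (x - t) 0 = x - t" using g_supp[of t r] x by auto
            then show ?thesis using 1 by (simp add: \<kappa>_def cut_def algebra_simps)
          next
            case 2
            then have "h t = g r t + cg t" using elim by simp
            then show ?thesis using 2 by (simp add: \<kappa>_def cut_def algebra_simps)
          next
            case 3
            then have "max (x - t) 0 = 0" using x by auto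
            then show ?thesis using 3 r by (simp add: \<kappa>_def cut_def)
          qed
        qed
      qed (use hg \<kappa>i s\<kappa>i in \<open>auto intro!: borel_measurable_diff borel_measurable_integrable\<close>)
      also have "\<dots> = of_real x * k0 - k1" using \<kappa>i s\<kappa>i by (simp add: k0_def k1_def)
      finally show ?thesis .
    qed
    ultimately show ?thesis by algebra
  qed
  show thesis by (rule that[OF main])
qed

text \<open>L s is -e^(ils) F, so the integrand is, up to sign, L 0 minus the superposition of the L
  s with weight cnj (g r s). Integrating L s against \<sigma> turns every exponential into \<Psi>.
  After exchanging integrals the total pairs c \<delta> + w dx with a function that is affine on
  [0, r], and this pairing vanishes.\<close>

lemma orthogonality:
  assumes r: "0 < r" "r \<le> R" and w: "density_on r w" and F: "\<And>l. isCont F l" and eq: "\<And>l. transform c w l = l\<^sup>2 * F l"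
  shows "(LINT l|\<sigma>. cnj (Q r (of_real l)) * F (of_real l)) = 0"
    and "integrable \<sigma> (\<lambda>l. cnj (Q r (of_real l)) * F (of_real l))"
proof -
  note wD = density_onD[OF w]
  have [measurable]: "w \<in> borel_measurable borel" using wD(1) by (auto dest: borel_measurable_integrable)
  have gr: "sq_integrable (g r)" using g r by simp
  have gi: "integrable lborel (g r)" using g_integrable r by simp
  have [measurable]: "g r \<in> borel_measurable borel" using gr by measurable
  note mom = transform_moments[OF w F eq less_imp_le[OF r(1)]]
  define L where "L s l = - exp (\<i> * of_real (l * s)) * F (of_real l)" for s l :: real
  have L: "L s l = c * spectral_integrand s l + (LINT x|lborel. w x * spectral_integrand (s - x) l)" for s l
    unfolding L_def by (rule transform_spectral_integrand[OF w F eq less_imp_le[OF r(1)], symmetric])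
  have "continuous_on UNIV (\<lambda>l::real. F (of_real l))"
    by (intro continuous_at_imp_continuous_on ballI continuous_within_compose3[OF F]) (auto intro!: continuous_intros)
  then have Fm[measurable]: "(\<lambda>l::real. F (of_real l)) \<in> borel_measurable borel"
    by (rule borel_measurable_continuous_onI)
  define W where "W = (LINT x|lborel. cmod (w x))"
  have wb: "cmod (w x * spectral_integrand (s - x) l) \<le> cmod (w x) * (CS * (1 / (1 + l\<^sup>2)))" if "s \<in> {0..r}" for s x l
  proof (cases "x \<in> {0..r}")
    case True
    then have "s - x \<in> {-R..R}" using that r by auto
    from S_bound[OF this, of l] show ?thesis by (simp only: norm_mult) (rule mult_left_mono, auto)
  qed (simp add: wD)
  have Lb: "cmod (L s l) \<le> ((cmod c + W) * CS) * (1 / (1 + l\<^sup>2))" if s: "s \<in> {0..r}" for s l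
  proof -
    have "cmod (L s l) \<le> cmod c * cmod (spectral_integrand s l) + cmod (LINT x|lborel. w x * spectral_integrand (s - x) l)"
      unfolding L by (metis norm_mult norm_triangle_ineq)
    also have "cmod (LINT x|lborel. w x * spectral_integrand (s - x) l) \<le> (LINT x|lborel. cmod (w x) * (CS * (1 / (1 + l\<^sup>2))))"
      using wb[OF s] wD(1) by (intro norm_integral_le) auto
    also have "\<dots> = W * (CS * (1 / (1 + l\<^sup>2)))" using wD(1) by (simp add: W_def)
    also have "cmod c * cmod (spectral_integrand s l) \<le> cmod c * (CS * (1 / (1 + l\<^sup>2)))"
      using s r by (intro mult_left_mono S_bound) auto
    finally show ?thesis by (simp add: algebra_simps)
  qed
  have Li: "integrable \<sigma> (L s)" if "s \<in> {0..r}" for s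
  proof (rule \<sigma>_integrable_bound[OF _ Lb[OF that]])
    show "L s \<in> borel_measurable borel" unfolding L_def by measurable
  qed
  have LI: "(LINT l|\<sigma>. L s l) = c * \<Psi> s + (LINT x|lborel. w x * \<Psi> (s - x))" if s: "s \<in> {0..r}" for s
  proof -
    have fm: "case_prod (\<lambda>x l. w x * spectral_integrand (s - x) l) \<in> borel_measurable (lborel \<Otimes>\<^sub>M \<sigma>)" by measurable
    note Fub = Fubini_product_bound[OF lborel.sigma_finite_measure_axioms sigma_finite_\<sigma> fm integrable_norm[OF wD(1)] integrable_mult_right[OF \<sigma>_integrable, of CS] wb[OF s]]
    have "(LINT l|\<sigma>. L s l) = c * \<Psi> s + (LINT l|\<sigma>. LINT x|lborel. w x * spectral_integrand (s - x) l)"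
      unfolding L \<Psi>_def using S_integrable[of s] Fub(3) s r by simp
    then show ?thesis unfolding Fub(1)[symmetric] by (simp add: \<Psi>_def)
  qed
  define f where "f s l = cnj (g r s) * L s l" for s l
  have fm: "case_prod f \<in> borel_measurable (lborel \<Otimes>\<^sub>M \<sigma>)" unfolding f_def L_def by measurable
  have fb: "cmod (f s l) \<le> cmod (g r s) * (((cmod c + W) * CS) * (1 / (1 + l\<^sup>2)))" for s l
  proof (cases "s \<in> {0..r}")
    case True
    from Lb[OF this, of l] show ?thesis by (simp only: f_def norm_mult complex_mod_cnj) (rule mult_left_mono, auto)
  qed (simp add: f_def g_supp)
  note Fub1 = Fubini_product_bound[OF lborel.sigma_finite_measure_axioms sigma_finite_\<sigma> fm integrable_norm[OF gi] integrable_mult_right[OF \<sigma>_integrable, of "(cmod c + W) * CS"] fb]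
  define f2 where "f2 s x = cnj (g r s) * (w x * \<Psi> (s - x))" for s x
  have f2m: "case_prod f2 \<in> borel_measurable (lborel \<Otimes>\<^sub>M lborel)" unfolding f2_def by measurable
  have f2b: "cmod (f2 s x) \<le> cmod (g r s) * (cmod (w x) * C\<Psi>)" for s x
  proof (cases "s \<in> {0..r} \<and> x \<in> {0..r}")
    case True
    then have "s - x \<in> {-R..R}" using r by auto
    from \<Psi>_bound[OF this] show ?thesis by (auto simp: f2_def norm_mult intro!: mult_left_mono)
  next
    case False
    then show ?thesis using wD(2)[of x] g_supp[of s r] by (auto simp: f2_def)
  qed
  note Fub2 = Fubini_product_bound[OF lborel.sigma_finite_measure_axioms lborel.sigma_finite_measure_axioms f2m integrable_norm[OF gi] integrable_mult_left[OF integrable_norm[OF wD(1)], of C\<Psi>] f2b]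
  have Qc: "cnj (Q r (of_real l)) * F (of_real l) = - (L 0 l - (LINT s|lborel. f s l))" for l
  proof -
    have "cnj (Q r (of_real l)) = 1 - (LINT s|lborel. cnj (g r s) * exp (\<i> * of_real (l * s)))"
      unfolding Q_eq by (simp add: Bochner_Integration.integral_cnj[symmetric] exp_cnj mult.assoc del: Bochner_Integration.integral_cnj)
    moreover have "(LINT s|lborel. f s l) = - (LINT s|lborel. cnj (g r s) * exp (\<i> * of_real (l * s))) * F (of_real l)"
    proof -
      have "f s l = - (cnj (g r s) * exp (\<i> * of_real (l * s))) * F (of_real l)" for s by (simp add: f_def L_def)
      then show ?thesis by simp
    qed
    ultimately show ?thesis by (simp only: L_def) (simp add: algebra_simps)
  qed
  have L0: "integrable \<sigma> (L 0)" using Li[of 0] r by simp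
  show "integrable \<sigma> (\<lambda>l. cnj (Q r (of_real l)) * F (of_real l))"
    unfolding Qc using L0 Fub1(3) by simp
  have "(LINT l|\<sigma>. LINT s|lborel. f s l) = (LINT s|lborel. LINT l|\<sigma>. f s l)" using Fub1(1) by simp
  also have "\<dots> = (LINT s|lborel. c * (cnj (g r s) * \<Psi> s) + (LINT x|lborel. f2 s x))"
  proof (intro Bochner_Integration.integral_cong refl)
    fix s
    show "(LINT l|\<sigma>. f s l) = c * (cnj (g r s) * \<Psi> s) + (LINT x|lborel. f2 s x)"
    proof (cases "s \<in> {0..r}")
      case True
      have "(LINT x|lborel. f2 s x) = cnj (g r s) * (LINT x|lborel. w x * \<Psi> (s - x))" by (simp add: f2_def)
      then show ?thesis using LI[OF True] by (simp add: f_def distrib_left mult.left_commute)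
    qed (simp add: f_def f2_def g_supp)
  qed
  also have "\<dots> = c * (LINT s|lborel. cnj (g r s) * \<Psi> s) + (LINT x|lborel. LINT s|lborel. f2 s x)"
  proof -
    have "integrable lborel (\<lambda>s. cnj (g r s) * \<Psi> s)"
    proof (rule Bochner_Integration.integrable_bound)
      show "integrable lborel (\<lambda>s. C\<Psi> * cmod (g r s))" using gi by simp
      have "cmod (cnj (g r s) * \<Psi> s) \<le> C\<Psi> * cmod (g r s)" for s
        using \<Psi>_bound[of s] g_supp[of s r] r by (cases "s \<in> {0..r}") (auto simp: norm_mult mult.commute[of _ "cmod (g r s)"] intro!: mult_left_mono)
      then show "AE s in lborel. norm (cnj (g r s) * \<Psi> s) \<le> norm (C\<Psi> * cmod (g r s))"
        by (auto intro!: AE_I2 order_trans[OF _ abs_ge_self])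
    qed measurable
    then show ?thesis using Fub2(1,2) by simp
  qed
  finally have I: "(LINT l|\<sigma>. LINT s|lborel. f s l) = c * (LINT s|lborel. cnj (g r s) * \<Psi> s) + (LINT x|lborel. LINT s|lborel. f2 s x)" .
  \<comment> \<open>The function paired with c \<delta> + w dx; by \<open>\<Psi>_minus\<close> it is
    the conjugate of the function in \<open>\<Psi>_minus_convolution_affine\<close>.\<close>
  define \<theta> where "\<theta> x = \<Psi> (- x) - (LINT s|lborel. cnj (g r s) * \<Psi> (s - x))" for x
  obtain a b where ab: "\<And>x. x \<in> {0..r} \<Longrightarrow> \<Psi> x - (LINT s|lborel. g r s * \<Psi> (x - s)) = a + b * of_real x"
    using \<Psi>_minus_convolution_affine[OF r] by metis
  have \<theta>: "\<theta> x = cnj a + cnj b * of_real x" if "x \<in> {0..r}" for x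
  proof -
    have "cnj (g r s) * \<Psi> (s - x) = cnj (g r s * \<Psi> (x - s))" for s
      using \<Psi>_minus[of "x - s"] by simp
    then have "\<theta> x = cnj (\<Psi> x - (LINT s|lborel. g r s * \<Psi> (x - s)))"
      unfolding \<theta>_def \<Psi>_minus by (simp del: complex_cnj_mult)
    then show ?thesis using ab[OF that] by simp
  qed
  have w\<Psi>: "integrable lborel (\<lambda>x. w x * \<Psi> (- x))"
  proof (rule Bochner_Integration.integrable_bound)
    show "integrable lborel (\<lambda>x. C\<Psi> * cmod (w x))" using wD(1) by simp
    have "cmod (w x * \<Psi> (- x)) \<le> C\<Psi> * cmod (w x)" for x
      using \<Psi>_bound[of "- x"] wD(2)[of x] r by (cases "x \<in> {0..r}") (auto simp: norm_mult mult.commute[of _ "cmod (w x)"] intro!: mult_left_mono)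
    then show "AE x in lborel. norm (w x * \<Psi> (- x)) \<le> norm (C\<Psi> * cmod (w x))"
      by (auto intro!: AE_I2 order_trans[OF _ abs_ge_self])
  qed measurable
  have "(LINT l|\<sigma>. L 0 l - (LINT s|lborel. f s l)) = (LINT l|\<sigma>. L 0 l) - (LINT l|\<sigma>. LINT s|lborel. f s l)"
    using L0 Fub1(3) by simp
  also have "\<dots> = c * \<theta> 0 + (LINT x|lborel. w x * \<Psi> (- x) - (LINT s|lborel. f2 s x))"
    using LI[of 0] r I w\<Psi> Fub2(3) by (simp add: \<theta>_def algebra_simps)
  also have "(LINT x|lborel. w x * \<Psi> (- x) - (LINT s|lborel. f2 s x)) = (LINT x|lborel. cnj a * w x + cnj b * (of_real x * w x))"
  proof (intro Bochner_Integration.integral_cong refl)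
    fix x
    have "f2 s x = w x * (cnj (g r s) * \<Psi> (s - x))" for s by (simp add: f2_def)
    then have "w x * \<Psi> (- x) - (LINT s|lborel. f2 s x) = w x * \<theta> x" by (simp add: \<theta>_def right_diff_distrib)
    also have "\<dots> = cnj a * w x + cnj b * (of_real x * w x)"
      using \<theta>[of x] wD(2)[of x] by (cases "x \<in> {0..r}") (auto simp: algebra_simps)
    finally show "w x * \<Psi> (- x) - (LINT s|lborel. f2 s x) = cnj a * w x + cnj b * (of_real x * w x)" .
  qed
  also have "\<dots> = cnj a * (LINT x|lborel. w x)" using wD(1) mom(2,3) by simp
  also have "c * \<theta> 0 + cnj a * (LINT x|lborel. w x) = cnj a * (c + (LINT x|lborel. w x))"
    using \<theta>[of 0] r by (simp add: algebra_simps)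
  finally have "(LINT l|\<sigma>. L 0 l - (LINT s|lborel. f s l)) = 0" using mom(1) by simp
  then show "(LINT l|\<sigma>. cnj (Q r (of_real l)) * F (of_real l)) = 0" unfolding Qc by (simp only: Bochner_Integration.integral_minus minus_zero)
qed

text \<open>Otherwise the left side of the spectral identity would be affine near \<open>0\<close>, where it has
  a kink.\<close>

lemma \<sigma>_nonzero: "\<not> (AE l in \<sigma>. False)"
proof
  assume "AE l in \<sigma>. False"
  then have z: "(LINT l|\<sigma>. spectral_integrand x l) = 0" for x
    by (intro integral_eq_zero_AE) (auto elim: eventually_mono)
  have hi: "integrable lborel h" using sq_integrable_imp_integrable(1)[OF h, of "-R" R] h_supp R by simp
  define M where "M y = (LINT s|lborel. of_real (max (y - s) 0) * h s)" for y
  have M: "of_real (max x 0) + M x + a0 + a1 * of_real x = 0" if "x \<in> {-R..R}" for x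
    using spectral_identity[OF that] z[of x] by (simp add: M_def)
  obtain \<delta> where \<delta>: "\<delta> > 0" "\<And>a b. a \<le> b \<Longrightarrow> b - a < \<delta> \<Longrightarrow> norm2 (cut {a<..b} h) < 1 / 2"
    using norm2_cut_small[OF h h_supp R, of "1/2"] by auto
  \<comment> \<open>The bound 2 y < \<delta> makes the norm of h on (-y, y] less than 1/2, and 2 y
    <= 1 makes the Cauchy-Schwarz factor at most 1. So h accounts for at most y/2 in a second
    difference that should cancel the amount y of the kink.\<close>
  define y where "y = min R (min (\<delta> / 3) (1 / 2))"
  have y: "y > 0" "y \<le> R" "2 * y < \<delta>" "2 * y \<le> 1" using R \<delta> by (auto simp: y_def)
  have hmax: "integrable lborel (\<lambda>s. of_real (max (x - s) 0) * h s)" for x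
    using hinge_integrable[OF hi, of R x] h_supp R by auto
  have "M y - 2 * M 0 + M (- y) = (LINT s|lborel. of_real (max (y - s) 0) * h s - 2 * (of_real (max (0 - s) 0) * h s) + of_real (max (- y - s) 0) * h s)"
    unfolding M_def using hmax[of y] hmax[of 0] hmax[of "-y"] by simp
  also have "cmod \<dots> \<le> (LINT s|lborel. y * cmod (cut {-y<..y} h s))"
  proof (rule norm_integral_le)
    have c: "sq_integrable (cut {-y<..y} h)" by (rule sq_integrable_cut(1)[OF h]) simp
    have "integrable lborel (cut {-y<..y} h)"
      by (rule sq_integrable_imp_integrable(1)[OF c, of "-y" y]) (use y in \<open>auto simp: cut_def\<close>)
    then show "integrable lborel (\<lambda>s. y * cmod (cut {-y<..y} h s))" by simp
    have "cmod (of_real (max (y - s) 0) * h s - 2 * (of_real (max (0 - s) 0) * h s) + of_real (max (- y - s) 0) * h s) \<le> y * cmod (cut {-y<..y} h s)" for s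
    proof -
      have "of_real (max (y - s) 0) * h s - 2 * (of_real (max (0 - s) 0) * h s) + of_real (max (- y - s) 0) * h s
          = of_real (max (y - s) 0 - 2 * max (0 - s) 0 + max (- y - s) 0) * h s"
        by (simp add: algebra_simps)
      \<comment> \<open>The second difference of the kernel is a hat function of height y on
        [-y, y].\<close>
      moreover have "\<bar>max (y - s) 0 - 2 * max (0 - s) 0 + max (- y - s) 0\<bar> \<le> (if s \<in> {-y<..y} then y else 0)"
        using y(1) by (auto simp: max_def)
      then have "cmod (of_real (max (y - s) 0 - 2 * max (0 - s) 0 + max (- y - s) 0) * h s) \<le> (if s \<in> {-y<..y} then y else 0) * cmod (h s)"
        unfolding norm_mult norm_of_real by (rule mult_right_mono) simp
      ultimately show ?thesis by (auto simp: cut_def split: if_splits)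
    qed
    then show "AE s in lborel. cmod (of_real (max (y - s) 0) * h s - 2 * (of_real (max (0 - s) 0) * h s) + of_real (max (- y - s) 0) * h s) \<le> y * cmod (cut {-y<..y} h s)"
      by simp
  qed
  also have "\<dots> \<le> y * (1 / 2)"
  proof -
    have c: "sq_integrable (cut {-y<..y} h)" by (rule sq_integrable_cut(1)[OF h]) simp
    have "(LINT s|lborel. cmod (cut {-y<..y} h s)) \<le> sqrt (y - (- y)) * norm2 (cut {-y<..y} h)"
      by (rule sq_integrable_imp_integrable(2)[OF c]) (use y in \<open>auto simp: cut_def\<close>)
    also have "\<dots> \<le> 1 * (1 / 2)"
      using y \<delta>(2)[of "-y" y] by (intro mult_mono) auto
    finally show ?thesis using y by simp
  qed
  finally have "cmod (M y - 2 * M 0 + M (- y)) \<le> y / 2" by simp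
  moreover have "M y - 2 * M 0 + M (- y) = - of_real y"
  proof -
    have "of_real y + M y + a0 + a1 * of_real y = 0" using M[of y] y by simp
    moreover have "M 0 + a0 = 0" using M[of 0] R by simp
    moreover have "M (- y) + a0 - a1 * of_real y = 0" using M[of "-y"] y by simp
    ultimately show ?thesis by algebra
  qed
  ultimately show False using y by simp
qed

end

subsection \<open>Counting zeroes\<close>

definition zero_poly :: "complex list \<Rightarrow> complex poly" where
  "zero_poly zs = (\<Prod>z\<leftarrow>zs. [:- z, 1:])"

lemma poly_zero_poly: "poly (zero_poly zs) l = (\<Prod>z\<leftarrow>zs. l - z)"
  by (induction zs) (auto simp: zero_poly_def left_diff_distrib)

lemma degree_zero_poly: "degree (zero_poly zs) \<le> length zs"
proof (induction zs)
  case (Cons z zs)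
  have "degree ([:- z, 1:] * zero_poly zs) \<le> degree [:- z, 1:] + degree (zero_poly zs)" by (rule degree_mult_le)
  then show ?case using Cons by (simp add: zero_poly_def)
qed (simp add: zero_poly_def)

lemma prod_list_ratio: "(\<Prod>z\<leftarrow>zs. f z / g z) = (\<Prod>z\<leftarrow>zs. f z) / (\<Prod>z\<leftarrow>zs. g z)" for f g :: "complex \<Rightarrow> complex"
  by (induction zs) auto

lemma norm_prod_list_le:
  assumes "\<And>z. z \<in> set zs \<Longrightarrow> cmod (f z) \<le> \<rho>" "\<rho> \<ge> 0"
  shows "cmod (\<Prod>z\<leftarrow>zs. f z) \<le> \<rho> ^ length zs"
  using assms by (induction zs) (auto simp: norm_mult intro!: mult_mono)

lemma norm_prod_list_eq_1:
  assumes "\<And>z. z \<in> set zs \<Longrightarrow> cmod (f z) = 1"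
  shows "cmod (\<Prod>z\<leftarrow>zs. f z) = 1"
  using assms by (induction zs) (auto simp: norm_mult)

text \<open>The Blaschke product \<open>B\<close> of the reflected zeroes, taken relative to its value at \<open>\<zeta>\<close>, yields
  a polynomial \<open>S\<close> of degree less than the number of zeroes such that \<open>(l - \<zeta>) S(l)\<close> is a small
  perturbation of \<open>\<Prod>(l - z)\<close> on the real line.\<close>

lemma perturbed_quotient:
  assumes zs: "\<And>z. z \<in> set zs \<Longrightarrow> Im z > 0" "zs \<noteq> []" and \<zeta>: "Im \<zeta> > 0"
    and \<rho>: "\<And>z. z \<in> set zs \<Longrightarrow> cmod ((\<zeta> - z) / (\<zeta> - cnj z)) \<le> \<rho>" "\<rho> \<ge> 0" "\<rho> ^ length zs \<le> e"
  obtains S \<eta> where "degree S < length zs"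
    "\<And>x::real. (of_real x - \<zeta>) * poly S (of_real x) = (\<Prod>z\<leftarrow>zs. of_real x - z) * (1 + \<eta> x)"
    "\<And>x::real. cmod (\<eta> x) \<le> e"
proof -
  define b where "b = (\<Prod>z\<leftarrow>zs. (\<zeta> - z) / (\<zeta> - cnj z))"
  \<comment> \<open>Here b is 1/B(\<zeta>), which makes \<zeta> a root; dividing it out brings the
    degree below the number of zeroes.\<close>
  define p where "p = zero_poly zs - smult b (zero_poly (map cnj zs))"
  have nz: "\<zeta> - cnj z \<noteq> 0" if "z \<in> set zs" for z using zs(1)[OF that] \<zeta> by (auto simp: complex_eq_iff)
  have "(\<Prod>z\<leftarrow>zs. \<zeta> - cnj z) \<noteq> 0" using nz by (auto simp: prod_list_zero_iff)
  then have root: "poly p \<zeta> = 0"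
    by (simp add: p_def poly_zero_poly b_def prod_list_ratio o_def)
  define S where "S = synthetic_div p \<zeta>"
  have pS: "poly p l = (l - \<zeta>) * poly S l" for l
    using arg_cong[OF synthetic_div_correct'[of \<zeta> p], of "\<lambda>p. poly p l"] root by (simp add: S_def algebra_simps)
  have "degree p \<le> length zs"
    unfolding p_def using degree_zero_poly[of zs] degree_zero_poly[of "map cnj zs"]
    by (intro degree_diff_le order_trans[OF degree_smult_le]) auto
  then have deg: "degree S < length zs" using zs(2) by (cases zs) (auto simp: S_def degree_synthetic_div)
  define \<eta> where "\<eta> x = - b * (\<Prod>z\<leftarrow>zs. (of_real x - cnj z) / (of_real x - z))" for x :: real
  have "of_real x - z \<noteq> 0" if "z \<in> set zs" for x z using zs(1)[OF that] by (auto simp: complex_eq_iff)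
  then have "(\<Prod>z\<leftarrow>zs. of_real x - z) \<noteq> 0" for x :: real by (force simp: prod_list_zero_iff)
  then have id: "(of_real x - \<zeta>) * poly S (of_real x) = (\<Prod>z\<leftarrow>zs. of_real x - z) * (1 + \<eta> x)" for x :: real
    unfolding pS[symmetric] by (simp add: p_def poly_zero_poly \<eta>_def prod_list_ratio o_def right_diff_distrib)
  have "cmod b \<le> e"
    unfolding b_def by (rule order_trans[OF norm_prod_list_le[OF \<rho>(1,2)] \<rho>(3)])
  moreover have "cmod (\<Prod>z\<leftarrow>zs. (of_real x - cnj z) / (of_real x - z)) = 1" for x :: real
  proof (rule norm_prod_list_eq_1)
    fix z assume z: "z \<in> set zs"
    have "cmod (of_real x - cnj z) = cmod (of_real x - z)"
      using complex_mod_cnj[of "of_real x - z"] by simp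
    moreover have "of_real x - z \<noteq> 0" using zs(1)[OF z] by (auto simp: complex_eq_iff)
    ultimately show "cmod ((of_real x - cnj z) / (of_real x - z)) = 1" by (simp add: norm_divide)
  qed
  ultimately have "cmod (\<eta> x) \<le> e" for x by (simp add: \<eta>_def norm_mult)
  from that[OF deg id this] show thesis .
qed

text \<open>With q = u^2 + t^2 the real part of the unperturbed quotient is at least (3/5)/q as soon
  as u^2 >= 4 t^2. Two perturbations of size 1/8 change the numerator 1 by at most 1/2 < 3/5, and
  the quotient has modulus 1/q; this is the origin of the 1/8.\<close>

lemma Re_perturbed_inverse_square_pos:
  fixes u t :: real
  assumes t: "t > 0" and u: "\<bar>u\<bar> \<ge> 2 * t" and e: "cmod e1 \<le> 1 / 8" "cmod e2 \<le> 1 / 8"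
  shows "Re ((1 + e1) * (1 + e2) / (of_real u - \<i> * of_real t)\<^sup>2) > 0"
proof -
  define d where "d = of_real u - \<i> * of_real t"
  define q where "q = u\<^sup>2 + t\<^sup>2"
  have u2: "u\<^sup>2 \<ge> 4 * t\<^sup>2" using power_mono[OF u, of 2] t by (simp add: power_mult_distrib)
  have t2: "t\<^sup>2 > 0" using t by simp
  have q: "q > 0" using t2 by (simp add: q_def add_nonneg_pos)
  have nd: "(cmod d)\<^sup>2 = q" by (simp add: d_def q_def cmod_def)
  have d0: "d \<noteq> 0" using nd q by auto
  have inv: "1 / d\<^sup>2 = (cnj d)\<^sup>2 / of_real (q\<^sup>2)"
  proof -
    have "d * cnj d = of_real q" unfolding complex_norm_square[symmetric] nd ..
    then have "d\<^sup>2 * (cnj d)\<^sup>2 = of_real (q\<^sup>2)" by (simp add: power_mult_distrib[symmetric])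
    then show ?thesis using d0 q by (simp add: field_simps)
  qed
  have "Re (1 / d\<^sup>2) = (u\<^sup>2 - t\<^sup>2) / q\<^sup>2"
    unfolding inv Re_divide_of_real by (simp add: d_def power2_eq_square)
  also have "\<dots> \<ge> (3 / 5 * q) / q\<^sup>2" using u2 by (intro divide_right_mono) (auto simp: q_def)
  finally have 1: "Re (1 / d\<^sup>2) \<ge> (3 / 5) / q" using q by (simp add: power2_eq_square)
  define \<theta> where "\<theta> = e1 + e2 + e1 * e2"
  have "cmod \<theta> \<le> cmod e1 + cmod e2 + cmod e1 * cmod e2"
    unfolding \<theta>_def norm_mult[symmetric] by (intro norm_triangle_le add_mono order_refl norm_triangle_ineq)
  also have "\<dots> \<le> 1 / 8 + 1 / 8 + 1 / 8 * (1 / 8)" using e by (intro add_mono mult_mono) auto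
  finally have \<theta>: "cmod \<theta> \<le> 1 / 2" by simp
  have "cmod (\<theta> / d\<^sup>2) \<le> (1 / 2) / q"
    unfolding norm_divide norm_power nd using \<theta> q by (intro divide_right_mono) auto
  then have 2: "Re (\<theta> / d\<^sup>2) \<ge> - ((1 / 2) / q)" using abs_Re_le_cmod[of "\<theta> / d\<^sup>2"] by linarith
  have eq: "(1 + e1) * (1 + e2) / d\<^sup>2 = 1 / d\<^sup>2 + \<theta> / d\<^sup>2"
    by (simp add: \<theta>_def algebra_simps add_divide_distrib)
  have 3: "(3 / 5) / q - (1 / 2) / q > 0" using q by (simp add: diff_divide_distrib[symmetric])
  show ?thesis unfolding d_def[symmetric] eq plus_complex.sel using 1 2 3 by linarith
qed

section \<open>Too many zeroes contradict orthogonality\<close>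

context spectral_accelerant
begin

lemma no_factorization:
  assumes r: "0 < r" "r \<le> R" and \<delta>: "\<delta> > 0" and gap: "AE l in \<sigma>. \<bar>l - x0\<bar> \<ge> \<delta>"
    and \<zeta>: "\<zeta> = Complex x0 (\<delta> / 2)"
    and K: "\<And>z. z \<in> K \<Longrightarrow> Im z > 0"
    and \<rho>: "\<And>z. z \<in> K \<Longrightarrow> cmod ((\<zeta> - z) / (\<zeta> - cnj z)) \<le> \<rho>" "\<rho> \<ge> 0" "\<rho> ^ N \<le> 1 / 8" "N \<ge> 1"
    and zs: "set zs \<subseteq> K" "length zs = 2 * N"
    and E: "E \<in> transforms r" and QE: "\<And>l. Q r l = (\<Prod>z\<leftarrow>zs. l - z) * E l"
  shows False
proof -
  define u where "u = take N zs"
  define v where "v = drop N zs"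
  have uv: "zs = u @ v" "length u = N" "length v = N" "set u \<subseteq> K" "set v \<subseteq> K"
    using zs set_take_subset[of N zs] set_drop_subset[of N zs] by (auto simp: u_def v_def)
  have z0: "Im \<zeta> > 0" using \<delta> by (simp add: \<zeta>)
  have pq: "\<exists>S \<eta>. degree S < N \<and> (\<forall>x::real. (of_real x - \<zeta>) * poly S (of_real x) = (\<Prod>z\<leftarrow>t. of_real x - z) * (1 + \<eta> x))
      \<and> (\<forall>x. cmod (\<eta> x) \<le> 1 / 8)" if t: "set t \<subseteq> K" "length t = N" for t
  proof (rule perturbed_quotient[of t \<zeta> \<rho> "1 / 8"])
    fix S \<eta> assume "degree S < length t" "\<And>x::real. (of_real x - \<zeta>) * poly S (of_real x) = (\<Prod>z\<leftarrow>t. of_real x - z) * (1 + \<eta> x)"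
      "\<And>x::real. cmod (\<eta> x) \<le> 1 / 8"
    then show ?thesis using t(2) by (intro exI[of _ S] exI[of _ \<eta>]) simp
  next
    fix z assume "z \<in> set t"
    then show "Im z > 0" "cmod ((\<zeta> - z) / (\<zeta> - cnj z)) \<le> \<rho>" using t(1) K \<rho>(1) by blast+
  next
    show "t \<noteq> []" using t(2) \<rho>(4) by auto
  qed (use t(2) \<rho>(2,3) z0 in simp_all)
  obtain S1 e1 where S1: "degree S1 < N"
    "\<And>x::real. (of_real x - \<zeta>) * poly S1 (of_real x) = (\<Prod>z\<leftarrow>u. of_real x - z) * (1 + e1 x)"
    "\<And>x::real. cmod (e1 x) \<le> 1 / 8"
    using pq[OF uv(4,2)] by metis
  obtain S2 e2 where S2: "degree S2 < N"
    "\<And>x::real. (of_real x - \<zeta>) * poly S2 (of_real x) = (\<Prod>z\<leftarrow>v. of_real x - z) * (1 + e2 x)"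
    "\<And>x::real. cmod (e2 x) \<le> 1 / 8"
    using pq[OF uv(5,3)] by metis
  define F where "F l = poly (S1 * S2) l * E l" for l
  have Ec: "isCont E l" for l by (rule transforms_continuous[OF E])
  have Fc: "isCont F l" for l unfolding F_def by (intro continuous_intros Ec)
  \<comment> \<open>The factor l^2 is what orthogonality asks for. It uses up the remaining room: 2
    + (N - 1) + (N - 1) is the number 2N of zeroes.\<close>
  have "degree ([:0, 0, 1:] * (S1 * S2)) \<le> degree [:0, 0, 1 :: complex:] + (degree S1 + degree S2)"
    by (intro order_trans[OF degree_mult_le] add_mono degree_mult_le order_refl)
  also have "\<dots> \<le> length zs" using S1(1) S2(1) zs(2) by simp
  finally have deg: "degree ([:0, 0, 1:] * (S1 * S2)) \<le> length zs" .
  have "(\<lambda>l. poly ([:0, 0, 1:] * (S1 * S2)) l * E l) \<in> transforms r"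
    by (rule transforms_move_zeros[OF _ Q_transforms[of r] QE Ec deg]) (use r in auto)
  then obtain c w where w: "density_on r w" and cw: "(\<lambda>l. poly ([:0, 0, 1:] * (S1 * S2)) l * E l) = transform c w"
    unfolding transforms_def by blast
  have eq: "transform c w l = l\<^sup>2 * F l" for l
    using fun_cong[OF cw, of l] by (simp add: F_def power2_eq_square mult.assoc)
  note orth = orthogonality[OF r w Fc eq]
  define G where "G l = cnj (Q r (of_real l)) * F (of_real l)" for l
  have Gpos: "Re (G l) > 0" if l: "\<bar>l - x0\<bar> \<ge> \<delta>" for l
  proof -
    define d where "d = of_real l - \<zeta>"
    have d: "d = of_real (l - x0) - \<i> * of_real (\<delta> / 2)" by (simp add: d_def \<zeta> complex_eq_iff)
    have d0: "d \<noteq> 0" using \<delta> by (simp add: d complex_eq_iff)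
    have "d\<^sup>2 * F (of_real l) = (d * poly S1 (of_real l)) * (d * poly S2 (of_real l)) * E (of_real l)"
      by (simp add: F_def power2_eq_square mult_ac)
    \<comment> \<open>Each of the two pole factors turns one polynomial into the product over its
      own group of zeroes, and both groups together with E restore Q.\<close>
    also have "\<dots> = Q r (of_real l) * ((1 + e1 l) * (1 + e2 l))"
      unfolding d_def S1(2) S2(2) QE uv(1) by (simp add: mult_ac)
    finally have "F (of_real l) = Q r (of_real l) * ((1 + e1 l) * (1 + e2 l) / d\<^sup>2)"
      using d0 by (simp add: field_simps)
    then have "G l = of_real ((cmod (Q r (of_real l)))\<^sup>2) * ((1 + e1 l) * (1 + e2 l) / d\<^sup>2)"
      unfolding G_def complex_norm_square by (simp add: mult_ac)
    then have "Re (G l) = (cmod (Q r (of_real l)))\<^sup>2 * Re ((1 + e1 l) * (1 + e2 l) / d\<^sup>2)"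
      by (simp only: Re_complex_of_real Im_complex_of_real times_complex.sel)
    moreover have "Re ((1 + e1 l) * (1 + e2 l) / d\<^sup>2) > 0"
      unfolding d by (rule Re_perturbed_inverse_square_pos) (use \<delta> l S1(3) S2(3) in auto)
    moreover have "cmod (Q r (of_real l)) > 0" using Q_real_nonzero[OF r, of l] by simp
    ultimately show ?thesis by simp
  qed
  have Gi: "integrable \<sigma> G" unfolding G_def by (rule orth(2))
  have "(LINT l|\<sigma>. Re (G l)) = Re (LINT l|\<sigma>. G l)" using Gi by simp
  also have "(LINT l|\<sigma>. G l) = 0" unfolding G_def by (rule orth(1))
  finally have I0: "(LINT l|\<sigma>. Re (G l)) = 0" by simp
  have nn: "AE l in \<sigma>. 0 \<le> Re (G l)" using gap by eventually_elim (use Gpos less_imp_le in blast)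
  have "AE l in \<sigma>. Re (G l) = 0"
    using integral_nonneg_eq_0_iff_AE[OF integrable_Re[OF Gi] nn] I0 by simp
  \<comment> \<open>The real part has integral 0, is nonnegative, and is strictly positive wherever
    \<sigma> can have mass.\<close>
  then have "AE l in \<sigma>. False" using gap by eventually_elim (use Gpos in force)
  then show False using \<sigma>_nonzero by blast
qed

text \<open>Zeroes are pulled out of \<open>Q r\<close> one at a time as long as the cofactor
  vanishes somewhere in K; \<open>no_factorization\<close> stops this before 2N factors are reached.
  The last cofactor has no zero in K, so the list contains each zero as often as its order, which
  settles finiteness and multiplicity together.\<close>

lemma zero_count_p:
  assumes r: "0 < r" "r \<le> R" and \<delta>: "\<delta> > 0" and gap: "AE l in \<sigma>. \<bar>l - x0\<bar> \<ge> \<delta>"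
    and \<zeta>: "\<zeta> = Complex x0 (\<delta> / 2)"
    and K: "\<And>z. z \<in> K \<Longrightarrow> Im z > 0"
    and \<rho>: "\<And>z. z \<in> K \<Longrightarrow> cmod ((\<zeta> - z) / (\<zeta> - cnj z)) \<le> \<rho>" "\<rho> \<ge> 0" "\<rho> ^ N \<le> 1 / 8" "N \<ge> 1"
  shows "zero_count (p r) K \<le> enat (2 * N)"
proof -
  define factors where "factors n \<longleftrightarrow> (\<exists>zs E. set zs \<subseteq> K \<and> length zs = n \<and> E \<in> transforms r \<and> (\<forall>l. Q r l = (\<Prod>z\<leftarrow>zs. l - z) * E l))" for n
  have "factors 0" unfolding factors_def using Q_transforms[of r] r by (intro exI[of _ "[]"] exI[of _ "Q r"]) auto
  moreover have "\<not> factors (2 * N)" unfolding factors_def using no_factorization[OF r \<delta> gap \<zeta> K \<rho>] by blast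
  ultimately obtain n where n: "n < 2 * N" "factors n" "\<not> factors (Suc n)"
  proof -
    have "\<exists>n<2 * N. factors n \<and> \<not> factors (Suc n)"
    proof (rule ccontr)
      assume no: "\<not> ?thesis"
      have "m \<le> 2 * N \<Longrightarrow> factors m" for m using no \<open>factors 0\<close> by (induction m) auto
      then show False using \<open>\<not> factors (2 * N)\<close> by blast
    qed
    then show thesis using that by blast
  qed
  then obtain zs E where zs: "set zs \<subseteq> K" "length zs = n" and E: "E \<in> transforms r"
    and QE: "\<And>l. Q r l = (\<Prod>z\<leftarrow>zs. l - z) * E l" unfolding factors_def by blast
  have Enz: "E z \<noteq> 0" if "z \<in> K" for z
  proof
    assume "E z = 0"
    obtain G where G: "G \<in> transforms r" "\<And>l. E l - E z = (l - z) * G l"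
      using transforms_difference_quotient[OF E] r by (metis less_imp_le)
    have "Q r l = (\<Prod>y\<leftarrow>z # zs. l - y) * G l" for l
      using QE[of l] G(2)[of l] \<open>E z = 0\<close> by (simp add: mult_ac)
    then have "factors (Suc n)" unfolding factors_def using zs that G(1) by (intro exI[of _ "z # zs"] exI[of _ G]) auto
    then show False using n(3) by blast
  qed
  have zero_set: "{z \<in> K. p r z = 0} = set zs"
    using Enz zs(1) by (auto simp: p_def QE prod_list_zero_iff)
  have Eh: "E holomorphic_on UNIV" by (rule transforms_holomorphic[OF E]) (use r in simp)
  \<comment> \<open>Collects all occurrences of z; the complementary product does not vanish at z,
    so the exponent is the order of the zero.\<close>
  have split: "(\<Prod>y\<leftarrow>zs. l - y) = (l - z) ^ count_list zs z * (\<Prod>y\<leftarrow>filter (\<lambda>y. y \<noteq> z) zs. l - y)" for l z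
    by (induction zs) auto
  have ord: "zorder (p r) z = int (count_list zs z)" if "z \<in> set zs" for z
  proof (rule zorder_eqI[of UNIV])
    define g' where "g' l = exp (\<i> * l * of_real r) * (\<Prod>y\<leftarrow>filter (\<lambda>y. y \<noteq> z) zs. l - y) * E l" for l
    have "(\<lambda>l. \<Prod>y\<leftarrow>ys. l - y) holomorphic_on UNIV" for ys :: "complex list"
      by (induction ys) (auto intro!: holomorphic_intros)
    then show "g' holomorphic_on UNIV" unfolding g'_def by (intro holomorphic_intros Eh)
    show "g' z \<noteq> 0" using Enz[of z] zs(1) that by (auto simp: g'_def prod_list_zero_iff)
    show "p r w = g' w * (w - z) powi int (count_list zs z)" for w
      by (simp add: p_def QE g'_def split[of w z] mult_ac)
  qed auto
  have "(\<Sum>z\<in>set zs. nat (zorder (p r) z)) = (\<Sum>z\<in>set zs. count_list zs z)"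
    by (intro sum.cong) (auto simp: ord)
  also have "\<dots> = n" using sum_count_set[of zs "set zs"] zs(2) by simp
  finally show ?thesis using n(1) unfolding zero_count_def zero_set by simp
qed

end

subsection \<open>Borel representatives\<close>

text \<open>The definitions integrate against the completed measure. There a function equal almost
  everywhere to a Borel function inherits its measurability.\<close>

lemma integral_lebesgue_eq:
  fixes f f0 :: "real \<Rightarrow> complex"
  assumes f0 [measurable]: "f0 \<in> borel_measurable borel" and eq: "AE x in lborel. f x = f0 x"
  shows "(LINT x|lebesgue. f x) = (LINT x|lborel. f0 x)"
proof -
  have f0m: "f0 \<in> borel_measurable lebesgue" using f0 by (simp add: measurable_completion)
  have eq': "AE x in lebesgue. f x = f0 x" using eq by (simp add: AE_completion_iff)
  have fm: "f \<in> borel_measurable lebesgue"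
  proof (rule measurableI)
    fix B :: "complex set" assume B: "B \<in> sets borel"
    have "f0 -` B \<inter> space lebesgue \<in> sets lebesgue" by (rule measurable_sets[OF f0m B])
    moreover have "AE x in lebesgue. x \<in> f0 -` B \<inter> space lebesgue \<longleftrightarrow> x \<in> f -` B \<inter> space lebesgue"
      using eq' by eventually_elim auto
    ultimately show "f -` B \<inter> space lebesgue \<in> sets lebesgue"
      using completion.in_sets_AE[of "f0 -` B \<inter> space lebesgue" "f -` B \<inter> space lebesgue"] by blast
  qed simp
  have "(LINT x|lebesgue. f x) = (LINT x|lebesgue. f0 x)"
    by (rule integral_cong_AE[OF fm f0m eq'])
  then show ?thesis using integral_completion[of f0 lborel] f0 by simp
qed

lemma Borel_representative:
  assumes f: "L2_on {a..b} f"
  obtains f0 where "sq_integrable f0" "\<And>x. x \<notin> {a..b} \<Longrightarrow> f0 x = 0" "AE x in lborel. x \<in> {a..b} \<longrightarrow> f0 x = f x"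
proof -
  define F where "F x = indicator {a..b} x *\<^sub>R f x" for x
  have F: "F \<in> borel_measurable lebesgue"
    using f unfolding L2_on_def set_borel_measurable_def F_def by blast
  have i: "integrable lebesgue (\<lambda>x. (cmod (F x))\<^sup>2)"
  proof -
    have "(\<lambda>x. (cmod (F x))\<^sup>2) = (\<lambda>x. indicator {a..b} x *\<^sub>R (cmod (f x))\<^sup>2)"
      by (auto simp: F_def indicator_def)
    then show ?thesis using f unfolding L2_on_def set_integrable_def by simp
  qed
  obtain u where u [measurable]: "u \<in> borel_measurable lborel" and ue: "AE x in lborel. Re (F x) = u x"
    using completion_ex_borel_measurable_real[of "\<lambda>x. Re (F x)" lborel] F by auto
  obtain v where v [measurable]: "v \<in> borel_measurable lborel" and ve: "AE x in lborel. Im (F x) = v x"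
    using completion_ex_borel_measurable_real[of "\<lambda>x. Im (F x)" lborel] F by auto
  define f0 where "f0 = cut {a..b} (\<lambda>x. of_real (u x) + \<i> * of_real (v x))"
  have f0m [measurable]: "f0 \<in> borel_measurable borel" unfolding f0_def by measurable
  have eq: "AE x in lborel. F x = f0 x"
    using ue ve by eventually_elim (auto simp: f0_def cut_def F_def complex_eq_iff indicator_def)
  have "integrable lebesgue (\<lambda>x. (cmod (f0 x))\<^sup>2)"
  proof (rule integrable_cong_AE_imp[OF i])
    have "(\<lambda>x. (cmod (f0 x))\<^sup>2) \<in> borel_measurable lborel" by measurable
    then show "(\<lambda>x. (cmod (f0 x))\<^sup>2) \<in> borel_measurable lebesgue" by (rule measurable_completion)
    show "AE x in lebesgue. (cmod (F x))\<^sup>2 = (cmod (f0 x))\<^sup>2"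
      using eq by (auto simp: AE_completion_iff elim: eventually_mono)
  qed
  then have "integrable lborel (\<lambda>x. (cmod (f0 x))\<^sup>2)" by (subst (asm) integrable_completion) auto
  then have "sq_integrable f0" using f0m by (simp add: sq_integrable_def)
  moreover have "f0 x = 0" if "x \<notin> {a..b}" for x using that by (auto simp: f0_def cut_def)
  moreover have "AE x in lborel. x \<in> {a..b} \<longrightarrow> f0 x = f x"
    using eq by eventually_elim (auto simp: F_def)
  ultimately show thesis by (rule that)
qed

lemma set_integral_lebesgue_eq:
  fixes f f0 :: "real \<Rightarrow> complex"
  assumes "f0 \<in> borel_measurable borel" "AE x in lborel. indicator S x *\<^sub>R f x = f0 x"
  shows "(LINT x:S|lebesgue. f x) = (LINT x|lborel. f0 x)"
  unfolding set_lebesgue_integral_def by (rule integral_lebesgue_eq[OF assms])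

lemma Hermitian_representative:
  assumes H: "L2_loc_line H" "AE x in lebesgue. H (- x) = cnj (H x)" and R: "R > 0"
  obtains h where "sq_integrable h" "\<And>x. x \<notin> {-R..R} \<Longrightarrow> h x = 0" "\<And>x. h (- x) = cnj (h x)"
    "AE x in lborel. x \<in> {-R..R} \<longrightarrow> h x = H x"
proof -
  have "L2_on {-R..R} H" using H(1) R by (simp add: L2_loc_line_def)
  from Borel_representative[OF this] obtain h1 where h1: "sq_integrable h1" "\<And>x. x \<notin> {-R..R} \<Longrightarrow> h1 x = 0"
    "AE x in lborel. x \<in> {-R..R} \<longrightarrow> h1 x = H x" by blast
  \<comment> \<open>Averaging with the reflected conjugate makes the symmetry hold everywhere.
    Almost everywhere on [-R, R] nothing changes, as H is Hermitian almost everywhere.\<close>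
  define h where "h x = (1 / 2) * (h1 x + cnj (h1 (- x)))" for x
  have "sq_integrable (\<lambda>x. cnj (h1 (0 - x)))" by (rule sq_integrable_cnj(1)[OF sq_integrable_affine(1)[OF h1(1)]])
  then have "sq_integrable h"
    unfolding h_def by (intro sq_integrable_cmult sq_integrable_add h1(1)) simp
  moreover have "h x = 0" if "x \<notin> {-R..R}" for x using that h1(2)[of x] h1(2)[of "- x"] by (auto simp: h_def)
  moreover have "h (- x) = cnj (h x)" for x by (simp add: h_def)
  moreover have "AE x in lborel. x \<in> {-R..R} \<longrightarrow> h x = H x"
  proof -
    have "AE x in lborel. H (- x) = cnj (H x)" using H(2) by (simp add: AE_completion_iff)
    moreover have "AE x in lborel. 0 - x \<in> {-R..R} \<longrightarrow> h1 (0 - x) = H (0 - x)"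
      by (rule AE_lborel_reflect[OF h1(3)])
    ultimately show ?thesis using h1(3) by eventually_elim (auto simp: h_def)
  qed
  ultimately show thesis by (rule that)
qed

text \<open>Cutting H off outside [-R, R] is harmless here: for t and u in [0, r] the difference t -
  u stays in that interval.\<close>

lemma conv_op_eq_conv:
  assumes h: "h \<in> borel_measurable borel" "AE x in lborel. x \<in> {-R..R} \<longrightarrow> h x = H x"
    and f: "f0 \<in> borel_measurable borel" "AE u in lborel. u \<in> {0..r} \<longrightarrow> f0 u = f u" "\<And>u. u \<notin> {0..r} \<Longrightarrow> f0 u = 0"
    and r: "r \<le> R" and t: "t \<in> {0..r}"
  shows "(LINT u:{0..r}|lebesgue. H (t - u) * f u) = conv h f0 t"
  unfolding conv_def
proof (rule set_integral_lebesgue_eq)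
  show "(\<lambda>u. h (t - u) * f0 u) \<in> borel_measurable borel" using h(1) f(1) by measurable
  have "AE u in lborel. t - u \<in> {-R..R} \<longrightarrow> h (t - u) = H (t - u)" by (rule AE_lborel_reflect[OF h(2)])
  then show "AE u in lborel. indicator {0..r} u *\<^sub>R (H (t - u) * f u) = h (t - u) * f0 u"
    using f(2)
  proof eventually_elim
    case (elim u)
    then show ?case using t r f(3)[of u] by (cases "u \<in> {0..r}") auto
  qed
qed

text \<open>|x|/2 is max x 0 - x/2, and the oriented integral is the integral against max (x - s) 0
  minus that of x - s over the negative half-line. The differences are affine in x and join the
  \<beta>-term in a0 and a1.\<close>

lemma spectral_integrand_identity:
  assumes h: "sq_integrable h" "\<And>x. x \<notin> {-R..R} \<Longrightarrow> h x = 0" "AE x in lborel. x \<in> {-R..R} \<longrightarrow> h x = H x" and R: "R > 0"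
    and id: "\<And>x::real. of_real (\<bar>x\<bar> / 2) + (LINT s=ereal 0..ereal x|lebesgue. (of_real (x - s) * H s)) =
          \<i> * of_real (\<beta> * x) + (LINT l|\<sigma>. spectral_integrand x l)"
  obtains a0 a1 where "\<And>x. x \<in> {-R..R} \<Longrightarrow> (LINT l|\<sigma>. spectral_integrand x l) =
      of_real (max x 0) + (LINT s|lborel. of_real (max (x - s) 0) * h s) + a0 + a1 * of_real x"
proof -
  have [measurable]: "h \<in> borel_measurable borel" using h(1) by measurable
  have hi: "integrable lborel h" using sq_integrable_imp_integrable(1)[OF h(1), of "-R" R] h(2) R by simp
  define n where "n = cut {..<0} h"
  have [measurable]: "n \<in> borel_measurable borel" unfolding n_def by measurable
  have n0: "n t = 0" if "t \<notin> {-R..R}" for t using h(2)[OF that] by (simp add: n_def cut_def)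
  have ni: "integrable lborel n"
    by (rule Bochner_Integration.integrable_bound[OF hi]) (auto simp: n_def cut_def)
  have sni: "integrable lborel (\<lambda>s. of_real s * n s)"
  proof (rule Bochner_Integration.integrable_bound)
    show "integrable lborel (\<lambda>s. R * cmod (n s))" using ni by simp
    have "cmod (of_real s * n s) \<le> R * cmod (n s)" for s
      using n0[of s] by (cases "s \<in> {-R..R}") (auto simp: norm_mult intro!: mult_right_mono)
    then show "AE s in lborel. norm (of_real s * n s) \<le> norm (R * cmod (n s))" using R by (simp add: abs_mult)
  qed measurable
  define m0 where "m0 = (LINT s|lborel. n s)"
  define m1 where "m1 = (LINT s|lborel. of_real s * n s)"
  have J: "(LINT s=ereal 0..ereal x|lebesgue. (of_real (x - s) * H s)) =
      (LINT s|lborel. of_real (max (x - s) 0) * h s) - (of_real x * m0 - m1)" if x: "x \<in> {-R..R}" for x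
  proof -
    define k where "k s = of_real (max (x - s) 0) * h s - (of_real x * n s - of_real s * n s)" for s
    have km: "k \<in> borel_measurable borel" unfolding k_def by measurable
    have hmax: "integrable lborel (\<lambda>s. of_real (max (x - s) 0) * h s)"
      by (rule hinge_integrable[OF hi h(2)]) (use R in auto)
    have kI: "(LINT s|lborel. k s) = (LINT s|lborel. of_real (max (x - s) 0) * h s) - (of_real x * m0 - m1)"
      unfolding k_def m0_def m1_def using hmax ni sni by simp
    have "(LINT s=ereal 0..ereal x|lebesgue. (of_real (x - s) * H s)) = (LINT s|lborel. k s)"
    proof (cases "0 \<le> x")
      case True
      have "(LINT s:einterval (ereal 0) (ereal x)|lebesgue. of_real (x - s) * H s) = (LINT s|lborel. k s)"
      proof (rule set_integral_lebesgue_eq[OF km])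
        show "AE s in lborel. indicator (einterval (ereal 0) (ereal x)) s *\<^sub>R (of_real (x - s) * H s) = k s"
          using h(3) AE_lborel_singleton[of 0] AE_lborel_singleton[of x]
        proof eventually_elim
          case (elim s)
          consider "s < 0" | "0 < s" "s < x" | "x < s" using elim(2,3) True by linarith
          then show ?case
            using elim x True by cases (auto simp: k_def n_def cut_def einterval_iff indicator_def algebra_simps)
        qed
      qed
      then show ?thesis using True by (simp add: interval_lebesgue_integral_def)
    next
      case False
      have "(LINT s:einterval (ereal x) (ereal 0)|lebesgue. of_real (x - s) * H s) = (LINT s|lborel. - k s)"
      proof (rule set_integral_lebesgue_eq)
        show "(\<lambda>s. - k s) \<in> borel_measurable borel" using km by measurable
        show "AE s in lborel. indicator (einterval (ereal x) (ereal 0)) s *\<^sub>R (of_real (x - s) * H s) = - k s"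
          using h(3) AE_lborel_singleton[of 0] AE_lborel_singleton[of x]
        proof eventually_elim
          case (elim s)
          consider "s < x" | "x < s" "s < 0" | "0 < s" using elim(2,3) False by linarith
          then show ?case
            using elim x False by cases (auto simp: k_def n_def cut_def einterval_iff indicator_def algebra_simps)
        qed
      qed
      then show ?thesis using False by (simp add: interval_lebesgue_integral_def)
    qed
    then show ?thesis using kI by simp
  qed
  show thesis
  proof (rule that[of m1 "- (1 / 2) - m0 - \<i> * of_real \<beta>"])
    fix x assume x: "x \<in> {-R..R}"
    have ab: "complex_of_real (\<bar>x\<bar> / 2) = of_real (max x 0) - of_real x / 2"
      by (cases "x \<ge> 0") (auto simp: max_def)
    define I where "I = (LINT s|lborel. of_real (max (x - s) 0) * h s)"
    have "(LINT l|\<sigma>. spectral_integrand x l) = of_real (max x 0) - of_real x / 2 + (I - (of_real x * m0 - m1)) - \<i> * of_real (\<beta> * x)"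
      using id[of x] unfolding ab J[OF x] I_def[symmetric] by (simp add: algebra_simps)
    then show "(LINT l|\<sigma>. spectral_integrand x l) = of_real (max x 0) + (LINT s|lborel. of_real (max (x - s) 0) * h s) + m1 + (- (1 / 2) - m0 - \<i> * of_real \<beta>) * of_real x"
      unfolding I_def[symmetric] by (simp add: algebra_simps)
  qed
qed

section \<open>From the original data to the locale, and the uniform bound\<close>

text \<open>The locale is instantiated with R equal to the very radius at which zeroes are counted.
  Its auxiliary constants grow with R, but 2N is fixed by the gap and K alone, which is what a
  supremum over all radii requires.\<close>

lemma zero_count_bound:
  assumes A: "L2_loc_halfline A" and krein: "krein_system A P Ps" and spec: "spectral_measure A \<sigma>"
    and R: "R > 0" and \<delta>: "\<delta> > 0" and gap: "AE l in \<sigma>. \<bar>l - x0\<bar> \<ge> \<delta>"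
    and \<zeta>: "\<zeta> = Complex x0 (\<delta> / 2)"
    and K: "\<And>z. z \<in> K \<Longrightarrow> Im z > 0"
    and \<rho>: "\<And>z. z \<in> K \<Longrightarrow> cmod ((\<zeta> - z) / (\<zeta> - cnj z)) \<le> \<rho>" "\<rho> \<ge> 0" "\<rho> ^ N \<le> 1 / 8" "N \<ge> 1"
  shows "zero_count (P R) K \<le> enat (2 * N)"
proof -
  obtain H \<beta> where AH: "accelerant_of A H"
    and id: "\<And>x::real. of_real (\<bar>x\<bar> / 2) + (LINT s=ereal 0..ereal x|lebesgue. (of_real (x - s) * H s)) =
          \<i> * of_real (\<beta> * x) + (LINT l|\<sigma>. spectral_integrand x l)"
    using spec unfolding spectral_measure_def by blast
  have sets_\<sigma>: "sets \<sigma> = sets borel" and fin: "(\<integral>\<^sup>+ l. ennreal (1 / (1 + l\<^sup>2)) \<partial>\<sigma>) < \<infinity>"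
    using spec unfolding spectral_measure_def by auto
  obtain G where acc: "accelerant H" and G: "\<And>r. r > 0 \<Longrightarrow> resolvent_kernel H r (G r)"
    and AG: "AE r\<in>{0<..} in lebesgue. cnj (A r) = H r - (LINT u:{0..r}|lebesgue. H (r - u) * G r u 0)"
    using AH unfolding accelerant_of_def by blast
  have H: "L2_loc_line H" "AE x in lebesgue. H (- x) = cnj (H x)" and pos: "\<And>r. r > 0 \<Longrightarrow> positive_operator r (\<lambda>f x. f x + conv_op H r f x)"
    using acc unfolding accelerant_def by auto
  obtain h where h: "sq_integrable h" "\<And>x. x \<notin> {-R..R} \<Longrightarrow> h x = 0" "\<And>x. h (- x) = cnj (h x)"
    "AE x in lborel. x \<in> {-R..R} \<longrightarrow> h x = H x"
    using Hermitian_representative[OF H R] by blast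
  have [measurable]: "h \<in> borel_measurable borel" using h(1) by measurable
  have "L2_on {0..R} A" using A R by (simp add: L2_loc_halfline_def)
  from Borel_representative[OF this] obtain A0 where A0: "sq_integrable A0" "\<And>x. x \<notin> {0..R} \<Longrightarrow> A0 x = 0"
    "AE x in lborel. x \<in> {0..R} \<longrightarrow> A0 x = A x" by blast
  have [measurable]: "A0 \<in> borel_measurable borel" using A0(1) by measurable
  have "\<exists>f0. sq_integrable f0 \<and> (\<forall>x. x \<notin> {0..r} \<longrightarrow> f0 x = 0) \<and> (0 < r \<longrightarrow> (AE x in lborel. x \<in> {0..r} \<longrightarrow> f0 x = G r x 0))" for r
  proof (cases "0 < r")
    case True
    then have "L2_on {0..r} (\<lambda>t. G r t 0)" using G[OF True] by (auto simp: resolvent_kernel_def)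
    from Borel_representative[OF this] show ?thesis by blast
  next
    case False
    have "sq_integrable (\<lambda>x. 0)" by (simp add: sq_integrable_def)
    then show ?thesis using False by (intro exI[of _ "\<lambda>x. 0"]) auto
  qed
  then obtain g where g: "\<And>r. sq_integrable (g r)" "\<And>r x. x \<notin> {0..r} \<Longrightarrow> g r x = 0"
    "\<And>r. 0 < r \<Longrightarrow> AE x in lborel. x \<in> {0..r} \<longrightarrow> g r x = G r x 0" by metis
  have gm: "g r \<in> borel_measurable borel" for r using g(1) by measurable
  have conv_g: "(LINT u:{0..r}|lebesgue. H (t - u) * G r u 0) = conv h (g r) t" if "0 < r" "r \<le> R" "t \<in> {0..r}" for r t
    by (rule conv_op_eq_conv[OF _ h(4) gm g(3)[OF that(1)] g(2) that(2,3)]) measurable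
  obtain a0 a1 where ida: "\<And>x. x \<in> {-R..R} \<Longrightarrow> (LINT l|\<sigma>. spectral_integrand x l) =
      of_real (max x 0) + (LINT s|lborel. of_real (max (x - s) 0) * h s) + a0 + a1 * of_real x"
    using spectral_integrand_identity[OF h(1,2,4) R id] by metis
  interpret spectral_accelerant R h g A0 \<sigma> a0 a1
  proof
    show "g r x = 0" if "x \<notin> {0..r}" for x r using g(2)[OF that] .
    show "sq_integrable (g r)" for r by (rule g(1))
    show "AE t in lborel. t \<in> {0..r} \<longrightarrow> g r t + conv h (g r) t = h t" if r: "0 < r" "r \<le> R" for r
    proof -
      have "AE t\<in>{0..r} in lebesgue. G r t 0 + (LINT u:{0..r}|lebesgue. H (t - u) * G r u 0) = H (t - 0)"
        using bspec[OF G[OF r(1), unfolded resolvent_kernel_def], of 0] r(1) by simp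
      then have "AE t in lborel. t \<in> {0..r} \<longrightarrow> G r t 0 + (LINT u:{0..r}|lebesgue. H (t - u) * G r u 0) = H (t - 0)"
        by (simp only: AE_completion_iff)
      then show ?thesis using g(3)[OF r(1)] h(4)
        by eventually_elim (use r conv_g[OF r] in auto)
    qed
    \<comment> \<open>Injectivity from positivity: a nonzero element of the kernel would make the
      quadratic form vanish.\<close>
    show "AE t in lborel. f t = 0"
      if \<rho>: "0 < \<rho>" "\<rho> \<le> R" and f: "sq_integrable f" "\<And>x. x \<notin> {0..\<rho>} \<Longrightarrow> f x = 0"
        and zero: "AE t in lborel. t \<in> {0..\<rho>} \<longrightarrow> f t + conv h f t = 0" for \<rho> f
    proof (rule ccontr)
      assume nz: "\<not> (AE t in lborel. f t = 0)"
      have fm [measurable]: "f \<in> borel_measurable borel" using f(1) by measurable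
      have "L2_on {0..\<rho>} f"
        unfolding L2_on_def
      proof
        have "(\<lambda>x. indicator {0..\<rho>} x *\<^sub>R f x) \<in> borel_measurable lborel" by measurable
        then show "set_borel_measurable lebesgue {0..\<rho>} f"
          unfolding set_borel_measurable_def by (rule measurable_completion)
        have "indicator {0..\<rho>} x *\<^sub>R (cmod (f x))\<^sup>2 = (cmod (f x))\<^sup>2" for x
          using f(2)[of x] by (cases "x \<in> {0..\<rho>}") auto
        moreover have "integrable lebesgue (\<lambda>x. (cmod (f x))\<^sup>2)"
          using sq_integrableD[OF f(1)] by (subst integrable_completion) auto
        ultimately show "set_integrable lebesgue {0..\<rho>} (\<lambda>x. (cmod (f x))\<^sup>2)"
          unfolding set_integrable_def by (simp only:)
      qed
      moreover have "\<not> (AE x\<in>{0..\<rho>} in lebesgue. f x = 0)"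
      proof
        assume "AE x\<in>{0..\<rho>} in lebesgue. f x = 0"
        then have "AE x in lborel. x \<in> {0..\<rho>} \<longrightarrow> f x = 0" by (simp only: AE_completion_iff)
        then have "AE x in lborel. f x = 0" by eventually_elim (use f(2) in blast)
        then show False using nz by blast
      qed
      ultimately have "Re (L2_inner \<rho> (\<lambda>x. f x + conv_op H \<rho> f x) f) > 0"
        using pos[OF \<rho>(1)] unfolding positive_operator_def by blast
      moreover have "L2_inner \<rho> (\<lambda>x. f x + conv_op H \<rho> f x) f = 0"
        unfolding L2_inner_def set_lebesgue_integral_def
      proof (rule integral_eq_zero_AE)
        have ch: "conv_op H \<rho> f x = conv h f x" if "x \<in> {0..\<rho>}" for x
          unfolding conv_op_def by (rule conv_op_eq_conv[OF _ h(4) fm _ f(2) \<rho>(2) that]) auto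
        have "AE x in lborel. indicator {0..\<rho>} x *\<^sub>R ((f x + conv_op H \<rho> f x) * cnj (f x)) = 0"
          using zero by eventually_elim (use ch in \<open>auto simp: indicator_def\<close>)
        then show "AE x in lebesgue. indicator {0..\<rho>} x *\<^sub>R ((f x + conv_op H \<rho> f x) * cnj (f x)) = 0"
          by (simp only: AE_completion_iff)
      qed
      ultimately show False by simp
    qed
    show "A0 x = 0" if "x \<notin> {-R..R}" for x using A0(2)[of x] that R by auto
    show "AE r in lborel. r \<in> {0<..R} \<longrightarrow> cnj (A0 r) = h r - conv h (g r) r"
    proof -
      have "AE r in lborel. r \<in> {0<..} \<longrightarrow> cnj (A r) = H r - (LINT u:{0..r}|lebesgue. H (r - u) * G r u 0)"
        using AG by (simp only: AE_completion_iff)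
      then show ?thesis using A0(3) h(4)
        by eventually_elim (use conv_g R in auto)
    qed
    show "integrable \<sigma> (\<lambda>l. 1 / (1 + l\<^sup>2))"
    proof (rule integrableI_bounded)
      show "(\<lambda>l. 1 / (1 + l\<^sup>2)) \<in> borel_measurable \<sigma>" using sets_\<sigma> by (simp cong: measurable_cong_sets)
      have "norm (1 / (1 + l\<^sup>2)) = 1 / (1 + l\<^sup>2)" for l :: real by simp
      then show "(\<integral>\<^sup>+ l. ennreal (norm (1 / (1 + l\<^sup>2))) \<partial>\<sigma>) < \<infinity>" using fin by simp
    qed
  qed (use R h(1,2,3) A0(1) sets_\<sigma> ida in auto)
  \<comment> \<open>The given solution meets the function built from the resolvent kernel: on [0, R]
    the replacement of A by its representative does not change the integral equations.\<close>
  have "P R l = p R l" for l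
  proof (rule krein_unique[where Ps = "\<lambda>r. Ps r l"])
    have cP: "continuous_on {0..} (\<lambda>r. P r l)" and cPs: "continuous_on {0..} (\<lambda>r. Ps r l)"
      using krein unfolding krein_system_def by auto
    show cP': "continuous_on {0..R} (\<lambda>r. P r l)" and cPs': "continuous_on {0..R} (\<lambda>r. Ps r l)"
      by (rule continuous_on_subset[OF cP], auto) (rule continuous_on_subset[OF cPs], auto)
    show "R \<in> {0..R}" using R by simp
    fix r assume r: "r \<in> {0..R}"
    note ints = integrable_A_continuous[OF _ order_refl, of _ r]
    have "P r l = 1 + (LINT s:{0..r}|lebesgue. \<i> * l * P s l - cnj (A s) * Ps s l)"
      using krein r unfolding krein_system_def by auto
    also have "(LINT s:{0..r}|lebesgue. \<i> * l * P s l - cnj (A s) * Ps s l) = (LINT u|lborel. indicator {0<..r} u *\<^sub>R (\<i> * l * P u l - cnj (A0 u) * Ps u l))"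
    proof (rule set_integral_lebesgue_eq)
      have "integrable lborel (\<lambda>u. indicator {0<..r} u *\<^sub>R (\<i> * l * P u l - cnj (A0 u) * Ps u l))"
        unfolding scaleR_diff_right
        by (intro Bochner_Integration.integrable_diff ints continuous_intros cP' cPs') (use r in auto)
      then show "(\<lambda>u. indicator {0<..r} u *\<^sub>R (\<i> * l * P u l - cnj (A0 u) * Ps u l)) \<in> borel_measurable borel"
        by (auto dest: borel_measurable_integrable)
      show "AE s in lborel. indicator {0..r} s *\<^sub>R (\<i> * l * P s l - cnj (A s) * Ps s l) = indicator {0<..r} s *\<^sub>R (\<i> * l * P s l - cnj (A0 s) * Ps s l)"
        using A0(3) AE_lborel_singleton[of 0] by eventually_elim (use r in \<open>auto simp: indicator_def\<close>)
    qed
    finally show "P r l = 1 + (LINT u|lborel. indicator {0<..r} u *\<^sub>R (\<i> * l * P u l - cnj (A0 u) * Ps u l))" .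
    have "Ps r l = 1 + (LINT s:{0..r}|lebesgue. - A s * P s l)"
      using krein r unfolding krein_system_def by auto
    also have "(LINT s:{0..r}|lebesgue. - A s * P s l) = (LINT u|lborel. - (indicator {0<..r} u *\<^sub>R (A0 u * P u l)))"
    proof (rule set_integral_lebesgue_eq)
      have "integrable lborel (\<lambda>u. indicator {0<..r} u *\<^sub>R (A0 u * P u l))"
        by (intro ints cP') (use r in auto)
      then show "(\<lambda>u. - (indicator {0<..r} u *\<^sub>R (A0 u * P u l))) \<in> borel_measurable borel"
        by (auto dest: borel_measurable_integrable)
      show "AE s in lborel. indicator {0..r} s *\<^sub>R (- A s * P s l) = - (indicator {0<..r} s *\<^sub>R (A0 s * P s l))"
        using A0(3) AE_lborel_singleton[of 0] by eventually_elim (use r in \<open>auto simp: indicator_def\<close>)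
    qed
    finally show "Ps r l = 1 - (LINT u|lborel. indicator {0<..r} u *\<^sub>R (A0 u * P u l))" by simp
  qed
  then have "P R = p R" by (rule ext)
  then show ?thesis using zero_count_p[OF R order_refl \<delta> gap \<zeta> K \<rho>] by simp
qed

theorem theorem10p3:
  fixes A :: "real \<Rightarrow> complex" and P Ps :: "real \<Rightarrow> complex \<Rightarrow> complex"
    and \<sigma> :: "real measure" and K :: "complex set"
  assumes "L2_loc_halfline A"
    and "krein_system A P Ps"
    and "spectral_measure A \<sigma>"
    and "measure_support \<sigma> \<noteq> UNIV"
    and "compact K" and "K \<subseteq> {z. Im z > 0}"
  shows "(SUP r\<in>{0<..}. zero_count (P r) K) < \<infinity>"
proof -
  have sets_\<sigma>: "sets \<sigma> = sets borel" using assms(3) unfolding spectral_measure_def by blast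
  obtain x0 where "x0 \<notin> measure_support \<sigma>" using assms(4) by blast
  then obtain U where U: "open U" "x0 \<in> U" "emeasure \<sigma> U = 0" by (auto simp: measure_support_def)
  obtain \<delta> where \<delta>: "\<delta> > 0" "ball x0 \<delta> \<subseteq> U" using U(1,2) openE by blast
  have "U \<in> null_sets \<sigma>" using U(1,3) sets_\<sigma> by (intro null_setsI) auto
  then have gap: "AE l in \<sigma>. \<bar>l - x0\<bar> \<ge> \<delta>"
    by (rule AE_I') (use \<delta>(2) in \<open>auto simp: ball_def dist_real_def abs_minus_commute not_le\<close>)
  \<comment> \<open>At height \<delta>/2 above the centre of the gap, points of the support are at
    horizontal distance at least twice the height, as \<open>Re_perturbed_inverse_square_pos\<close>
    demands.\<close>
  define \<zeta> where "\<zeta> = Complex x0 (\<delta> / 2)"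
  have K: "Im z > 0" if "z \<in> K" for z using assms(6) that by blast
  have nz: "\<zeta> - cnj z \<noteq> 0" if "z \<in> K" for z
    using K[OF that] \<delta>(1) by (auto simp: \<zeta>_def complex_eq_iff)
  define q where "q z = cmod ((\<zeta> - z) / (\<zeta> - cnj z))" for z
  \<comment> \<open>The pseudohyperbolic distance from \<zeta> to a point of the upper half-plane;
    compactness of K keeps it away from 1, uniformly in the position of the zeroes.\<close>
  have q1: "q z < 1" if "z \<in> K" for z
  proof -
    have "(\<delta> / 2 - Im z)\<^sup>2 < (\<delta> / 2 + Im z)\<^sup>2"
      using mult_pos_pos[OF \<delta>(1) K[OF that]] by (simp add: power2_eq_square algebra_simps)
    then have "cmod (\<zeta> - z) < cmod (\<zeta> - cnj z)" by (simp add: cmod_def \<zeta>_def)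
    then show ?thesis using nz[OF that] by (simp add: q_def norm_divide)
  qed
  obtain \<rho> where \<rho>: "0 \<le> \<rho>" "\<rho> < 1" "\<And>z. z \<in> K \<Longrightarrow> q z \<le> \<rho>"
  proof (cases "K = {}")
    case True
    then show thesis using that[of 0] by simp
  next
    case False
    have "continuous_on K q" unfolding q_def by (intro continuous_intros) (use nz in auto)
    from continuous_attains_sup[OF assms(5) False this] obtain z where "z \<in> K" "\<And>y. y \<in> K \<Longrightarrow> q y \<le> q z" by blast
    then show thesis using that[of "q z"] q1 by (auto simp: q_def)
  qed
  obtain n where n: "\<rho> ^ n < 1 / 8" using real_arch_pow_inv[of "1 / 8" \<rho>] \<rho>(2) by auto
  \<comment> \<open>The successor serves to have N at least 1, so that both groups of zeroes are
    nonempty.\<close>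
  have "\<rho> ^ Suc n \<le> \<rho> ^ n" using \<rho> by (intro power_decreasing) auto
  then have N: "\<rho> ^ Suc n \<le> 1 / 8" using n by linarith
  have "zero_count (P r) K \<le> enat (2 * Suc n)" if "r \<in> {0<..}" for r
    by (rule zero_count_bound[OF assms(1-3) _ \<delta>(1) gap \<zeta>_def K \<rho>(3)[unfolded q_def] \<rho>(1) N]) (use that in auto)
  then have "(SUP r\<in>{0<..}. zero_count (P r) K) \<le> enat (2 * Suc n)" by (rule SUP_least)
  then show ?thesis using enat_ord_code(4) order_le_less_trans by blast
qed

end
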